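(* Let $C\subset\mathbb{P}^2$ be an integral projective plane curve over $\mathbb{C}$ of degree $d\ge 2$ and let $q\in C$ be an $(m,n)$-point; set $c=\gcd(n,m)$. Then $$\delta(q)\ \ge\ \frac{nm-n-m+c}{2},$$ with equality if $c=1$.
   Context: A point $q$ of an integral curve $C$ is unibranch if it has exactly one preimage in the normalization of $C$. For an integral plane curve $C\subset\mathbb{P}^2$ of degree at least $2$ and a unibranch point $q\in C$ (smooth or singular), let $L$ be the tangent line to $C$ at $q$; $q$ is an $(m,n)$-point of $C$ if $m=\operatorname{mult}_q(C)$ is the multiplicity of $C$ at $q$ and $n=(C\cdot L)_q$ is the intersection multiplicity; one has $n>m>0$. $\delta(q)$ is the delta-invariant of $C$ at $q$, given by $\delta(q)=\sum_p m_p(m_p-1)/2$, where $p$ runs over $q$ and all points infinitely near to $q$ (the points lying over $q$ in the proper transforms of $C$ under successive blow-ups) and $m_p$ is the multiplicity at $p$ of the corresponding proper transform of $C$. *)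

theory Defs
  imports
    "HOL-Analysis.Infinite_Sum"
    "HOL-Computational_Algebra.Polynomial_Factorial"
    "HOL-Algebra.QuotRing"
begin

section \<open>Polynomials in two and three variables\<close>

text \<open>
  Polynomials in several variables are iterated univariate ones, the first variable being the
  innermost: \<open>\<complex>[x, y] = \<complex>[x][y]\<close> and \<open>\<complex>[X, Y, Z] = \<complex>[X][Y][Z]\<close>.
\<close>

type_synonym poly2 = "complex poly poly"
type_synonym poly3 = "complex poly poly poly"

definition const2 :: "complex \<Rightarrow> poly2" where
  "const2 c = [:[:c:]:]"

definition var_x :: poly2 where
  "var_x = [:[:0, 1:]:]"

definition var_y :: poly2 where
  "var_y = [:0, 1:]"

definition coeff2 :: "poly2 \<Rightarrow> nat \<Rightarrow> nat \<Rightarrow> complex" where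
  "coeff2 f i j = coeff (coeff f j) i"

definition coeff3 :: "poly3 \<Rightarrow> nat \<Rightarrow> nat \<Rightarrow> nat \<Rightarrow> complex" where
  "coeff3 F i j k = coeff (coeff (coeff F k) j) i"

definition subst2 :: "poly2 \<Rightarrow> poly2 \<Rightarrow> poly2 \<Rightarrow> poly2" where
  "subst2 f a b = poly (map_poly (\<lambda>p. poly (map_poly const2 p) a) f) b"

definition subst3 :: "poly3 \<Rightarrow> poly2 \<Rightarrow> poly2 \<Rightarrow> poly2 \<Rightarrow> poly2" where
  "subst3 F a b c = poly (map_poly (\<lambda>f. subst2 f a b) F) c"

definition homogeneous :: "nat \<Rightarrow> poly3 \<Rightarrow> bool" where
  "homogeneous d F \<longleftrightarrow> (\<forall>i j k. coeff3 F i j k \<noteq> 0 \<longrightarrow> i + j + k = d)"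


section \<open>Plane curves\<close>

text \<open>
  An integral plane curve of degree \<open>d\<close> is given by its equation, an irreducible form of degree
  \<open>d\<close>, which it determines up to a nonzero constant. A point of the projective plane is given
  by a nonzero triple of homogeneous coordinates.
\<close>

definition integral_curve :: "nat \<Rightarrow> poly3 \<Rightarrow> bool" where
  "integral_curve d F \<longleftrightarrow> homogeneous d F \<and> irreducible F"

definition line :: "poly3 \<Rightarrow> bool" where
  "line L \<longleftrightarrow> homogeneous 1 L \<and> L \<noteq> 0"

type_synonym point = "complex \<times> complex \<times> complex"

definition on_curve :: "point \<Rightarrow> poly3 \<Rightarrow> bool" where
  "on_curve q F \<longleftrightarrow> q \<noteq> (0, 0, 0) \<and>
     (case q of (a, b, c) \<Rightarrow> poly (poly (poly F [:[:c:]:]) [:b:]) a = 0)"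

text \<open>
  The equation of the curve in the first of the three standard affine charts that contains \<open>q\<close>,
  with the affine coordinates translated so that \<open>q\<close> becomes the origin. It depends only on the
  point, not on the representing triple.
\<close>

definition local_eq :: "poly3 \<Rightarrow> point \<Rightarrow> poly2" where
  "local_eq F q = (case q of (a, b, c) \<Rightarrow>
     if a \<noteq> 0 then subst3 F 1 (const2 (b / a) + var_x) (const2 (c / a) + var_y)
     else if b \<noteq> 0 then subst3 F (const2 (a / b) + var_x) 1 (const2 (c / b) + var_y)
     else subst3 F (const2 (a / c) + var_x) (const2 (b / c) + var_y) 1)"


section \<open>Multiplicity and tangent lines\<close>

text \<open>The multiplicity of the affine curve \<open>f = 0\<close> at the origin (for \<open>f \<noteq> 0\<close>).\<close>

definition mult_origin :: "poly2 \<Rightarrow> nat" where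
  "mult_origin f = (LEAST m. \<exists>i j. i + j = m \<and> coeff2 f i j \<noteq> 0)"

definition multiplicity_at :: "poly3 \<Rightarrow> point \<Rightarrow> nat" where
  "multiplicity_at F q = mult_origin (local_eq F q)"

text \<open>The homogeneous part of lowest degree, which defines the tangent cone at the origin.\<close>

definition initial_form :: "poly2 \<Rightarrow> poly2" where
  "initial_form f = (\<Sum>i\<le>mult_origin f.
     monom (monom (coeff2 f i (mult_origin f - i)) i) (mult_origin f - i))"

text \<open>
  The tangent lines at \<open>q\<close> are the lines contained in the tangent cone. At a unibranch point
  there is exactly one.
\<close>

definition tangent_line :: "poly3 \<Rightarrow> point \<Rightarrow> poly3 \<Rightarrow> bool" where
  "tangent_line F q L \<longleftrightarrow>
     line L \<and> on_curve q L \<and> local_eq L q dvd initial_form (local_eq F q)"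


section \<open>Intersection multiplicity\<close>

definition local_ring :: "poly2 fract set" where
  "local_ring = {Fract a b | a b. coeff2 b 0 0 \<noteq> 0}"

text \<open>
  The dimension over \<open>\<complex>\<close> of the quotient of the local ring of the plane at the origin by the
  ideal generated by \<open>f\<close> and \<open>g\<close>, as the least size of a family spanning it modulo the ideal.
  This presupposes that the dimension is finite, i.e.\ that \<open>f\<close> and \<open>g\<close> have no common
  component through the origin.
\<close>

definition intersection_origin :: "poly2 \<Rightarrow> poly2 \<Rightarrow> nat" where
  "intersection_origin f g = (LEAST k. \<exists>e :: nat \<Rightarrow> poly2 fract.
     (\<forall>i<k. e i \<in> local_ring) \<and>
     (\<forall>h\<in>local_ring. \<exists>c :: nat \<Rightarrow> complex. \<exists>u\<in>local_ring. \<exists>v\<in>local_ring.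
        h = (\<Sum>i<k. Fract (const2 (c i)) 1 * e i) + Fract f 1 * u + Fract g 1 * v))"

definition intersection_multiplicity :: "poly3 \<Rightarrow> poly3 \<Rightarrow> point \<Rightarrow> nat" where
  "intersection_multiplicity F G q = intersection_origin (local_eq F q) (local_eq G q)"


section \<open>The normalization and unibranch points\<close>

text \<open>
  In this section \<open>f\<close> is the irreducible equation of an affine curve through the origin. Its
  function field is the residue field of \<open>\<complex>[x, y]\<close> at the prime ideal \<open>(f)\<close>: the rational
  functions on the plane with denominator not divisible by \<open>f\<close>, modulo those with numerator
  divisible by \<open>f\<close>.
\<close>

definition generic_ring :: "poly2 \<Rightarrow> poly2 fract ring" where
  "generic_ring f =
     \<lparr>carrier = {Fract a b | a b. \<not> f dvd b}, mult = (*), one = 1, zero = 0, add = (+)\<rparr>"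

definition generic_ideal :: "poly2 \<Rightarrow> poly2 fract set" where
  "generic_ideal f = {Fract a b | a b. f dvd a \<and> \<not> f dvd b}"

definition function_field :: "poly2 \<Rightarrow> poly2 fract set ring" where
  "function_field f = generic_ring f Quot generic_ideal f"

definition to_function_field :: "poly2 \<Rightarrow> poly2 \<Rightarrow> poly2 fract set" where
  "to_function_field f p = generic_ideal f +>\<^bsub>generic_ring f\<^esub> Fract p 1"

text \<open>
  The coordinate ring \<open>\<complex>[x, y] / (f)\<close> as a subset of the function field, and in it the maximal
  ideal of the origin.
\<close>

definition coordinate_ring :: "poly2 \<Rightarrow> poly2 fract set set" where
  "coordinate_ring f = range (to_function_field f)"

definition origin_ideal :: "poly2 \<Rightarrow> poly2 fract set set" where
  "origin_ideal f = to_function_field f ` {p. coeff2 p 0 0 = 0}"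

definition integral_over :: "('a, 'b) ring_scheme \<Rightarrow> 'a set \<Rightarrow> 'a \<Rightarrow> bool" where
  "integral_over R A h \<longleftrightarrow> (\<exists>(k::nat) a. (\<forall>i<k. a i \<in> A) \<and>
     h [^]\<^bsub>R\<^esub> k \<oplus>\<^bsub>R\<^esub> (\<Oplus>\<^bsub>R\<^esub>i\<in>{..<k}. a i \<otimes>\<^bsub>R\<^esub> h [^]\<^bsub>R\<^esub> i) = \<zero>\<^bsub>R\<^esub>)"

text \<open>
  The coordinate ring of the normalization, and the points of the normalization that are mapped
  to the origin: its maximal ideals lying over that of the origin.
\<close>

definition normalization_ring :: "poly2 \<Rightarrow> poly2 fract set ring" where
  "normalization_ring f = (function_field f)
     \<lparr>carrier := {h \<in> carrier (function_field f).
        integral_over (function_field f) (coordinate_ring f) h}\<rparr>"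

definition normalization_fibre :: "poly2 \<Rightarrow> poly2 fract set set set" where
  "normalization_fibre f =
     {M. maximalideal M (normalization_ring f) \<and> M \<inter> coordinate_ring f = origin_ideal f}"

text \<open>
  Normalization is local, so the points over \<open>q\<close> may be computed in an affine chart.
\<close>

definition unibranch :: "poly3 \<Rightarrow> point \<Rightarrow> bool" where
  "unibranch F q \<longleftrightarrow> on_curve q F \<and> (\<exists>!M. M \<in> normalization_fibre (local_eq F q))"

definition mn_point :: "poly3 \<Rightarrow> point \<Rightarrow> nat \<Rightarrow> nat \<Rightarrow> bool" where
  "mn_point F q m n \<longleftrightarrow> unibranch F q \<and> m = multiplicity_at F q \<and>
     (\<exists>L. tangent_line F q L \<and> n = intersection_multiplicity F L q)"


section \<open>Infinitely near points and the delta-invariant\<close>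

text \<open>
  The exceptional curve of the blow-up of the plane at the origin is the projective line of
  directions. At the point given by the direction \<open>Some t\<close> (the line \<open>y = t x\<close>) the blow-up has
  local coordinates \<open>x', y'\<close> with \<open>x = x'\<close>, \<open>y = x' (y' + t)\<close>; at the point given by \<open>None\<close> (the
  line \<open>x = 0\<close>) it has local coordinates with \<open>x = x' y'\<close>, \<open>y = y'\<close>. The proper transform of
  \<open>f = 0\<close> is obtained by dividing out the equation of the exceptional curve as often as the
  multiplicity of \<open>f\<close> indicates; the division is exact.
\<close>

definition proper_transform :: "poly2 \<Rightarrow> complex option \<Rightarrow> poly2" where
  "proper_transform f s = (case s of
     Some t \<Rightarrow> subst2 f var_x (var_x * (var_y + const2 t)) div var_x ^ mult_origin f
   | None \<Rightarrow> subst2 f (var_x * var_y) var_y div var_y ^ mult_origin f)"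

text \<open>
  A point infinitely near to the origin is given by the list of the points blown up to reach it,
  the empty list being the origin itself. We keep the points that lie on the curve and its
  successive proper transforms.
\<close>

primrec on_transforms :: "poly2 \<Rightarrow> complex option list \<Rightarrow> bool" where
  "on_transforms f [] \<longleftrightarrow> coeff2 f 0 0 = 0"
| "on_transforms f (s # p) \<longleftrightarrow> coeff2 f 0 0 = 0 \<and> on_transforms (proper_transform f s) p"

definition infinitely_near_points :: "poly2 \<Rightarrow> complex option list set" where
  "infinitely_near_points f = {p. on_transforms f p}"

definition infinitely_near_mult :: "poly2 \<Rightarrow> complex option list \<Rightarrow> nat" where
  "infinitely_near_mult f p = mult_origin (foldl proper_transform f p)"

text \<open>
  There are infinitely many infinitely near points, but on a reduced curve only finitely many of
  them have multiplicity other than 1 and contribute to the sum.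
\<close>

definition delta_origin :: "poly2 \<Rightarrow> real" where
  "delta_origin f = (\<Sum>\<^sub>\<infinity>p\<in>infinitely_near_points f.
     real (infinitely_near_mult f p) * (real (infinitely_near_mult f p) - 1) / 2)"

definition delta_invariant :: "poly3 \<Rightarrow> point \<Rightarrow> real" where
  "delta_invariant F q = delta_origin (local_eq F q)"

end

theory Submission
  imports
    Defs
    "HOL-Computational_Algebra.Field_as_Ring"
    "HOL-Computational_Algebra.Fundamental_Theorem_Algebra"
begin

text \<open>
  The bound comes from Euclid's algorithm. Let \<open>g = 0\<close> be a germ with only one branch that meets
  the axis \<open>x = 0\<close> with multiplicity \<open>a\<close> and the axis \<open>y = 0\<close> with multiplicity \<open>b\<close>. Then
  \<open>2 \<delta> \<ge> a b - a - b + gcd a b\<close>, with equality if \<open>gcd a b = 1\<close>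
  (\<open>delta_lower_bound\<close>). Indeed, if \<open>a < b\<close>, the germ has multiplicity \<open>a\<close> and is tangent to
  \<open>y = 0\<close>, and after one blow-up the transform meets the exceptional curve with multiplicity \<open>a\<close>
  and the transform of \<open>y = 0\<close> with multiplicity \<open>b - a\<close>; the blown-up point contributes
  \<open>a (a - 1)\<close> to \<open>2 \<delta>\<close>, which is exactly what separates the bound for \<open>(a, b)\<close> from that for
  \<open>(a, b - a)\<close>. If \<open>a = b\<close>, the bound is the contribution of a single point, and if
  \<open>a = b = 1\<close> the germ is smooth. At an \<open>(m, n)\<close>-point one first blows up the point itself; the
  transform meets the exceptional curve with multiplicity \<open>m\<close> and the transform of the tangent
  line with multiplicity \<open>n - m\<close>, and the same computation ends the proof.

  Three facts make this work. The first is that every blow-up leaves a single point on the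
  transform (\<open>chart_unique_direction\<close>). The points of the normalization are read off from
  valuation rings of \<open>\<complex>(x, y)\<close> that contain the coordinate ring and have the equation \<open>f\<close> of the
  curve and its multiples, taken in the local ring of the curve's generic point, in their maximal
  ideal; such a ring is the same thing as a valuation ring of the function field, so no separate
  field has to be built. By Chevalley's extension theorem every local ring is dominated by a
  valuation ring, and integral closures are intersections of valuation rings. The centre of a
  valuation ring on the normalization determines it, because the function field is algebraic over
  \<open>\<complex>(x)\<close> (\<open>valuation_ring_determined_by_centre\<close>). Hence at a unibranch point exactly one
  valuation ring \<open>W\<close> is centred at the point. The local ring of each infinitely near point on the
  curve is dominated by \<open>W\<close> as well, and \<open>y / x\<close> has only one residue in \<open>W\<close>.

  The second is that only finitely many infinitely near points are multiple
  (\<open>finite_multiple_points\<close>); otherwise the sum defining \<open>\<delta>\<close> would not converge. If the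
  multiplicity remained \<open>m \<ge> 2\<close> forever, then some transform would have an equation \<open>f\<close> in suitable
  coordinates such that \<open>f(x, \<sigma>(x) + x^k y)\<close> is divisible by \<open>x^(m k)\<close> for each \<open>k\<close> and a polynomial \<open>\<sigma>\<close>
  depending on \<open>k\<close>, and \<open>x^k\<close> would divide every polynomial in \<open>x\<close>
  of the form \<open>A f + B f_y\<close>; but the ideal generated by \<open>f\<close> and \<open>f_y\<close> contains a nonzero one.

  The third is that the intersection multiplicity with a line through the origin is the order of
  vanishing of the equation restricted to the line (\<open>intersection_with_line\<close>).
\<close>


section \<open>Valuation rings of a field\<close>

definition subring_of_field :: "'k::field set \<Rightarrow> bool" where
  "subring_of_field S \<longleftrightarrow> 1 \<in> S \<and> (\<forall>a\<in>S. \<forall>b\<in>S. a - b \<in> S \<and> a * b \<in> S)"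

definition ideal_in :: "'k::field set \<Rightarrow> 'k set \<Rightarrow> bool" where
  "ideal_in S J \<longleftrightarrow> J \<subseteq> S \<and> 0 \<in> J \<and> (\<forall>a\<in>J. \<forall>b\<in>J. a + b \<in> J) \<and> (\<forall>a\<in>S. \<forall>b\<in>J. a * b \<in> J)"

lemma subring_closed:
  assumes "subring_of_field S"
  shows "0 \<in> S" "1 \<in> S" "a \<in> S \<Longrightarrow> - a \<in> S" "a \<in> S \<Longrightarrow> b \<in> S \<Longrightarrow> a + b \<in> S"
    "a \<in> S \<Longrightarrow> b \<in> S \<Longrightarrow> a - b \<in> S" "a \<in> S \<Longrightarrow> b \<in> S \<Longrightarrow> a * b \<in> S" "a \<in> S \<Longrightarrow> a ^ k \<in> S"
proof -
  show 0: "0 \<in> S" and "1 \<in> S"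
    using assms unfolding subring_of_field_def by force+
  show m: "- a \<in> S" if "a \<in> S" for a
    using assms 0 that unfolding subring_of_field_def by (metis diff_0)
  show "a + b \<in> S" if "a \<in> S" "b \<in> S"
    using assms m[of b] that unfolding subring_of_field_def by (metis diff_minus_eq_add)
  show "a - b \<in> S" "a * b \<in> S" if "a \<in> S" "b \<in> S"
    using assms that unfolding subring_of_field_def by auto
  show "a ^ k \<in> S" if "a \<in> S"
    using assms that unfolding subring_of_field_def by (induction k) auto
qed

lemma subring_sum:
  assumes "subring_of_field S" "\<And>i. i \<in> A \<Longrightarrow> f i \<in> S"
  shows "sum f A \<in> S"
  using assms(2) by (induction A rule: infinite_finite_induct) (auto simp: subring_closed[OF assms(1)])

lemma subring_poly:
  assumes "subring_of_field S" "\<And>i. coeff P i \<in> S" "h \<in> S"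
  shows "poly P h \<in> S"
  unfolding poly_altdef by (intro subring_sum subring_closed assms)

lemma ideal_closed:
  assumes "subring_of_field S" "ideal_in S J"
  shows "a \<in> J \<Longrightarrow> a \<in> S" "0 \<in> J" "a \<in> J \<Longrightarrow> b \<in> J \<Longrightarrow> a + b \<in> J"
    "a \<in> S \<Longrightarrow> b \<in> J \<Longrightarrow> a * b \<in> J" "a \<in> J \<Longrightarrow> b \<in> S \<Longrightarrow> a * b \<in> J"
    "a \<in> J \<Longrightarrow> - a \<in> J" "a \<in> J \<Longrightarrow> b \<in> J \<Longrightarrow> a - b \<in> J"
proof -
  have *: "- a \<in> J" if "a \<in> J" for a
    using assms(2) subring_closed(2,3)[OF assms(1)] that unfolding ideal_in_def
    by (metis mult_minus1)
  show "a \<in> J \<Longrightarrow> - a \<in> J" "a \<in> J \<Longrightarrow> b \<in> J \<Longrightarrow> a - b \<in> J"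
    using assms(2) *[of a] *[of b] unfolding ideal_in_def by (auto simp flip: add_uminus_conv_diff)
qed (use assms(2) in \<open>auto simp: ideal_in_def mult.commute\<close>)

lemma ideal_sum:
  assumes "subring_of_field S" "ideal_in S J" "\<And>i. i \<in> A \<Longrightarrow> f i \<in> J"
  shows "sum f A \<in> J"
  using assms(3) by (induction A rule: infinite_finite_induct) (auto simp: ideal_closed[OF assms(1,2)])

definition adjoin :: "'k::field set \<Rightarrow> 'k \<Rightarrow> 'k set" where
  "adjoin S h = {poly P h | P. \<forall>i. coeff P i \<in> S}"

lemma adjoinI: "(\<And>i. coeff P i \<in> S) \<Longrightarrow> poly P h \<in> adjoin S h"
  unfolding adjoin_def by auto

lemma coeff_mult_in_ideal:
  assumes "subring_of_field S" "ideal_in S J" "\<And>i. coeff P i \<in> S" "\<And>i. coeff Q i \<in> J"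
  shows "coeff (P * Q) i \<in> J"
  unfolding coeff_mult by (intro ideal_sum[OF assms(1,2)] ideal_closed(4)[OF assms(1,2)] assms)

lemma ideal_in_self: "subring_of_field S \<Longrightarrow> ideal_in S S"
  by (auto simp: ideal_in_def subring_closed)

lemma subring_adjoin:
  assumes "subring_of_field S"
  shows "subring_of_field (adjoin S h)"
  unfolding subring_of_field_def
proof (intro conjI ballI)
  show "1 \<in> adjoin S h"
    using adjoinI[of "[:1:]" S h] subring_closed[OF assms] by (simp add: coeff_pCons split: nat.splits)
next
  fix a b assume "a \<in> adjoin S h" "b \<in> adjoin S h"
  then obtain P Q where PQ: "a = poly P h" "b = poly Q h" "\<And>i. coeff P i \<in> S" "\<And>i. coeff Q i \<in> S"
    unfolding adjoin_def by auto
  show "a - b \<in> adjoin S h"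
    using adjoinI[of "P - Q" S h] PQ subring_closed[OF assms] by simp
  show "a * b \<in> adjoin S h"
    using adjoinI[of "P * Q" S h] PQ coeff_mult_in_ideal[OF assms ideal_in_self[OF assms]] by simp
qed

lemma adjoin_superset: "subring_of_field S \<Longrightarrow> S \<subseteq> adjoin S h"
  using adjoinI[of "[:a:]" S h for a] by (auto simp: coeff_pCons subring_closed split: nat.splits)

lemma adjoin_self: "subring_of_field S \<Longrightarrow> h \<in> adjoin S h"
  using adjoinI[of "[:0,1:]" S h] by (auto simp: coeff_pCons subring_closed split: nat.splits)

inductive_set ideal_span :: "'k::field set \<Rightarrow> 'k set \<Rightarrow> 'k set" for N S where
  zero: "0 \<in> ideal_span N S"
| step: "n \<in> N \<Longrightarrow> s \<in> S \<Longrightarrow> a \<in> ideal_span N S \<Longrightarrow> n * s + a \<in> ideal_span N S"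

lemma ideal_span_add:
  "a \<in> ideal_span N S \<Longrightarrow> b \<in> ideal_span N S \<Longrightarrow> a + b \<in> ideal_span N S"
  by (induction rule: ideal_span.induct) (auto simp: add.assoc intro: ideal_span.intros)

lemma ideal_span_mult:
  assumes "subring_of_field S" "t \<in> S"
  shows "a \<in> ideal_span N S \<Longrightarrow> t * a \<in> ideal_span N S"
proof (induction rule: ideal_span.induct)
  case (step n s a)
  have "t * (n * s + a) = n * (t * s) + t * a"
    by (simp add: algebra_simps)
  then show ?case
    using step assms(2) subring_closed(6)[OF assms(1)] by (simp add: ideal_span.step)
qed (auto intro: ideal_span.intros)

lemma ideal_span_ideal:
  assumes "subring_of_field S" "N \<subseteq> S"
  shows "ideal_in S (ideal_span N S)"
proof -
  have "a \<in> S" if "a \<in> ideal_span N S" for a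
    using that by induction (use assms in \<open>auto intro!: subring_closed\<close>)
  then show ?thesis
    unfolding ideal_in_def using ideal_span_add ideal_span_mult[OF assms(1)] ideal_span.zero by auto
qed

lemma ideal_span_of_ideal:
  assumes "ideal_in S N"
  shows "ideal_span N S \<subseteq> N"
proof
  fix a assume "a \<in> ideal_span N S"
  then show "a \<in> N"
  proof induction
    case (step n s a)
    then have "s * n \<in> N" using assms by (simp add: ideal_in_def)
    then show ?case using step assms by (simp add: ideal_in_def mult.commute)
  qed (use assms in \<open>simp add: ideal_in_def\<close>)
qed

lemma ideal_span_Union_chain:
  assumes "subset.chain A C" "C \<noteq> {}" "a \<in> ideal_span N (\<Union>C)"
  shows "\<exists>S\<in>C. a \<in> ideal_span N S"
  using assms(3)
proof induction
  case zero
  then show ?case using assms(2) by (auto intro: ideal_span.zero)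
next
  case (step n s a)
  then obtain S S' where S: "S \<in> C" "a \<in> ideal_span N S" "S' \<in> C" "s \<in> S'" by auto
  have mono: "ideal_span N S \<subseteq> ideal_span N T" if "S \<subseteq> T" for T
  proof
    fix x assume "x \<in> ideal_span N S" then show "x \<in> ideal_span N T"
      by induction (use that in \<open>auto intro: ideal_span.intros\<close>)
  qed
  from S assms(1) have "S \<subseteq> S' \<or> S' \<subseteq> S"
    unfolding subset.chain_def by blast
  then show ?case
    using S step mono by (blast intro: ideal_span.step)
qed

lemma ideal_span_adjoin:
  assumes "subring_of_field S" "N \<subseteq> S" "a \<in> ideal_span N (adjoin S h)"
  shows "\<exists>P. (\<forall>i. coeff P i \<in> ideal_span N S) \<and> a = poly P h"
  using assms(3)
proof induction
  case zero
  show ?case by (rule exI[of _ 0]) (auto intro: ideal_span.zero)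
next
  case (step n s a)
  then obtain P Q where P: "\<And>i. coeff P i \<in> ideal_span N S" "a = poly P h"
    and Q: "\<And>i. coeff Q i \<in> S" "s = poly Q h"
    unfolding adjoin_def by auto
  have "\<forall>i. coeff (smult n Q + P) i \<in> ideal_span N S"
    using step(1) P(1) Q(1) by (auto intro: ideal_span.step)
  then show ?case
    using P(2) Q(2) by (intro exI[of _ "smult n Q + P"]) auto
qed

text \<open>
  Of two relations \<open>P(h) = 1\<close> and \<open>Q(1/h) = 1\<close> the one of larger degree can be shortened:
  clearing denominators in the other one expresses \<open>(1 - b) h^q\<close>, where \<open>b\<close> is the constant
  coefficient of \<open>Q\<close>, by lower powers of \<open>h\<close>. Descent on the sum of the degrees ends at a
  constant relation, that is, at \<open>1 \<in> J\<close>.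
\<close>
lemma no_two_sided_relation:
  assumes S: "subring_of_field S" and J: "ideal_in S J" "1 \<notin> J" and h: "h \<noteq> 0"
    and "\<And>i. coeff P i \<in> J" "poly P h = 1" "\<And>i. coeff Q i \<in> J" "poly Q (inverse h) = 1"
  shows False
  using h assms(5-)
proof (induction "degree P + degree Q" arbitrary: P Q h rule: less_induct)
  case less
  note cl = subring_closed[OF S] ideal_closed[OF S J(1)]
  have main: False if le: "degree Q \<le> degree P" and h: "h \<noteq> 0"
    and P: "\<And>i. coeff P i \<in> J" "poly P h = 1" and Q: "\<And>i. coeff Q i \<in> J" "poly Q (inverse h) = 1"
    and IH: "\<And>P'. degree P' < degree P \<Longrightarrow> (\<And>i. coeff P' i \<in> J) \<Longrightarrow> poly P' h = 1 \<Longrightarrow> False"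
    for P Q h
  proof -
    have pos: "degree Q > 0"
    proof (rule ccontr)
      assume "\<not> degree Q > 0"
      then obtain b where "Q = [:b:]" using degree_eq_zeroE by auto
      then show False using Q Q(1)[of 0] J(2) by auto
    qed
    define a b p q where "a = lead_coeff P" and "b = coeff Q 0" and "p = degree P" and "q = degree Q"
    define R where "R = reflect_poly Q - monom b q"
    have R: "poly R h = (1 - b) * h ^ q"
      using Q(2) h poly_reflect_poly_nz[of h Q]
      by (simp add: R_def poly_monom q_def algebra_simps)
    have cR: "coeff R i \<in> J" for i
      using Q(1) cl(8-) by (simp add: R_def coeff_reflect_poly b_def)
    have dR: "coeff R i = 0" if "i \<ge> q" for i
      using that by (auto simp: R_def coeff_reflect_poly b_def q_def)
    \<comment> \<open>\<open>P'(h) = b + (1 - b) P(h) = 1\<close>, with the term \<open>(1 - b) a h^p\<close> replaced by means of \<open>R\<close>\<close>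
    define P' where "P' = [:b:] + smult (1 - b) (P - monom a p) + smult a (monom 1 (p - q) * R)"
    have "poly P' h = b + (1 - b) * (1 - a * h ^ p) + a * (h ^ (p - q) * ((1 - b) * h ^ q))"
      by (simp add: P'_def poly_monom P(2) R)
    also have "h ^ (p - q) * ((1 - b) * h ^ q) = (1 - b) * h ^ p"
      using le by (simp add: p_def q_def algebra_simps flip: power_add)
    finally have 1: "poly P' h = 1" by (simp add: algebra_simps)
    have bJ: "b \<in> J" "a \<in> J" using P(1) Q(1) by (auto simp: a_def b_def)
    have 2: "coeff P' i \<in> J" for i
    proof -
      have "coeff P' i = coeff [:b:] i + (1 - b) * (coeff P i - coeff (monom a p) i)
          + a * (if p - q \<le> i then coeff R (i - (p - q)) else 0)"
        by (simp add: P'_def coeff_monom_mult)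
      moreover have "coeff [:b:] i \<in> J"
        using bJ cl by (auto simp: coeff_pCons split: nat.splits)
      ultimately show ?thesis
        using bJ P(1) cR cl by auto
    qed
    have "coeff P' i = 0" if "i \<ge> p" for i
    proof -
      have "coeff [:b:] i = 0" 
        using that pos le by (auto simp: coeff_pCons p_def split: nat.splits)
      moreover have "coeff P i - coeff (monom a p) i = 0"
        using that by (auto simp: a_def p_def coeff_eq_0)
      moreover have "coeff R (i - (p - q)) = 0"
        by (rule dR) (use that le in \<open>auto simp: p_def q_def\<close>)
      ultimately show ?thesis by (simp add: P'_def coeff_monom_mult)
    qed
    then have "degree P' < degree P"
      using pos le unfolding p_def by (metis (no_types, lifting) coeff_0 degree_0 leading_coeff_0_iff linorder_not_less order_less_le_trans)
    then show False using IH 1 2 by blast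
  qed
  show ?case
  proof (cases "degree Q \<le> degree P")
    case True
    show False
      by (rule main[OF True less.prems]) (use less.hyps less.prems in \<open>meson add_less_mono1\<close>)
  next
    case False
    show False
      by (rule main[of P Q "inverse h"])
        (use False less.hyps[of P] less.prems in \<open>auto\<close>)
  qed
qed

definition valuation_ring :: "'k::field set \<Rightarrow> bool" where
  "valuation_ring V \<longleftrightarrow> subring_of_field V \<and> (\<forall>h. h \<in> V \<or> inverse h \<in> V)"

definition nonunits :: "'k::field set \<Rightarrow> 'k set" where
  "nonunits V = {h \<in> V. h = 0 \<or> inverse h \<notin> V}"

lemma valuation_ringD:
  assumes "valuation_ring V"
  shows "subring_of_field V" "h \<notin> V \<Longrightarrow> inverse h \<in> nonunits V"
  using assms unfolding valuation_ring_def nonunits_def by (auto simp: subring_closed)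

lemma nonunits_ideal:
  assumes V: "valuation_ring V"
  shows "ideal_in V (nonunits V)"
proof -
  note cl = subring_closed[OF valuation_ringD(1)[OF V]]
  have mult: "a * b \<in> nonunits V" if "a \<in> V" "b \<in> nonunits V" for a b
  proof (cases "a * b = 0")
    case False
    have *: "a * inverse (a * b) = inverse b" using False by simp
    have "inverse (a * b) \<notin> V"
    proof
      assume "inverse (a * b) \<in> V"
      then have "inverse b \<in> V" using cl(6)[of a "inverse (a * b)"] that(1) unfolding * by blast
      then show False using that False by (simp add: nonunits_def)
    qed
    then show ?thesis using that cl(6)[of a b] by (simp add: nonunits_def)
  next
    case True
    then show ?thesis using cl(1) by (simp only: nonunits_def) auto
  qed
  have 1: "a + b \<in> nonunits V" if "a \<in> nonunits V" "b \<in> nonunits V" "a / b \<in> V" "b \<noteq> 0" for a b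
  proof -
    have "(a / b + 1) * b \<in> nonunits V" using that cl by (intro mult) auto
    moreover have "(a / b + 1) * b = a + b" using that by (simp add: distrib_right)
    ultimately show ?thesis by simp
  qed
  have "a + b \<in> nonunits V" if "a \<in> nonunits V" "b \<in> nonunits V" for a b
  proof (cases "a = 0 \<or> b = 0")
    case False
    have "a / b \<in> V \<or> b / a \<in> V"
      using V unfolding valuation_ring_def by (metis inverse_divide)
    then show ?thesis using 1[of a b] 1[of b a] that False by (auto simp: add.commute)
  qed (use that in auto)
  then show ?thesis using mult cl unfolding ideal_in_def by (auto simp: nonunits_def)
qed

lemma one_notin_nonunits: "valuation_ring V \<Longrightarrow> 1 \<notin> nonunits V"
  by (auto simp: nonunits_def valuation_ring_def subring_closed)

lemma nonunits_prime:
  assumes V: "valuation_ring V" and "a \<in> V" "b \<in> V" "a * b \<in> nonunits V"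
  shows "a \<in> nonunits V \<or> b \<in> nonunits V"
  using assms subring_closed(6)[OF valuation_ringD(1)[OF V], of "inverse a" "inverse b"]
  by (auto simp: nonunits_def)

lemmas nonunits_rules = ideal_closed[OF valuation_ringD(1) nonunits_ideal]

text \<open>
  Chevalley's extension theorem. Among the subrings above \<open>S\<close> in which \<open>N\<close> does not generate the
  unit ideal there is a maximal one \<open>V\<close>. If neither \<open>h\<close> nor \<open>1/h\<close> lay in \<open>V\<close>, adjoining either
  of them would make \<open>N\<close> generate the unit ideal, and the two resulting relations contradict
  each other.
\<close>
theorem chevalley_extension:
  fixes S :: "'k::field set"
  assumes S: "subring_of_field S" and N: "ideal_in S N" "1 \<notin> N"
  obtains V where "valuation_ring V" "S \<subseteq> V" "N \<subseteq> nonunits V"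
proof -
  define A where "A = {T. subring_of_field T \<and> S \<subseteq> T \<and> 1 \<notin> ideal_span N T}"
  have NS: "N \<subseteq> S" using N by (auto simp: ideal_in_def)
  have "S \<in> A" using S N ideal_span_of_ideal[OF N(1)] by (auto simp: A_def)
  moreover have "\<Union>C \<in> A" if C: "C \<noteq> {}" "subset.chain A C" for C
  proof -
    have CA: "C \<subseteq> A" using C by (auto simp: subset.chain_def)
    have "subring_of_field (\<Union>C)"
      unfolding subring_of_field_def
    proof (intro conjI ballI)
      obtain T0 where "T0 \<in> C" using C by blast
      moreover from this have "subring_of_field T0" using CA by (auto simp: A_def)
      ultimately show "1 \<in> \<Union>C" using subring_closed(2) by blast
      fix a b assume "a \<in> \<Union>C" "b \<in> \<Union>C"
      then obtain T T' where T: "T \<in> C" "T' \<in> C" "a \<in> T" "b \<in> T'" by auto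
      with C have "T \<subseteq> T' \<or> T' \<subseteq> T" unfolding subset.chain_def by blast
      then obtain U where "U \<in> C" "a \<in> U" "b \<in> U" using T by blast
      moreover have "subring_of_field U" using \<open>U \<in> C\<close> CA by (auto simp: A_def)
      ultimately have "U \<in> C" "a - b \<in> U" "a * b \<in> U" by (simp_all add: subring_closed)
      then show "a - b \<in> \<Union>C" "a * b \<in> \<Union>C" by blast+
    qed
    moreover have "S \<subseteq> \<Union>C" using C CA by (auto simp: A_def)
    moreover have "1 \<notin> ideal_span N (\<Union>C)"
      using ideal_span_Union_chain[OF C(2,1)] CA by (auto simp: A_def)
    ultimately show ?thesis by (auto simp: A_def)
  qed
  ultimately obtain V where V: "V \<in> A" and max: "\<And>T. T \<in> A \<Longrightarrow> V \<subseteq> T \<Longrightarrow> T = V"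
    using subset_Zorn_nonempty[of A] by blast
  have sub: "subring_of_field V" and SV: "S \<subseteq> V" and 1: "1 \<notin> ideal_span N V"
    using V by (auto simp: A_def)
  have NV: "N \<subseteq> V" using NS SV by auto
  have rel: "\<exists>P. (\<forall>i. coeff P i \<in> ideal_span N V) \<and> poly P h = 1" if "h \<notin> V" for h
  proof -
    have "adjoin V h \<notin> A"
      using max[of "adjoin V h"] adjoin_superset[OF sub, of h] adjoin_self[OF sub, of h] that by auto
    then have "1 \<in> ideal_span N (adjoin V h)"
      using subring_adjoin[OF sub, of h] adjoin_superset[OF sub, of h] SV by (auto simp: A_def)
    then show ?thesis using ideal_span_adjoin[OF sub NV, of 1 h] by auto
  qed
  have val: "valuation_ring V"
    unfolding valuation_ring_def
  proof (intro conjI allI sub)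
    fix h show "h \<in> V \<or> inverse h \<in> V"
    proof (rule ccontr)
      assume *: "\<not> (h \<in> V \<or> inverse h \<in> V)"
      then have "h \<noteq> 0" using subring_closed[OF sub] by auto
      obtain P where P: "\<And>i. coeff P i \<in> ideal_span N V" "poly P h = 1" using rel * by blast
      obtain Q where Q: "\<And>i. coeff Q i \<in> ideal_span N V" "poly Q (inverse h) = 1" using rel * by blast
      show False
        by (rule no_two_sided_relation[OF sub ideal_span_ideal[OF sub NV] 1 \<open>h \<noteq> 0\<close> P Q])
    qed
  qed
  moreover have "N \<subseteq> nonunits V"
  proof
    fix n assume n: "n \<in> N"
    have "inverse n \<notin> V" if "n \<noteq> 0"
    proof
      assume "inverse n \<in> V"
      then have "n * inverse n + 0 \<in> ideal_span N V" using n by (intro ideal_span.intros)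
      then show False using that 1 by simp
    qed
    then show "n \<in> nonunits V" using n NV by (auto simp: nonunits_def)
  qed
  ultimately show ?thesis using that SV by blast
qed

definition integral_equation :: "'k::field set \<Rightarrow> 'k \<Rightarrow> bool" where
  "integral_equation S h \<longleftrightarrow> (\<exists>(k::nat) a. (\<forall>i<k. a i \<in> S) \<and> h ^ k + (\<Sum>i<k. a i * h ^ i) = 0)"

text \<open>
  Divided by \<open>h^k\<close>, an integral equation expresses 1 by positive powers of \<open>1/h\<close>.
\<close>
lemma integral_in_valuation_ring:
  assumes V: "valuation_ring V" and "S \<subseteq> V" "integral_equation S h"
  shows "h \<in> V"
proof (rule ccontr)
  assume "h \<notin> V"
  note cl = subring_closed[OF valuation_ringD(1)[OF V]]
  from assms obtain k a where a: "\<And>i. i < k \<Longrightarrow> a i \<in> V" "h ^ k + (\<Sum>i<k. a i * h ^ i) = 0"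
    unfolding integral_equation_def by blast
  have h0: "h \<noteq> 0" using \<open>h \<notin> V\<close> cl by auto
  have I: "inverse h \<in> nonunits V" using \<open>h \<notin> V\<close> V valuation_ringD by blast
  have "1 = - (\<Sum>i<k. a i * h ^ i) / h ^ k"
    using a(2) h0 by (simp add: field_simps add_eq_0_iff)
  also have "\<dots> = - (\<Sum>i<k. a i * inverse h ^ (k - Suc i) * inverse h)"
  proof -
    have "a i * h ^ i / h ^ k = a i * inverse h ^ (k - Suc i) * inverse h" if "i < k" for i
    proof -
      have "h ^ k = h ^ i * (h ^ (k - Suc i) * h)"
        using that by (metis Suc_diff_Suc add_diff_inverse_nat less_imp_le not_less power_Suc2 power_add)
      then show ?thesis
        using h0 by (simp add: divide_inverse power_inverse mult.assoc)
    qed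
    then show ?thesis
      by (simp add: sum_divide_distrib)
  qed
  also have "(\<Sum>i<k. a i * inverse h ^ (k - Suc i) * inverse h) \<in> nonunits V"
  proof (rule ideal_sum[OF valuation_ringD(1)[OF V] nonunits_ideal[OF V]])
    fix i assume "i \<in> {..<k}"
    moreover have "inverse h \<in> V" using I by (simp add: nonunits_def)
    ultimately have "a i * inverse h ^ (k - Suc i) \<in> V"
      using a(1) cl by auto
    then show "a i * inverse h ^ (k - Suc i) * inverse h \<in> nonunits V"
      by (rule ideal_closed(4)[OF valuation_ringD(1)[OF V] nonunits_ideal[OF V]]) (rule I)
  qed
  then have "- (\<Sum>i<k. a i * inverse h ^ (k - Suc i) * inverse h) \<in> nonunits V"
    by (rule ideal_closed(6)[OF valuation_ringD(1)[OF V] nonunits_ideal[OF V]])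
  finally show False using one_notin_nonunits[OF V] by simp
qed

text \<open>
  If \<open>1/h\<close> generates a proper ideal of \<open>S[1/h]\<close>, some valuation ring above \<open>S\<close> has \<open>1/h\<close> in its
  maximal ideal and omits \<open>h\<close>. If it generates the unit ideal, a relation \<open>1 = (1/h) P(1/h)\<close> is
  an integral equation after multiplication by a power of \<open>h\<close>.
\<close>
lemma integral_if_in_all_valuation_rings:
  assumes S: "subring_of_field S" and all: "\<And>V. valuation_ring V \<Longrightarrow> S \<subseteq> V \<Longrightarrow> h \<in> V"
  shows "integral_equation S h"
proof (cases "h = 0")
  case True
  then show ?thesis unfolding integral_equation_def
    by (intro exI[of _ 1] exI[of _ "\<lambda>_. 0"]) (auto simp: subring_closed[OF S])
next
  case False
  define T where "T = adjoin S (inverse h)"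
  define N where "N = (*) (inverse h) ` T"
  have T: "subring_of_field T" unfolding T_def by (rule subring_adjoin[OF S])
  note cl = subring_closed[OF T]
  have hT: "inverse h \<in> T" unfolding T_def by (rule adjoin_self[OF S])
  have N: "ideal_in T N"
    unfolding ideal_in_def
  proof (intro conjI ballI)
    show "N \<subseteq> T" using hT cl by (auto simp: N_def)
    show "0 \<in> N" unfolding N_def by (rule image_eqI[of _ _ 0]) (simp_all add: cl(1))
    show "a + b \<in> N" if "a \<in> N" "b \<in> N" for a b
    proof -
      from that obtain s t where "s \<in> T" "t \<in> T" "a = inverse h * s" "b = inverse h * t"
        unfolding N_def by auto
      then have "a + b = inverse h * (s + t)" "s + t \<in> T" using cl by (simp_all add: distrib_left)
      then show ?thesis unfolding N_def by blast
    qed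
    show "a * b \<in> N" if "a \<in> T" "b \<in> N" for a b
    proof -
      from that obtain t where "t \<in> T" "b = inverse h * t"
        unfolding N_def by auto
      then have "a * b = inverse h * (a * t)" "a * t \<in> T" using cl that by simp_all
      then show ?thesis unfolding N_def by blast
    qed
  qed
  have "1 \<in> N"
  proof (rule ccontr)
    assume "1 \<notin> N"
    then obtain V where V: "valuation_ring V" "T \<subseteq> V" "N \<subseteq> nonunits V"
      using chevalley_extension[OF T N] by blast
    have "inverse h \<in> N" unfolding N_def by (rule image_eqI[of _ _ 1]) (simp_all add: cl(2))
    then have "h \<notin> V" using V False by (auto simp: nonunits_def)
    moreover have "S \<subseteq> V" using V adjoin_superset[OF S] unfolding T_def by blast
    ultimately show False using all V(1) by blast
  qed
  then obtain t where t: "t \<in> T" "1 = inverse h * t"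
    unfolding N_def by blast
  then obtain P where P: "\<forall>i. coeff P i \<in> S" "1 = inverse h * poly P (inverse h)"
    unfolding T_def adjoin_def by blast
  define p where "p = degree P"
  have "h ^ Suc p = h ^ p * poly P (inverse h)"
    using P(2) False by (simp add: field_simps)
  also have "\<dots> = (\<Sum>i\<le>p. coeff P i * h ^ (p - i))"
    unfolding poly_altdef sum_distrib_left p_def
  proof (intro sum.cong refl)
    fix i assume "i \<in> {..degree P}"
    then have "h ^ degree P = h ^ i * h ^ (degree P - i)" by (simp flip: power_add)
    then show "h ^ degree P * (coeff P i * inverse h ^ i) = coeff P i * h ^ (degree P - i)"
      using False by (simp add: field_simps)
  qed
  also have "\<dots> = (\<Sum>i<Suc p. coeff P (p - i) * h ^ i)"
    unfolding lessThan_Suc_atMost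
    by (rule sum.reindex_bij_witness[of _ "\<lambda>i. p - i" "\<lambda>i. p - i"]) auto
  finally show ?thesis unfolding integral_equation_def
    using P(1) by (intro exI[of _ "Suc p"] exI[of _ "\<lambda>i. - coeff P (p - i)"])
      (auto simp: subring_closed[OF S] sum_negf)
qed


section \<open>Linear dependence and ring homomorphisms\<close>

text \<open>
  Fraction-free elimination. It is applied over \<open>\<complex>[x]\<close>, to find algebraic relations, and over
  \<open>\<complex>\<close>, to bound dimensions.
\<close>
lemma dependent_rows:
  fixes c :: "nat \<Rightarrow> nat \<Rightarrow> 'a::idom"
  assumes "finite J" "k < card J"
  shows "\<exists>l. (\<exists>j\<in>J. l j \<noteq> 0) \<and> (\<forall>i<k. (\<Sum>j\<in>J. l j * c j i) = 0)"
  using assms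
proof (induction k arbitrary: J c)
  case 0
  then have "J \<noteq> {}" by auto
  then show ?case by (intro exI[of _ "\<lambda>_. 1"]) auto
next
  case (Suc k)
  show ?case
  proof (cases "\<forall>j\<in>J. c j k = 0")
    case True
    then show ?thesis
      using Suc.IH[of J c] Suc.prems by (auto simp: less_Suc_eq)
  next
    case False
    then obtain j0 where j0: "j0 \<in> J" "c j0 k \<noteq> 0" by auto
    define J' where "J' = J - {j0}"
    have J': "finite J'" "k < card J'" "J = insert j0 J'" "j0 \<notin> J'"
      using Suc.prems j0 by (auto simp: J'_def)
    define c' where "c' j i = c j0 k * c j i - c j k * c j0 i" for j i
    obtain l where l: "\<exists>j\<in>J'. l j \<noteq> 0" "\<And>i. i < k \<Longrightarrow> (\<Sum>j\<in>J'. l j * c' j i) = 0"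
      using Suc.IH[OF J'(1,2), of c'] by auto
    define l' where "l' j = (if j = j0 then - (\<Sum>j\<in>J'. l j * c j k) else c j0 k * l j)" for j
    have "(\<Sum>j\<in>J. l' j * c j i) = (\<Sum>j\<in>J'. l j * c' j i)" for i
    proof -
      have "(\<Sum>j\<in>J. l' j * c j i) = l' j0 * c j0 i + (\<Sum>j\<in>J'. l' j * c j i)"
        using J' by simp
      also have "(\<Sum>j\<in>J'. l' j * c j i) = (\<Sum>j\<in>J'. c j0 k * l j * c j i)"
        using J'(4) by (intro sum.cong) (auto simp: l'_def)
      finally show ?thesis
        by (simp add: l'_def c'_def right_diff_distrib sum_subtractf sum_distrib_left sum_distrib_right
            mult_ac)
    qed
    moreover have "(\<Sum>j\<in>J'. l j * c' j k) = 0"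
      by (intro sum.neutral) (simp add: c'_def)
    ultimately have "\<forall>i<Suc k. (\<Sum>j\<in>J. l' j * c j i) = 0"
      using l(2) by (auto simp: less_Suc_eq)
    moreover have "\<exists>j\<in>J. l' j \<noteq> 0"
      using l(1) j0 J' by (auto simp: l'_def)
    ultimately show ?thesis by blast
  qed
qed

text \<open>
  A homomorphism on \<open>\<complex>[x, y]\<close> is determined by its values on the constants and the variables
  (\<open>poly2_hom_eqI\<close>); all identities between substitutions below are checked in this way.
\<close>
definition unital_hom :: "('a::comm_ring_1 \<Rightarrow> 'b::comm_ring_1) \<Rightarrow> bool" where
  "unital_hom h \<longleftrightarrow> h 1 = 1 \<and> (\<forall>a b. h (a + b) = h a + h b) \<and> (\<forall>a b. h (a * b) = h a * h b)"

lemma unital_homD: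
  assumes "unital_hom h"
  shows "h 0 = 0" "h 1 = 1" "h (a + b) = h a + h b" "h (a * b) = h a * h b" "h (- a) = - h a"
    "h (a - b) = h a - h b" "h (a ^ n) = h a ^ n"
proof -
  show add: "h (a + b) = h a + h b" for a b using assms by (simp add: unital_hom_def)
  show 0: "h 0 = 0" using add[of 0 0] by simp
  show neg: "h (- a) = - h a" for a using add[of a "- a"] 0 by (simp add: eq_neg_iff_add_eq_0 add.commute)
  show "h (a - b) = h a - h b" using add[of a "- b"] neg by simp
  show "h 1 = 1" "h (a * b) = h a * h b" for a b using assms by (simp_all add: unital_hom_def)
  then show "h (a ^ n) = h a ^ n" by (induction n) auto
qed

lemma unital_hom_sum: "unital_hom h \<Longrightarrow> h (sum g A) = (\<Sum>i\<in>A. h (g i))"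
  by (induction A rule: infinite_finite_induct) (auto simp: unital_homD)

definition extend_hom :: "('a::comm_ring_1 \<Rightarrow> 'b::comm_ring_1) \<Rightarrow> 'b \<Rightarrow> 'a poly \<Rightarrow> 'b" where
  "extend_hom h a p = poly (map_poly h p) a"

lemma extend_hom_pCons:
  "unital_hom h \<Longrightarrow> extend_hom h a (pCons c p) = h c + a * extend_hom h a p"
  by (simp add: extend_hom_def map_poly_pCons unital_homD)

lemma extend_hom_0 [simp]: "extend_hom h a 0 = 0"
  by (simp add: extend_hom_def)

lemma unital_hom_extend:
  assumes h: "unital_hom h"
  shows "unital_hom (extend_hom h a)"
proof -
  note c = extend_hom_pCons[OF h] unital_homD[OF h]
  have add: "extend_hom h a (p + q) = extend_hom h a p + extend_hom h a q" for p q
    by (induction p q rule: poly_induct2) (auto simp: c algebra_simps)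
  have smult: "extend_hom h a (smult r p) = h r * extend_hom h a p" for r p
    by (induction p) (auto simp: c algebra_simps)
  have "extend_hom h a (p * q) = extend_hom h a p * extend_hom h a q" for p q
    by (induction p) (auto simp: c add smult algebra_simps)
  moreover have "extend_hom h a 1 = 1"
    using c(1)[of a 1 0] by (simp add: c flip: one_pCons)
  ultimately show ?thesis by (simp add: unital_hom_def add)
qed

lemma unital_hom_eq_extend_hom:
  assumes h: "unital_hom h"
  shows "h p = extend_hom (\<lambda>c. h [:c:]) (h [:0, 1:]) p"
proof -
  have k: "unital_hom (\<lambda>c. h [:c:])"
    unfolding unital_hom_def using unital_homD(3,4)[OF h, of "[:a:]" "[:b:]" for a b]
    by (auto simp: unital_homD[OF h] simp flip: one_pCons)
  show ?thesis
  proof (induction p)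
    case 0
    then show ?case by (simp add: unital_homD[OF h])
  next
    case (pCons c p)
    have "pCons c p = [:c:] + [:0, 1:] * p" by simp
    then have "h (pCons c p) = h [:c:] + h [:0, 1:] * h p" by (simp only: unital_homD(3,4)[OF h])
    then show ?case using pCons by (simp add: extend_hom_pCons[OF k])
  qed
qed

lemma unital_hom_eqI:
  assumes "unital_hom h" "unital_hom k" "\<And>c. h [:c:] = k [:c:]" "h [:0, 1:] = k [:0, 1:]"
  shows "h p = k p"
proof -
  have "(\<lambda>c. h [:c:]) = (\<lambda>c. k [:c:])" using assms(3) by auto
  then show ?thesis
    unfolding unital_hom_eq_extend_hom[OF assms(1), of p] unital_hom_eq_extend_hom[OF assms(2), of p]
    using assms(4) by simp
qed

lemma unital_hom_comp: "unital_hom h \<Longrightarrow> unital_hom k \<Longrightarrow> unital_hom (\<lambda>x. h (k x))"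
  by (simp add: unital_hom_def)

lemma unital_hom_const: "unital_hom h \<Longrightarrow> unital_hom (\<lambda>c. h [:c:])"
  by (rule unital_hom_comp) (auto simp: unital_hom_def one_pCons)

lemma unital_hom_eqI2:
  fixes h k :: "'a::comm_ring_1 poly poly \<Rightarrow> 'b::comm_ring_1"
  assumes "unital_hom h" "unital_hom k" "\<And>c. h [:[:c:]:] = k [:[:c:]:]"
    "h [:[:0, 1:]:] = k [:[:0, 1:]:]" "h [:0, 1:] = k [:0, 1:]"
  shows "h p = k p"
proof (rule unital_hom_eqI[OF assms(1,2) _ assms(5)])
  show "h [:c:] = k [:c:]" for c
    by (rule unital_hom_eqI[of "\<lambda>c. h [:c:]" "\<lambda>c. k [:c:]"]) (use assms unital_hom_const in auto)
qed

lemma extend_hom_const [simp]: "unital_hom h \<Longrightarrow> extend_hom h a [:c:] = h c"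
  and extend_hom_var [simp]: "unital_hom h \<Longrightarrow> extend_hom h a [:0, 1:] = a"
  by (simp_all add: extend_hom_pCons unital_homD)

lemma unital_hom_const2: "unital_hom const2"
  by (simp add: unital_hom_def const2_def one_pCons)

abbreviation eval2 :: "(complex \<Rightarrow> 'b::comm_ring_1) \<Rightarrow> 'b \<Rightarrow> 'b \<Rightarrow> poly2 \<Rightarrow> 'b" where
  "eval2 k a b \<equiv> extend_hom (extend_hom k a) b"

lemma subst2_eq: "subst2 f a b = eval2 const2 a b f"
  by (simp add: subst2_def extend_hom_def[abs_def])

lemma subst3_eq: "subst3 F a b c = extend_hom (eval2 const2 a b) c F"
  by (simp add: subst3_def subst2_eq extend_hom_def[abs_def])

lemma eval2_simps [simp]:
  assumes "unital_hom k"
  shows "eval2 k a b (const2 c) = k c" "eval2 k a b var_x = a" "eval2 k a b var_y = b"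
  using assms by (simp_all add: const2_def var_x_def var_y_def unital_hom_extend)


section \<open>The centre of a valuation ring\<close>

definition integral_closure :: "'k::field set \<Rightarrow> 'k set" where
  "integral_closure S = {h. integral_equation S h}"

lemma integral_closure_iff:
  assumes "subring_of_field S"
  shows "h \<in> integral_closure S \<longleftrightarrow> (\<forall>V. valuation_ring V \<longrightarrow> S \<subseteq> V \<longrightarrow> h \<in> V)"
  using integral_in_valuation_ring integral_if_in_all_valuation_rings[OF assms]
  by (auto simp: integral_closure_def)

text \<open>
  Since integrality means membership in all valuation rings above \<open>S\<close>, sums and products of
  integral elements need no elimination.
\<close>
lemma subring_integral_closure:
  assumes "subring_of_field S"
  shows "subring_of_field (integral_closure S)" "S \<subseteq> integral_closure S"
proof -
  show "S \<subseteq> integral_closure S"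
    by (auto simp: integral_closure_iff[OF assms])
  show "subring_of_field (integral_closure S)"
    unfolding subring_of_field_def
  proof (intro conjI ballI)
    show "1 \<in> integral_closure S"
      by (auto simp: integral_closure_iff[OF assms] subring_closed valuation_ringD(1))
    fix a b assume "a \<in> integral_closure S" "b \<in> integral_closure S"
    then have "a \<in> V \<and> b \<in> V" if "valuation_ring V" "S \<subseteq> V" for V
      using that by (auto simp: integral_closure_iff[OF assms])
    then show "a - b \<in> integral_closure S" "a * b \<in> integral_closure S"
      by (auto simp: integral_closure_iff[OF assms] subring_closed valuation_ringD(1))
  qed
qed

text \<open>
  In a valuation ring above \<open>S\<close>, either \<open>h\<close> itself is present, or \<open>1/h\<close> is and the equation
  divided by the right power of \<open>h\<close> expresses \<open>lead_coeff P * h\<close>.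
\<close>
lemma leading_coeff_times_root_integral:
  assumes S: "subring_of_field S" and P: "\<And>i. coeff P i \<in> integral_closure S" "poly P h = 0" "degree P > 0"
  shows "lead_coeff P * h \<in> integral_closure S"
  unfolding integral_closure_iff[OF S]
proof (intro allI impI)
  fix V assume V: "valuation_ring V" "S \<subseteq> V"
  note cl = subring_closed[OF valuation_ringD(1)[OF V(1)]]
  have PV: "coeff P i \<in> V" for i using P(1) V by (simp add: integral_closure_iff[OF S])
  show "lead_coeff P * h \<in> V"
  proof (cases "h \<in> V")
    case True
    then show ?thesis using PV cl by simp
  next
    case False
    then have ih: "inverse h \<in> V" and h0: "h \<noteq> 0" using V cl(1) unfolding valuation_ring_def by auto
    define n where "n = degree P - 1"
    have n: "degree P = Suc n" using P(3) by (simp add: n_def)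
    have "0 = (\<Sum>i\<le>n. coeff P i * h ^ i) + lead_coeff P * h ^ Suc n"
      using P(2) unfolding poly_altdef n by simp
    then have "lead_coeff P * h * h ^ n = - (\<Sum>i\<le>n. coeff P i * h ^ i)"
      by (simp add: eq_neg_iff_add_eq_0 algebra_simps)
    then have "lead_coeff P * h = - (\<Sum>i\<le>n. coeff P i * h ^ i) / h ^ n"
      using h0 by (simp add: field_simps)
    also have "\<dots> = - (\<Sum>i\<le>n. coeff P i * inverse h ^ (n - i))"
    proof -
      have "coeff P i * h ^ i / h ^ n = coeff P i * inverse h ^ (n - i)" if "i \<le> n" for i
      proof -
        have "h ^ n = h ^ i * h ^ (n - i)" using that by (simp flip: power_add)
        then show ?thesis using h0 by (simp add: divide_inverse power_inverse)
      qed
      then show ?thesis by (simp add: sum_divide_distrib)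
    qed
    also have "\<dots> \<in> V"
      by (intro cl(3) subring_sum[OF valuation_ringD(1)[OF V(1)]] cl(6,7) PV ih)
    finally show ?thesis .
  qed
qed

text \<open>
  Seidenberg's argument. Let \<open>c\<close> be the leading coefficient. If \<open>c\<close> and the integral element
  \<open>c h\<close> both belong to \<open>M\<close>, the leading term \<open>c h^n = (c h) h^(n - 1)\<close> can be merged with the
  next one; this lowers the degree and changes no coefficient modulo \<open>M\<close>.
\<close>
lemma root_is_quotient_of_integral_elements:
  assumes S: "subring_of_field S" and M: "0 \<in> M" "\<And>a b. a \<in> M \<Longrightarrow> b \<in> M \<Longrightarrow> a - b \<in> M"
    and P: "\<And>i. coeff P i \<in> integral_closure S" "poly P h = 0" "coeff P j \<notin> M"
  shows "\<exists>a\<in>integral_closure S. \<exists>b\<in>integral_closure S. b * h = a \<and> \<not> (a \<in> M \<and> b \<in> M)"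
  using P
proof (induction "degree P" arbitrary: P j rule: less_induct)
  case less
  note cl = subring_closed[OF subring_integral_closure(1)[OF S]]
  show ?case
  proof (cases "degree P = 0")
    case True
    then obtain c where "P = [:c:]" using degree_eq_zeroE by auto
    then show ?thesis using less.prems M by (cases j) auto
  next
    case False
    define n c where "n = degree P" and "c = lead_coeff P"
    have n0: "n > 0" using False by (simp add: n_def)
    have b: "c * h \<in> integral_closure S"
      unfolding c_def using leading_coeff_times_root_integral[OF S less.prems(1,2)] False by simp
    show ?thesis
    proof (cases "c * h \<in> M \<and> c \<in> M")
      case False
      then show ?thesis using b less.prems(1) unfolding c_def by blast
    next
      case True
      \<comment> \<open>merging the leading term with the next one\<close>
      define P' where "P' = P - monom c n + monom (c * h) (n - 1)"
      have "coeff P' i \<in> integral_closure S" for i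
        using less.prems(1)[of i] less.prems(1)[of n] b cl by (auto simp: P'_def c_def n_def)
      moreover have "poly P' h = 0"
        using less.prems(2) n0 by (cases n) (simp_all add: P'_def poly_monom)
      moreover have "coeff P' i = 0" if "i \<ge> n" for i
        using that n0 by (auto simp: P'_def c_def n_def coeff_eq_0)
      then have "degree P' < degree P"
        using n0 unfolding n_def
        by (metis coeff_0 degree_0 leading_coeff_0_iff linorder_not_less)
      moreover have "coeff P' j \<notin> M"
      proof
        assume *: "coeff P' j \<in> M"
        show False
        proof (cases "j = n - 1")
          case True
          then have "coeff P' j = coeff P j + c * h" using n0 by (auto simp: P'_def)
          then have "coeff P j = coeff P' j - c * h" by simp
          then show False using * \<open>c * h \<in> M \<and> c \<in> M\<close> M(2) less.prems(3) by metis
        next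
          case False
          moreover have "j \<noteq> n" using less.prems(3) \<open>c * h \<in> M \<and> c \<in> M\<close> by (auto simp: c_def n_def)
          ultimately have "coeff P' j = coeff P j" by (simp add: P'_def)
          then show False using * less.prems(3) by simp
        qed
      qed
      ultimately show ?thesis using less.hyps by blast
    qed
  qed
qed

text \<open>
  If \<open>h\<close> satisfies an equation with a coefficient that is a unit at the centre, then \<open>h\<close> or
  \<open>1/h\<close> lies in the local ring of the integral closure at the centre, which depends on the
  centre only.
\<close>
lemma valuation_ring_determined_by_centre:
  assumes S: "subring_of_field S"
    and V: "valuation_ring V" "S \<subseteq> V" and W: "valuation_ring W" "S \<subseteq> W"
    and eq: "nonunits V \<inter> integral_closure S = nonunits W \<inter> integral_closure S"
    and h: "h \<in> V" "\<And>i. coeff P i \<in> S" "coeff P j \<notin> nonunits V" "poly P h = 0"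
  shows "h \<in> W"
proof -
  note idl = nonunits_rules[OF V(1) V(1)]
  have BV: "integral_closure S \<subseteq> V" "integral_closure S \<subseteq> W"
    using V W by (auto simp: integral_closure_iff[OF S])
  have P': "\<And>i. coeff P i \<in> integral_closure S" using h(2) subring_integral_closure(2)[OF S] by blast
  obtain a b where ab: "a \<in> integral_closure S" "b \<in> integral_closure S" "b * h = a"
    "\<not> (a \<in> nonunits V \<and> b \<in> nonunits V)"
    using root_is_quotient_of_integral_elements[OF S idl(2,7) P' h(4,3)] by blast
  have "b \<notin> nonunits V"
    using ab idl(5)[of b h] h(1) by blast
  then have "b \<notin> nonunits W" using eq ab(2) by blast
  then have "inverse b \<in> W" "b \<noteq> 0" using ab(2) BV by (auto simp: nonunits_def)
  moreover have "h = inverse b * a" using ab(3) \<open>b \<noteq> 0\<close> by (auto simp: field_simps)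
  ultimately show ?thesis
    using ab(1) BV subring_closed(6)[OF valuation_ringD(1)[OF W(1)]] by blast
qed


section \<open>The normalization of an affine plane curve\<close>

text \<open>
  A ring record all of whose elements are images under \<open>h\<close> of elements of a subring of a field.
  The function field and the normalization have this form, \<open>h\<close> being the passage to residue
  classes, so that computations in them become computations with rational functions on the
  plane.
\<close>
definition presents :: "('c, 'm) ring_scheme \<Rightarrow> ('k::field \<Rightarrow> 'c) \<Rightarrow> 'k set \<Rightarrow> bool" where
  "presents R h S \<longleftrightarrow> subring_of_field S \<and> carrier R = h ` S \<and> one R = h 1 \<and> zero R = h 0 \<and>
     (\<forall>a\<in>S. \<forall>b\<in>S. add R (h a) (h b) = h (a + b) \<and> mult R (h a) (h b) = h (a * b))"

lemma presentsD:
  assumes "presents R h S"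
  shows "subring_of_field S" "carrier R = h ` S" "one R = h 1" "zero R = h 0"
    "a \<in> S \<Longrightarrow> b \<in> S \<Longrightarrow> add R (h a) (h b) = h (a + b)"
    "a \<in> S \<Longrightarrow> b \<in> S \<Longrightarrow> mult R (h a) (h b) = h (a * b)"
  using assms unfolding presents_def by auto

lemma presents_cring:
  assumes "presents R h S"
  shows "cring R"
proof -
  note P = presentsD[OF assms] and cl = subring_closed[OF presentsD(1)[OF assms]]
  show ?thesis
  proof (rule cringI)
    show "abelian_group R"
    proof (rule abelian_groupI)
      fix x assume "x \<in> carrier R"
      then obtain a where "a \<in> S" "x = h a" by (auto simp: P)
      then show "\<exists>y\<in>carrier R. y \<oplus>\<^bsub>R\<^esub> x = \<zero>\<^bsub>R\<^esub>"
        using P(5)[of "- a" a] cl(3)[of a] by (intro bexI[of _ "h (- a)"]) (auto simp: P)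
    qed (use cl in \<open>auto simp: P add_ac\<close>)
    show "comm_monoid R"
      by (rule comm_monoidI) (use cl in \<open>auto simp: P mult_ac\<close>)
  qed (use cl in \<open>auto simp: P algebra_simps\<close>)
qed

lemma presents_ideal:
  assumes pr: "presents R h S" and J: "ideal_in S J"
  shows "ideal (h ` J) R"
proof -
  note P = presentsD[OF pr] and cl = subring_closed[OF presentsD(1)[OF pr]]
  note jcl = ideal_closed[OF P(1) J]
  interpret cring R by (rule presents_cring[OF pr])
  have neg: "\<ominus>\<^bsub>R\<^esub> (h a) = h (- a)" if "a \<in> S" for a
    by (rule minus_equality) (use that cl in \<open>auto simp: P\<close>)
  show ?thesis
  proof (rule idealI)
    show "ring R" ..
    show "subgroup (h ` J) (add_monoid R)"
    proof (rule add.subgroupI)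
      show "h ` J \<subseteq> carrier R" using jcl(1) by (auto simp: P)
      show "h ` J \<noteq> {}" using jcl(2) by auto
      show "\<ominus>\<^bsub>R\<^esub> a \<in> h ` J" if "a \<in> h ` J" for a
        using that jcl(1,6) by (auto simp: neg)
      show "a \<oplus>\<^bsub>R\<^esub> b \<in> h ` J" if "a \<in> h ` J" "b \<in> h ` J" for a b
        using that jcl(1,3) by (auto simp: P)
    qed
    show "x \<otimes>\<^bsub>R\<^esub> a \<in> h ` J" if "a \<in> h ` J" "x \<in> carrier R" for a x
      using that jcl(1,4) by (auto simp: P)
    show "a \<otimes>\<^bsub>R\<^esub> x \<in> h ` J" if "a \<in> h ` J" "x \<in> carrier R" for a x
      using that jcl(1,5) by (auto simp: P)
  qed
qed

lemma presents_pow: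
  assumes pr: "presents R h S" and "a \<in> S"
  shows "h a [^]\<^bsub>R\<^esub> (n::nat) = h (a ^ n)"
proof -
  interpret cring R by (rule presents_cring[OF pr])
  show ?thesis
    by (induction n) (use presentsD[OF pr] subring_closed[OF presentsD(1)[OF pr]] assms in
        \<open>simp_all add: mult.commute\<close>)
qed

lemma presents_finsum:
  assumes pr: "presents R h S" and "finite A" "\<And>i. i \<in> A \<Longrightarrow> g i \<in> S"
  shows "(\<Oplus>\<^bsub>R\<^esub>i\<in>A. h (g i)) = h (\<Sum>i\<in>A. g i)"
proof -
  interpret cring R by (rule presents_cring[OF pr])
  note P = presentsD[OF pr] and cl = subring_closed[OF presentsD(1)[OF pr]]
  show ?thesis using assms(2,3)
  proof (induction A)
    case empty
    then show ?case by (simp add: P)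
  next
    case (insert x F)
    have "(\<Oplus>\<^bsub>R\<^esub>i\<in>insert x F. h (g i)) = h (g x) \<oplus>\<^bsub>R\<^esub> (\<Oplus>\<^bsub>R\<^esub>i\<in>F. h (g i))"
      using insert by (intro finsum_insert) (auto simp: P)
    also have "\<dots> = h (g x + (\<Sum>i\<in>F. g i))"
      using insert subring_sum[OF P(1), of F g] by (simp add: P)
    finally show ?case using insert by simp
  qed
qed

definition const_term :: "poly2 \<Rightarrow> complex" where
  "const_term p = coeff2 p 0 0"

lemma unital_hom_const_term: "unital_hom const_term"
  by (simp add: unital_hom_def const_term_def coeff2_def coeff_mult)

lemmas const_term_simps = unital_homD[OF unital_hom_const_term]

lemma const_term_basic [simp]: "const_term (const2 c) = c" "const_term var_x = 0" "const_term var_y = 0"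
  by (simp_all add: const_term_def const2_def var_x_def var_y_def coeff2_def)

lemma unital_hom_to_fract: "unital_hom to_fract"
  by (simp add: unital_hom_def)

definition const_fract :: "complex \<Rightarrow> poly2 fract" where
  "const_fract c = to_fract (const2 c)"

lemma unital_hom_const_fract: "unital_hom const_fract"
  unfolding const_fract_def[abs_def]
  by (rule unital_hom_comp[OF unital_hom_to_fract unital_hom_const2])

abbreviation generic_fractions :: "poly2 \<Rightarrow> poly2 fract set" where
  "generic_fractions f \<equiv> carrier (generic_ring f)"

lemma generic_fractions_eq: "generic_fractions f = {Fract a b | a b. \<not> f dvd b}"
  by (simp add: generic_ring_def)

lemma generic_fractionsI: "\<not> f dvd b \<Longrightarrow> Fract a b \<in> generic_fractions f"
  by (auto simp: generic_fractions_eq)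

lemma generic_idealI: "f dvd a \<Longrightarrow> \<not> f dvd b \<Longrightarrow> Fract a b \<in> generic_ideal f"
  by (auto simp: generic_ideal_def)

lemma subring_generic:
  assumes "prime_elem f"
  shows "subring_of_field (generic_fractions f)"
  unfolding subring_of_field_def
proof (intro conjI ballI)
  show "1 \<in> generic_fractions f"
    using generic_fractionsI[of f 1 1] assms by (simp add: One_fract_def)
  fix g h assume "g \<in> generic_fractions f" "h \<in> generic_fractions f"
  then obtain a b c d where *: "g = Fract a b" "\<not> f dvd b" "h = Fract c d" "\<not> f dvd d"
    by (auto simp: generic_fractions_eq)
  then have "b \<noteq> 0" "d \<noteq> 0" "\<not> f dvd b * d" using assms by (auto simp: prime_elem_dvd_mult_iff)
  then show "g - h \<in> generic_fractions f" "g * h \<in> generic_fractions f"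
    using * by (auto intro!: generic_fractionsI)
qed

lemma ideal_generic:
  assumes "prime_elem f"
  shows "ideal_in (generic_fractions f) (generic_ideal f)"
  unfolding ideal_in_def
proof (intro conjI ballI)
  show "generic_ideal f \<subseteq> generic_fractions f"
    by (auto simp: generic_ideal_def generic_fractions_eq)
  show "0 \<in> generic_ideal f"
    using generic_idealI[of f 0 1] assms by (simp add: Zero_fract_def)
  show "g + h \<in> generic_ideal f" if "g \<in> generic_ideal f" "h \<in> generic_ideal f" for g h
  proof -
    from that obtain a b c d where *: "g = Fract a b" "\<not> f dvd b" "f dvd a" "h = Fract c d" "\<not> f dvd d" "f dvd c"
      by (auto simp: generic_ideal_def)
    then have "b \<noteq> 0" "d \<noteq> 0" "\<not> f dvd b * d" using assms by (auto simp: prime_elem_dvd_mult_iff)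
    then show ?thesis using * by (auto intro!: generic_idealI)
  qed
  show "g * h \<in> generic_ideal f" if "g \<in> generic_fractions f" "h \<in> generic_ideal f" for g h
  proof -
    from that obtain a b c d where *: "g = Fract a b" "\<not> f dvd b" "h = Fract c d" "\<not> f dvd d" "f dvd c"
      by (auto simp: generic_ideal_def generic_fractions_eq)
    then have "\<not> f dvd b * d" using assms by (auto simp: prime_elem_dvd_mult_iff)
    then show ?thesis using * by (auto intro!: generic_idealI)
  qed
qed

lemma Fract_in_generic_ideal_iff:
  assumes "prime_elem f" "\<not> f dvd b"
  shows "Fract a b \<in> generic_ideal f \<longleftrightarrow> f dvd a"
proof
  assume "Fract a b \<in> generic_ideal f"
  then obtain c d where *: "Fract a b = Fract c d" "f dvd c" "\<not> f dvd d"
    by (auto simp: generic_ideal_def)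
  then have "b \<noteq> 0" "d \<noteq> 0" using assms by auto
  then have "a * d = c * b" using * by (simp add: eq_fract)
  then have "f dvd a * d" using * by simp
  then show "f dvd a" using assms * by (simp add: prime_elem_dvd_mult_iff)
qed (use assms in \<open>auto intro: generic_idealI\<close>)

lemma to_fract_in_generic_ideal_iff: "prime_elem f \<Longrightarrow> to_fract p \<in> generic_ideal f \<longleftrightarrow> f dvd p"
  unfolding to_fract_def by (rule Fract_in_generic_ideal_iff) auto

lemma to_fract_in_generic_fractions: "prime_elem f \<Longrightarrow> to_fract p \<in> generic_fractions f"
  unfolding to_fract_def by (rule generic_fractionsI) auto

lemma inverse_in_generic_fractions:
  assumes "prime_elem f" "g \<in> generic_fractions f" "g \<notin> generic_ideal f"
  shows "inverse g \<in> generic_fractions f"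
proof -
  obtain a b where *: "g = Fract a b" "\<not> f dvd b" using assms by (auto simp: generic_fractions_eq)
  then have "\<not> f dvd a" using assms by (auto intro: generic_idealI)
  then show ?thesis using * by (auto intro: generic_fractionsI)
qed

text \<open>
  The fractions with denominator prime to \<open>f\<close> form the valuation ring of the order of vanishing
  along \<open>f = 0\<close>, and the generic ideal is its maximal ideal.
\<close>
lemma inverse_in_generic_ideal:
  assumes "prime_elem f" "g \<notin> generic_fractions f"
  shows "inverse g \<in> generic_ideal f"
proof -
  define a b where "a = fst (quot_of_fract g)" and "b = snd (quot_of_fract g)"
  have ab: "g = Fract a b" "coprime a b" by (simp_all add: a_def b_def coprime_quot_of_fract)
  have "f dvd b" using assms(2) ab generic_fractionsI by blast
  moreover have "\<not> f dvd a"
    using ab(2) assms(1) \<open>f dvd b\<close> coprime_common_divisor prime_elem_not_unit by blast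
  ultimately show ?thesis using ab by (auto intro: generic_idealI)
qed

lemma generic_ideal_prime:
  assumes "prime_elem f" "g \<in> generic_fractions f" "h \<in> generic_fractions f" "g * h \<in> generic_ideal f"
  shows "g \<in> generic_ideal f \<or> h \<in> generic_ideal f"
proof -
  from assms obtain a b c d where *: "g = Fract a b" "\<not> f dvd b" "h = Fract c d" "\<not> f dvd d"
    by (auto simp: generic_fractions_eq)
  then have "\<not> f dvd b * d" using assms by (auto simp: prime_elem_dvd_mult_iff)
  then have "f dvd a * c" using assms * Fract_in_generic_ideal_iff[of f "b * d" "a * c"] by simp
  then show ?thesis using assms * by (auto simp: prime_elem_dvd_mult_iff intro: generic_idealI)
qed

text \<open>
  The preimages in \<open>\<complex>(x, y)\<close> of the subring of the function field generated by the coordinates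
  \<open>h x\<close> and \<open>h y\<close>, and of its ideal generated by these coordinates.
\<close>
definition chart_ring :: "poly2 \<Rightarrow> (poly2 \<Rightarrow> poly2 fract) \<Rightarrow> poly2 fract set" where
  "chart_ring f h = {h p + i | p i. i \<in> generic_ideal f}"

definition chart_max :: "poly2 \<Rightarrow> (poly2 \<Rightarrow> poly2 fract) \<Rightarrow> poly2 fract set" where
  "chart_max f h = {h p + i | p i. const_term p = 0 \<and> i \<in> generic_ideal f}"

abbreviation coord_ring :: "poly2 \<Rightarrow> poly2 fract set" where
  "coord_ring f \<equiv> chart_ring f to_fract"

abbreviation origin_max :: "poly2 \<Rightarrow> poly2 fract set" where
  "origin_max f \<equiv> chart_max f to_fract"

locale affine_curve =
  fixes f :: poly2
  assumes prime: "prime_elem f" and origin: "const_term f = 0"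
begin

abbreviation "G \<equiv> generic_fractions f"
abbreviation "I \<equiv> generic_ideal f"
abbreviation "A \<equiv> coord_ring f"
abbreviation "B \<equiv> integral_closure (coord_ring f)"
abbreviation "K \<equiv> function_field f"
abbreviation "cls \<equiv> a_r_coset (generic_ring f) (generic_ideal f)"

lemmas G_closed = subring_closed[OF subring_generic[OF prime]]
lemmas I_closed = ideal_closed[OF subring_generic[OF prime] ideal_generic[OF prime]]

lemma one_notin_I: "1 \<notin> I"
  using to_fract_in_generic_ideal_iff[OF prime, of 1] prime by (auto dest: prime_elem_not_unit)

lemma subring_chart:
  assumes h: "unital_hom h" "\<And>p. h p \<in> G"
  shows "subring_of_field (chart_ring f h)" "I \<subseteq> chart_ring f h" "h p \<in> chart_ring f h"
    "chart_ring f h \<subseteq> G"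
proof -
  note hs = unital_homD[OF h(1)]
  show "I \<subseteq> chart_ring f h"
  proof
    fix i assume "i \<in> I"
    then have "h 0 + i \<in> chart_ring f h" unfolding chart_ring_def by blast
    then show "i \<in> chart_ring f h" by (simp add: hs)
  qed
  show in_A: "h p \<in> chart_ring f h" for p unfolding chart_ring_def using I_closed(2) by force
  show sub: "chart_ring f h \<subseteq> G" unfolding chart_ring_def
    using h(2) G_closed I_closed by auto
  show "subring_of_field (chart_ring f h)"
    unfolding subring_of_field_def
  proof (intro conjI ballI)
    show "1 \<in> chart_ring f h" using in_A[of 1] by (simp add: hs)
    fix a b assume ab: "a \<in> chart_ring f h" "b \<in> chart_ring f h"
    then obtain p q i j where *: "a = h p + i" "b = h q + j" "i \<in> I" "j \<in> I"
      unfolding chart_ring_def by auto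
    have "a - b = h (p - q) + (i - j)" using * by (simp add: hs)
    then show "a - b \<in> chart_ring f h" using * I_closed(7) unfolding chart_ring_def by blast
    have "a * b = h (p * q) + (h p * j + i * b)" using * by (simp add: hs algebra_simps)
    moreover have "h p * j + i * b \<in> I"
      using * ab(2) sub h(2) I_closed(3-5) by blast
    ultimately show "a * b \<in> chart_ring f h" unfolding chart_ring_def by blast
  qed
qed

lemma ideal_chart_max:
  assumes h: "unital_hom h" "\<And>p. h p \<in> G"
  shows "ideal_in (chart_ring f h) (chart_max f h)"
  unfolding ideal_in_def
proof (intro conjI ballI)
  note hs = unital_homD[OF h(1)]
  show "chart_max f h \<subseteq> chart_ring f h" unfolding chart_max_def chart_ring_def by blast
  have "h 0 + 0 \<in> chart_max f h" unfolding chart_max_def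
    using I_closed(2) const_term_simps(1) by blast
  then show "0 \<in> chart_max f h" by (simp add: hs)
  show "a + b \<in> chart_max f h" if "a \<in> chart_max f h" "b \<in> chart_max f h" for a b
  proof -
    from that obtain p q i j where *: "a = h p + i" "b = h q + j" "i \<in> I" "j \<in> I"
      "const_term p = 0" "const_term q = 0"
      unfolding chart_max_def by auto
    have "a + b = h (p + q) + (i + j)" using * by (simp add: hs)
    moreover have "const_term (p + q) = 0" using * by (simp add: const_term_simps)
    ultimately show ?thesis using * I_closed(3) unfolding chart_max_def by blast
  qed
  show "a * b \<in> chart_max f h" if "a \<in> chart_ring f h" "b \<in> chart_max f h" for a b
  proof -
    from that obtain p q i j where *: "a = h p + i" "b = h q + j" "i \<in> I" "j \<in> I"
      "const_term q = 0"
      unfolding chart_max_def chart_ring_def by auto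
    have "a * b = h (p * q) + (a * j + h q * i)" using * by (simp add: hs algebra_simps)
    moreover have "a * j + h q * i \<in> I"
      using * that(1) subring_chart(4)[OF h] h(2) I_closed(3-5) by blast
    moreover have "const_term (p * q) = 0" using * by (simp add: const_term_simps)
    ultimately show ?thesis unfolding chart_max_def by blast
  qed
qed

text \<open>
  The ideal is proper because the origin lies on the curve \<open>g = 0\<close> described by the coordinates.
\<close>
lemma one_notin_chart_max:
  assumes h: "unital_hom h" "\<And>p. h p \<in> I \<Longrightarrow> g dvd p" and g: "const_term g = 0"
  shows "1 \<notin> chart_max f h"
proof
  note hs = unital_homD[OF h(1)]
  assume "1 \<in> chart_max f h"
  then obtain p i where *: "1 = h p + i" "i \<in> I" "const_term p = 0"
    unfolding chart_max_def by auto
  then have "h (1 - p) = i" by (metis add_diff_cancel_left' hs(2,6))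
  then have "g dvd 1 - p" using * h(2) by metis
  then obtain r where "1 - p = g * r" by auto
  then have "const_term (1 - p) = const_term (g * r)" by simp
  then show False using * g by (simp add: const_term_simps)
qed

lemmas subring_A = subring_chart(1)[OF unital_hom_to_fract to_fract_in_generic_fractions[OF prime]]
lemmas I_sub_A = subring_chart(2)[OF unital_hom_to_fract to_fract_in_generic_fractions[OF prime]]
lemmas to_fract_in_A = subring_chart(3)[OF unital_hom_to_fract to_fract_in_generic_fractions[OF prime]]
lemmas A_sub_G = subring_chart(4)[OF unital_hom_to_fract to_fract_in_generic_fractions[OF prime]]
lemmas ideal_origin_max = ideal_chart_max[OF unital_hom_to_fract to_fract_in_generic_fractions[OF prime]]
lemmas one_notin_origin_max = one_notin_chart_max[OF unital_hom_to_fract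
  to_fract_in_generic_ideal_iff[OF prime, THEN iffD1] origin]

text \<open>
  Such a ring lies inside the valuation ring of \<open>f\<close>; modulo the generic ideal it becomes a
  valuation ring of the function field that dominates the local ring of the curve at the origin.
\<close>
definition local_valuation :: "poly2 fract set \<Rightarrow> bool" where
  "local_valuation V \<longleftrightarrow> valuation_ring V \<and> A \<subseteq> V \<and> origin_max f \<subseteq> nonunits V"

lemma local_valuationD:
  assumes "local_valuation V"
  shows "valuation_ring V" "A \<subseteq> V" "origin_max f \<subseteq> nonunits V" "I \<subseteq> nonunits V" "V \<subseteq> G" "B \<subseteq> V"
    "const_fract c \<in> V" "c \<noteq> 0 \<Longrightarrow> const_fract c \<notin> nonunits V"
proof -
  show V: "valuation_ring V" "A \<subseteq> V" "origin_max f \<subseteq> nonunits V"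
    using assms by (auto simp: local_valuation_def)
  show I: "I \<subseteq> nonunits V"
  proof
    fix i assume "i \<in> I"
    then have "to_fract 0 + i \<in> origin_max f" unfolding chart_max_def
      using const_term_simps(1) by blast
    then show "i \<in> nonunits V" using V by auto
  qed
  show "V \<subseteq> G"
  proof
    fix h assume "h \<in> V"
    show "h \<in> G"
    proof (rule ccontr)
      assume "h \<notin> G"
      then have "h \<noteq> 0" "inverse h \<in> nonunits V"
        using I inverse_in_generic_ideal[OF prime] G_closed(1) by auto
      then show False using \<open>h \<in> V\<close> by (auto simp: nonunits_def)
    qed
  qed
  show "B \<subseteq> V" using V by (auto simp: integral_closure_iff[OF subring_A])
  show c: "const_fract c \<in> V" for c using V to_fract_in_A unfolding const_fract_def by blast
  show "const_fract c \<notin> nonunits V" if "c \<noteq> 0"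
  proof -
    have "const_fract c * const_fract (inverse c) = 1"
      using that unital_homD[OF unital_hom_const_fract] by (metis right_inverse)
    then have "inverse (const_fract c) = const_fract (inverse c)" "const_fract c \<noteq> 0"
      by (auto intro: inverse_unique)
    then show ?thesis using c[of "inverse c"] by (auto simp: nonunits_def)
  qed
qed

text \<open>
  Modulo the maximal ideal of \<open>V\<close>, the coefficients of an integral equation for \<open>b\<close> are
  constants; the resulting complex polynomial splits, and one of its linear factors vanishes at
  \<open>b\<close>.
\<close>
lemma residue_exists:
  assumes V: "local_valuation V" and b: "b \<in> B"
  shows "\<exists>c. b - const_fract c \<in> nonunits V"
proof -
  note VD = local_valuationD[OF V]
  note cl = subring_closed[OF valuation_ringD(1)[OF VD(1)]]
  note ncl = nonunits_rules[OF VD(1) VD(1)]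
  let ?ev = "extend_hom const_fract b"
  note ev = unital_homD[OF unital_hom_extend[OF unital_hom_const_fract]]
  have evV: "?ev p \<in> V" for p
    unfolding extend_hom_def
    by (rule subring_poly[OF valuation_ringD(1)[OF VD(1)]])
      (use VD b in \<open>auto simp: coeff_map_poly unital_homD(1)[OF unital_hom_const_fract]\<close>)
  have root: "\<exists>c. b - const_fract c \<in> nonunits V" if "p \<noteq> 0" "?ev p \<in> nonunits V" for p
    using that
  proof (induction "degree p" arbitrary: p)
    case 0
    then obtain c where "p = [:c:]" using degree_eq_zeroE by metis
    then show ?case using 0 VD(8)[of c] by (simp add: unital_hom_const_fract)
  next
    case (Suc n)
    then have "\<not> constant (poly p)" by (simp add: constant_degree)
    then obtain z where "poly p z = 0" using fundamental_theorem_of_algebra by blast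
    then obtain q where q: "p = [:- z, 1:] * q" using poly_eq_0_iff_dvd by (metis dvdE)
    have "?ev p = ?ev [:- z, 1:] * ?ev q" unfolding q by (rule ev)
    also have "?ev [:- z, 1:] = b - const_fract z"
      by (simp add: extend_hom_pCons unital_hom_const_fract unital_homD[OF unital_hom_const_fract])
    finally have "b - const_fract z \<in> nonunits V \<or> ?ev q \<in> nonunits V"
      using Suc.prems(2) nonunits_prime[OF VD(1)] evV cl(5) VD(6,7) b by (metis subsetD)
    moreover have "q \<noteq> 0" using Suc.prems(1) q by auto
    moreover from this have "degree q = n"
      using Suc.hyps(2) unfolding q by (subst (asm) degree_mult_eq) auto
    ultimately show ?case using Suc.hyps(1)[of q] Suc.prems by blast
  qed
  obtain k a where a: "\<And>i. i < k \<Longrightarrow> a i \<in> A" "b ^ k + (\<Sum>i<k. a i * b ^ i) = 0"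
    using b unfolding integral_closure_def integral_equation_def by auto
  have "\<exists>c. a i - const_fract c \<in> nonunits V" if i: "i < k" for i
  proof -
    obtain p j where pj: "a i = to_fract p + j" "j \<in> I" using a(1)[OF i] unfolding chart_ring_def by auto
    have "const_term (p - const2 (const_term p)) = 0" by (simp add: const_term_simps)
    then have "to_fract (p - const2 (const_term p)) + j \<in> origin_max f"
      unfolding chart_max_def using pj(2) by blast
    then show ?thesis using pj VD(3) by (auto simp: const_fract_def algebra_simps)
  qed
  then obtain c where c: "\<And>i. i < k \<Longrightarrow> a i - const_fract (c i) \<in> nonunits V" by metis
  define p where "p = monom 1 k + (\<Sum>i<k. monom (c i) i)"
  have ev_monom: "?ev (monom c i) = const_fract c * b ^ i" for c i
    by (simp add: extend_hom_def map_poly_monom unital_homD(1)[OF unital_hom_const_fract] poly_monom)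
  have "?ev p = b ^ k + (\<Sum>i<k. const_fract (c i) * b ^ i)"
    unfolding p_def by (simp add: ev ev_monom unital_hom_sum[OF unital_hom_extend[OF unital_hom_const_fract]]
        unital_homD[OF unital_hom_const_fract])
  also have "\<dots> = (b ^ k + (\<Sum>i<k. a i * b ^ i)) - (\<Sum>i<k. (a i - const_fract (c i)) * b ^ i)"
    by (simp add: left_diff_distrib sum_subtractf)
  also have "\<dots> = - (\<Sum>i<k. (a i - const_fract (c i)) * b ^ i)" using a(2) by simp
  also have "\<dots> \<in> nonunits V"
    using b VD(6) by (intro ncl(6) ideal_sum[OF valuation_ringD(1)[OF VD(1)] nonunits_ideal[OF VD(1)]]
        ncl(5) c cl(7)) auto
  finally have 1: "?ev p \<in> nonunits V" .
  have "coeff p k = 1"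
    unfolding p_def by (simp add: coeff_sum)
  then have "p \<noteq> 0" by auto
  then show ?thesis using root 1 by blast
qed

lemma presents_generic: "presents (generic_ring f) id G"
  unfolding presents_def using subring_generic[OF prime] by (simp add: generic_ring_def)

lemma cls_eq: "cls g = (\<lambda>i. i + g) ` I"
  by (auto simp: a_r_coset_def r_coset_def generic_ring_def)

lemma cls_eq_iff: "cls g = cls h \<longleftrightarrow> g - h \<in> I"
proof
  assume "cls g = cls h"
  then have "0 + g \<in> (\<lambda>i. i + h) ` I" using I_closed(2) unfolding cls_eq by blast
  then show "g - h \<in> I" by auto
next
  have *: "cls g \<subseteq> cls h" if "g - h \<in> I" for g h
  proof
    fix x assume "x \<in> cls g"
    then obtain i where i: "i \<in> I" "x = i + g" unfolding cls_eq by auto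
    then have "x = (i + (g - h)) + h" by simp
    then show "x \<in> cls h" using i that I_closed(3) unfolding cls_eq by blast
  qed
  assume "g - h \<in> I"
  then show "cls g = cls h" using *[of g h] *[of h g] I_closed(6)[of "g - h"] by auto
qed

lemma presents_function_field: "presents K cls G"
proof -
  have id: "ideal I (generic_ring f)"
    using presents_ideal[OF presents_generic ideal_generic[OF prime]] by simp
  then interpret ideal I "generic_ring f" .
  show ?thesis
    unfolding presents_def function_field_def
  proof (intro conjI ballI subring_generic prime)
    show "carrier (generic_ring f Quot I) = cls ` G"
      by (auto simp: FactRing_def A_RCOSETS_def' a_r_coset_def')
    show "\<one>\<^bsub>generic_ring f Quot I\<^esub> = cls 1" by (simp add: FactRing_def generic_ring_def)
    show "\<zero>\<^bsub>generic_ring f Quot I\<^esub> = cls 0" by (simp add: FactRing_def cls_eq)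
    fix a b assume "a \<in> G" "b \<in> G"
    then show "cls a \<oplus>\<^bsub>generic_ring f Quot I\<^esub> cls b = cls (a + b)"
      "cls a \<otimes>\<^bsub>generic_ring f Quot I\<^esub> cls b = cls (a * b)"
      using a_rcos_sum[of a b] rcoset_mult_add[of a b]
      by (simp_all add: FactRing_def) (simp_all add: generic_ring_def)
  qed
qed

lemma coordinate_ring_eq: "coordinate_ring f = cls ` A"
proof -
  have "cls (to_fract p + i) = cls (to_fract p)" if "i \<in> I" for p i
    using that by (simp add: cls_eq_iff)
  then show ?thesis
    unfolding coordinate_ring_def to_function_field_def chart_ring_def to_fract_def[symmetric]
    using I_closed(2) by (fastforce simp: image_iff)
qed

lemma origin_ideal_eq: "origin_ideal f = cls ` origin_max f"
proof -
  have "cls (to_fract p + i) = cls (to_fract p)" if "i \<in> I" for p i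
    using that by (simp add: cls_eq_iff)
  then show ?thesis
    unfolding origin_ideal_def to_function_field_def chart_max_def to_fract_def[symmetric] const_term_def
    using I_closed(2) by (fastforce simp: image_iff)
qed

lemma B_sub_G: "B \<subseteq> G"
proof
  fix b assume b: "b \<in> B"
  obtain V where "valuation_ring V" "A \<subseteq> V" "origin_max f \<subseteq> nonunits V"
    using chevalley_extension[OF subring_A ideal_origin_max one_notin_origin_max] .
  then have "local_valuation V" by (simp add: local_valuation_def)
  then show "b \<in> G" using b local_valuationD(5,6) by blast
qed

text \<open>
  An integral equation for a residue class holds for its representative up to an element of the
  generic ideal, which can be absorbed into the constant coefficient.
\<close>
lemma integral_over_iff:
  assumes g: "g \<in> G"
  shows "integral_over K (coordinate_ring f) (cls g) \<longleftrightarrow> g \<in> B"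
proof -
  note P = presentsD[OF presents_function_field]
  have expr: "cls g [^]\<^bsub>K\<^esub> k \<oplus>\<^bsub>K\<^esub> (\<Oplus>\<^bsub>K\<^esub>i\<in>{..<k}. cls (a i) \<otimes>\<^bsub>K\<^esub> cls g [^]\<^bsub>K\<^esub> i)
      = cls (g ^ k + (\<Sum>i<k. a i * g ^ i))" if a: "\<And>i. i < k \<Longrightarrow> a i \<in> G" for k :: nat and a
  proof -
    interpret KK: cring K by (rule presents_cring[OF presents_function_field])
    have "(\<Oplus>\<^bsub>K\<^esub>i\<in>{..<k}. cls (a i) \<otimes>\<^bsub>K\<^esub> cls g [^]\<^bsub>K\<^esub> i) = (\<Oplus>\<^bsub>K\<^esub>i\<in>{..<k}. cls (a i * g ^ i))"
      by (rule KK.finsum_cong') (use a g G_closed in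
          \<open>auto simp: P presents_pow[OF presents_function_field]\<close>)
    also have "\<dots> = cls (\<Sum>i<k. a i * g ^ i)"
      by (rule presents_finsum[OF presents_function_field]) (use a g G_closed in auto)
    finally show ?thesis
      using g a G_closed subring_sum[OF P(1), of "{..<k}" "\<lambda>i. a i * g ^ i"]
      by (simp add: P presents_pow[OF presents_function_field])
  qed
  show ?thesis
  proof
    assume "integral_over K (coordinate_ring f) (cls g)"
    then obtain k :: nat and a where a: "\<forall>i<k. a i \<in> cls ` A"
      "cls g [^]\<^bsub>K\<^esub> k \<oplus>\<^bsub>K\<^esub> (\<Oplus>\<^bsub>K\<^esub>i\<in>{..<k}. a i \<otimes>\<^bsub>K\<^esub> cls g [^]\<^bsub>K\<^esub> i) = \<zero>\<^bsub>K\<^esub>"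
      unfolding integral_over_def coordinate_ring_eq by (elim exE conjE) (rule that)
    from a(1) have "\<forall>i. \<exists>b. i < k \<longrightarrow> b \<in> A \<and> a i = cls b" by blast
    then obtain b where b: "\<And>i. i < k \<Longrightarrow> b i \<in> A" "\<And>i. i < k \<Longrightarrow> a i = cls (b i)" by metis
    have "(\<Oplus>\<^bsub>K\<^esub>i\<in>{..<k}. a i \<otimes>\<^bsub>K\<^esub> cls g [^]\<^bsub>K\<^esub> i) = (\<Oplus>\<^bsub>K\<^esub>i\<in>{..<k}. cls (b i) \<otimes>\<^bsub>K\<^esub> cls g [^]\<^bsub>K\<^esub> i)"
    proof -
      interpret KK: cring K by (rule presents_cring[OF presents_function_field])
      have bG: "b i \<in> G" if "i < k" for i using b(1)[OF that] A_sub_G by blast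
      show ?thesis
        by (rule KK.finsum_cong') (use b(2) bG g G_closed in
          \<open>auto simp: P presents_pow[OF presents_function_field]\<close>)
    qed
    then have "cls (g ^ k + (\<Sum>i<k. b i * g ^ i)) = cls 0"
      using a(2) expr[of k b] b A_sub_G by (simp add: P subset_iff)
    then have I: "g ^ k + (\<Sum>i<k. b i * g ^ i) \<in> I" by (simp add: cls_eq_iff)
    have "k \<noteq> 0"
    proof
      assume "k = 0"
      then show False using I one_notin_I by simp
    qed
    \<comment> \<open>the error term is absorbed into the constant coefficient\<close>
    define c where "c i = (if i = 0 then b 0 - (g ^ k + (\<Sum>i<k. b i * g ^ i)) else b i)" for i
    have "(\<Sum>i<k. c i * g ^ i) = (\<Sum>i<k. b i * g ^ i) - (g ^ k + (\<Sum>i<k. b i * g ^ i))"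
      using \<open>k \<noteq> 0\<close> by (cases k) (simp_all add: c_def sum.lessThan_Suc_shift del: sum.lessThan_Suc)
    then have "g ^ k + (\<Sum>i<k. c i * g ^ i) = 0" by simp
    moreover have "\<forall>i<k. c i \<in> A"
      using b(1) I I_sub_A subring_closed(5)[OF subring_A] \<open>k \<noteq> 0\<close> unfolding c_def by auto
    ultimately show "g \<in> B" unfolding integral_closure_def integral_equation_def by blast
  next
    assume "g \<in> B"
    then obtain k a where a: "\<And>i. i < k \<Longrightarrow> a i \<in> A" "g ^ k + (\<Sum>i<k. a i * g ^ i) = 0"
      unfolding integral_closure_def integral_equation_def by auto
    then show "integral_over K (coordinate_ring f) (cls g)"
      unfolding integral_over_def coordinate_ring_eq
      using expr[of k a] A_sub_G by (intro exI[of _ k] exI[of _ "\<lambda>i. cls (a i)"]) (auto simp: P)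
  qed
qed

lemma presents_normalization: "presents (normalization_ring f) cls B"
proof -
  note P = presentsD[OF presents_function_field]
  have "carrier (normalization_ring f) = cls ` B"
    unfolding normalization_ring_def using integral_over_iff B_sub_G by (auto simp: P)
  then show ?thesis
    unfolding presents_def using subring_integral_closure(1)[OF subring_A] P(3-6) B_sub_G
    by (simp add: normalization_ring_def subset_iff)
qed

lemma ideal_centre:
  assumes V: "local_valuation V"
  shows "ideal_in B (nonunits V \<inter> B)"
proof -
  note VD = local_valuationD[OF V]
  note ncl = nonunits_rules[OF VD(1) VD(1)]
  note bcl = subring_closed[OF subring_integral_closure(1)[OF subring_A]]
  show ?thesis
    unfolding ideal_in_def
  proof (intro conjI ballI)
    fix a b assume a: "a \<in> B" and b: "b \<in> nonunits V \<inter> B"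
    then show "a * b \<in> nonunits V \<inter> B" using ncl(4)[of a b] VD(6) bcl(6) by blast
  qed (use ncl(2,3) bcl(1,4) in auto)
qed

text \<open>
  The centre is maximal because every element of the normalization has a constant residue.
\<close>
lemma centre_in_fibre:
  assumes V: "local_valuation V"
  shows "cls ` (nonunits V \<inter> B) \<in> normalization_fibre f"
proof -
  note VD = local_valuationD[OF V]
  note P = presentsD[OF presents_normalization]
  note ncl = nonunits_rules[OF VD(1) VD(1)]
  note bcl = subring_closed[OF P(1)]
  have cls_mem: "b \<in> nonunits V" if "cls b \<in> cls ` (nonunits V \<inter> B)" for b
  proof -
    from that obtain a where "a \<in> nonunits V" "cls b = cls a" by auto
    then have "b - a \<in> nonunits V" using VD(4) by (auto simp: cls_eq_iff)
    then have "(b - a) + a \<in> nonunits V" using \<open>a \<in> nonunits V\<close> by (rule ncl(3))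
    then show ?thesis by simp
  qed
  have AB: "A \<subseteq> B" by (rule subring_integral_closure(2)[OF subring_A])
  have "maximalideal (cls ` (nonunits V \<inter> B)) (normalization_ring f)"
  proof (rule maximalidealI)
    show "ideal (cls ` (nonunits V \<inter> B)) (normalization_ring f)"
      by (rule presents_ideal[OF presents_normalization ideal_centre[OF V]])
    have "cls 1 \<notin> cls ` (nonunits V \<inter> B)"
      using cls_mem one_notin_nonunits[OF VD(1)] by blast
    then show "carrier (normalization_ring f) \<noteq> cls ` (nonunits V \<inter> B)"
      using P(2) bcl(2) imageI[of 1 B cls] by metis
    fix J assume J: "ideal J (normalization_ring f)" "cls ` (nonunits V \<inter> B) \<subseteq> J"
      "J \<subseteq> carrier (normalization_ring f)"
    interpret J: ideal J "normalization_ring f" by (rule J(1))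
    show "J = cls ` (nonunits V \<inter> B) \<or> J = carrier (normalization_ring f)"
    proof (cases "J = cls ` (nonunits V \<inter> B)")
      case False
      then obtain x where "x \<in> J" "x \<notin> cls ` (nonunits V \<inter> B)" using J(2) by blast
      moreover from this obtain b where b: "b \<in> B" "x = cls b" using J(3) P(2) by auto
      ultimately have bJ: "cls b \<in> J" "b \<notin> nonunits V" by auto
      obtain c where c: "b - const_fract c \<in> nonunits V" using residue_exists[OF V b(1)] by blast
      have cB: "const_fract c \<in> B" for c using AB to_fract_in_A unfolding const_fract_def by blast
      have "c \<noteq> 0" using c bJ(2) unital_homD(1)[OF unital_hom_const_fract] by auto
      have "const_fract c - b \<in> nonunits V \<inter> B" using ncl(6)[OF c] cB b(1) bcl(5) by auto
      then have "cls (const_fract c - b) \<in> J" using J(2) by blast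
      then have "cls (const_fract c - b) \<oplus>\<^bsub>normalization_ring f\<^esub> cls b \<in> J"
        using bJ(1) by (rule additive_subgroup.a_closed[OF ideal.axioms(1)[OF J(1)]])
      then have "cls (const_fract c) \<in> J" using cB b(1) bcl(5) by (simp add: P)
      then have "cls (const_fract (inverse c)) \<otimes>\<^bsub>normalization_ring f\<^esub> cls (const_fract c) \<in> J"
        by (rule J.I_l_closed) (use cB P(2) in auto)
      then have "cls (const_fract (inverse c) * const_fract c) \<in> J" using cB by (simp add: P)
      also have "const_fract (inverse c) * const_fract c = 1"
        using \<open>c \<noteq> 0\<close> unital_homD[OF unital_hom_const_fract] by (metis left_inverse)
      finally have "\<one>\<^bsub>normalization_ring f\<^esub> \<in> J" by (simp add: P)
      then show ?thesis using J.one_imp_carrier by simp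
    qed simp
  qed
  moreover have "cls ` (nonunits V \<inter> B) \<inter> coordinate_ring f = origin_ideal f"
    unfolding coordinate_ring_eq origin_ideal_eq
  proof (intro equalityI subsetI)
    fix x assume x: "x \<in> cls ` (nonunits V \<inter> B) \<inter> cls ` A"
    then obtain a where a: "a \<in> A" "x = cls a" by blast
    with x have a3: "a \<in> nonunits V" using cls_mem[of a] by blast
    from a(1) obtain p i where pi: "a = to_fract p + i" "i \<in> I" unfolding chart_ring_def by auto
    define c where "c = const_term p"
    have "const_term (p - const2 c) = 0" by (simp add: const_term_simps c_def)
    then have "to_fract (p - const2 c) + i \<in> nonunits V"
      using VD(3) pi(2) unfolding chart_max_def by blast
    then have "a - (to_fract (p - const2 c) + i) \<in> nonunits V" using a3 by (rule ncl(7)[rotated])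
    then have "const_fract c \<in> nonunits V" by (simp add: pi(1) const_fract_def)
    then have "const_term p = 0" using VD(8) unfolding c_def by blast
    then have "a \<in> origin_max f" unfolding chart_max_def using pi by blast
    then show "x \<in> cls ` origin_max f" using a(2) by blast
  next
    fix x assume "x \<in> cls ` origin_max f"
    then show "x \<in> cls ` (nonunits V \<inter> B) \<inter> cls ` A"
      using VD(3) ideal_closed(1)[OF subring_A ideal_origin_max] AB by blast
  qed
  ultimately show ?thesis unfolding normalization_fibre_def by simp
qed

lemma same_centre:
  assumes uni: "\<exists>!M. M \<in> normalization_fibre f" and V: "local_valuation V" and W: "local_valuation W"
  shows "nonunits V \<inter> B = nonunits W \<inter> B"
proof -
  have eq: "cls ` (nonunits V \<inter> B) = cls ` (nonunits W \<inter> B)"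
    using uni centre_in_fibre[OF V] centre_in_fibre[OF W] by blast
  have *: "nonunits V \<inter> B \<subseteq> nonunits W" if W: "local_valuation W"
    and eq: "cls ` (nonunits V \<inter> B) = cls ` (nonunits W \<inter> B)" for V W
  proof
    note WD = local_valuationD[OF W]
    note ncl = nonunits_rules[OF WD(1) WD(1)]
    fix b assume "b \<in> nonunits V \<inter> B"
    then have "cls b \<in> cls ` (nonunits W \<inter> B)" using eq by blast
    then obtain a where a: "a \<in> nonunits W" "cls b = cls a" by auto
    then have "b - a \<in> nonunits W" using WD(4) by (auto simp: cls_eq_iff)
    then have "(b - a) + a \<in> nonunits W" using a(1) by (rule ncl(3))
    then show "b \<in> nonunits W" by simp
  qed
  show ?thesis using *[OF W eq] *[OF V eq[symmetric]] by blast
qed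

end


section \<open>A unibranch point carries a single valuation ring\<close>

lemma var_x_smult: "var_x * p = smult [:0, 1:] p"
  by (simp add: var_x_def)

text \<open>
  Dividing by common factors \<open>x\<close> makes a relation nontrivial over the origin.
\<close>
lemma strip_common_x:
  fixes p :: "nat \<Rightarrow> complex poly"
  assumes f: "prime_elem f" "\<not> f dvd var_x"
    and "p j0 \<noteq> 0" "j0 \<le> N" "f dvd (\<Sum>j\<le>N. smult (p j) (w j))"
  shows "\<exists>p'. (\<exists>j\<le>N. poly (p' j) 0 \<noteq> 0) \<and> f dvd (\<Sum>j\<le>N. smult (p' j) (w j))"
  using assms(3-)
proof (induction "degree (p j0)" arbitrary: p rule: less_induct)
  case less
  show ?case
  proof (cases "\<exists>j\<le>N. poly (p j) 0 \<noteq> 0")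
    case False
    then have "\<forall>j. \<exists>q. j \<le> N \<longrightarrow> p j = [:0, 1:] * q"
      using poly_eq_0_iff_dvd[of _ 0] by (auto simp: dvd_def)
    then obtain q where q: "\<And>j. j \<le> N \<Longrightarrow> p j = [:0, 1:] * q j" by metis
    have "(\<Sum>j\<le>N. smult (p j) (w j)) = var_x * (\<Sum>j\<le>N. smult (q j) (w j))"
      unfolding sum_distrib_left by (intro sum.cong) (simp_all add: q var_x_def)
    then have "f dvd (\<Sum>j\<le>N. smult (q j) (w j))"
      using less.prems(3) f by (simp add: prime_elem_dvd_mult_iff)
    moreover have "q j0 \<noteq> 0" using q less.prems by auto
    moreover from this have "degree (q j0) < degree (p j0)"
      unfolding q[OF less.prems(2)] by (subst degree_mult_eq) auto
    ultimately show ?thesis using less.hyps less.prems(2) by blast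
  qed (use less.prems in blast)
qed

text \<open>
  The function field has degree at most \<open>degree f\<close> over \<open>\<complex>(x)\<close>: the \<open>N + 1\<close> forms
  \<open>a^j b^(N - j)\<close> have remainders modulo \<open>f\<close> with only \<open>N\<close> coefficients, hence are dependent.
\<close>
lemma algebraic_relation_mod_f:
  fixes a b :: poly2
  assumes f: "prime_elem f" "\<not> f dvd var_x"
  shows "\<exists>p N. (\<exists>j\<le>N. poly (p j) 0 \<noteq> 0) \<and> f dvd (\<Sum>j\<le>N. smult (p j) (a ^ j * b ^ (N - j)))"
proof -
  define N where "N = degree f"
  define w where "w j = a ^ j * b ^ (N - j)" for j
  have f0: "f \<noteq> 0" using f(1) by auto
  have "\<forall>j. \<exists>e q. e \<noteq> 0 \<and> smult e (w j) = f * q + pseudo_mod (w j) f"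
    using pseudo_mod(1)[OF f0] by blast
  then obtain e q where e: "\<And>j. e j \<noteq> 0" "\<And>j. smult (e j) (w j) = f * q j + pseudo_mod (w j) f"
    by metis
  obtain l where l: "\<exists>j\<in>{..N}. l j \<noteq> 0"
    "\<And>i. i < N \<Longrightarrow> (\<Sum>j\<le>N. l j * coeff (pseudo_mod (w j) f) i) = 0"
    using dependent_rows[of "{..N}" N "\<lambda>j i. coeff (pseudo_mod (w j) f) i"] by auto
  have "(\<Sum>j\<le>N. smult (l j) (pseudo_mod (w j) f)) = 0"
  proof (rule poly_eqI)
    fix i show "coeff (\<Sum>j\<le>N. smult (l j) (pseudo_mod (w j) f)) i = coeff 0 i"
    proof (cases "i < N")
      case False
      then have "coeff (pseudo_mod (w j) f) i = 0" for j
        using pseudo_mod(2)[OF f0, of "w j"] by (auto simp: N_def coeff_eq_0)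
      then show ?thesis by (simp add: coeff_sum)
    qed (simp add: coeff_sum l(2))
  qed
  then have "(\<Sum>j\<le>N. smult (l j * e j) (w j)) = f * (\<Sum>j\<le>N. smult (l j) (q j))"
    by (simp add: e(2) smult_add_right sum.distrib sum_distrib_left flip: smult_smult)
  then have "f dvd (\<Sum>j\<le>N. smult (l j * e j) (w j))" by simp
  moreover obtain j0 where "j0 \<le> N" "l j0 * e j0 \<noteq> 0" using l(1) e(1) by auto
  ultimately show ?thesis
    using strip_common_x[OF f, of "\<lambda>j. l j * e j" j0 N w] unfolding w_def by blast
qed

context affine_curve
begin

text \<open>
  The coefficient at \<open>j\<close> is congruent to a nonzero constant, hence is a unit in every local
  valuation ring.
\<close>
lemma algebraic_relation:
  assumes x: "\<not> f dvd var_x" and h: "h \<in> G"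
  shows "\<exists>P j c. (\<forall>i. coeff P i \<in> A) \<and> poly P h = 0 \<and> c \<noteq> 0 \<and> coeff P j - const_fract c \<in> origin_max f"
proof -
  obtain a b where ab: "h = Fract a b" "\<not> f dvd b" using h by (auto simp: generic_fractions_eq)
  have b0: "b \<noteq> 0" using ab by auto
  obtain p N j where p: "j \<le> N" "poly (p j) 0 \<noteq> 0" "f dvd (\<Sum>j\<le>N. smult (p j) (a ^ j * b ^ (N - j)))"
    using algebraic_relation_mod_f[OF prime x, of a b] by blast
  define S where "S = (\<Sum>j\<le>N. smult (p j) (a ^ j * b ^ (N - j)))"
  define P0 where "P0 = (\<Sum>j\<le>N. monom (to_fract [:p j:]) j)"
  define z where "z = poly P0 h"
  have h': "h * to_fract b = to_fract a"
    using b0 by (simp add: ab to_fract_def eq_fract)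
  have "z * to_fract b ^ N = (\<Sum>j\<le>N. to_fract [:p j:] * h ^ j * to_fract b ^ N)"
    by (simp add: z_def P0_def poly_sum poly_monom sum_distrib_right)
  also have "\<dots> = (\<Sum>j\<le>N. to_fract (smult (p j) (a ^ j * b ^ (N - j))))"
  proof (intro sum.cong refl)
    fix j assume "j \<in> {..N}"
    then have "to_fract b ^ N = to_fract b ^ j * to_fract b ^ (N - j)" by (simp flip: power_add)
    then have "to_fract [:p j:] * h ^ j * to_fract b ^ N
        = to_fract [:p j:] * ((h * to_fract b) ^ j * to_fract b ^ (N - j))"
      by (simp add: power_mult_distrib mult_ac)
    also have "\<dots> = to_fract ([:p j:] * (a ^ j * b ^ (N - j)))"
      unfolding h' by (simp only: unital_homD[OF unital_hom_to_fract])
    finally show "to_fract [:p j:] * h ^ j * to_fract b ^ N = to_fract (smult (p j) (a ^ j * b ^ (N - j)))"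
      by simp
  qed
  also have "\<dots> = to_fract S"
    unfolding S_def unital_hom_sum[OF unital_hom_to_fract] ..
  finally have zb: "z * to_fract b ^ N = to_fract S" .
  have "\<not> f dvd b ^ N" using ab(2) prime prime_elem_dvd_power by blast
  moreover have "z = Fract S (b ^ N)"
    using zb b0 by (metis eq_divide_eq Fract_conv_to_fract to_fract_eq_0_iff power_not_zero unital_homD(7)[OF unital_hom_to_fract])
  ultimately have z: "z \<in> I" using p(3) generic_idealI unfolding S_def by blast
  \<comment> \<open>\<open>z\<close> is the value of \<open>P0\<close> at \<open>h\<close>, an element of the generic ideal\<close>
  define P where "P = P0 - [:z:]"
  have cP: "coeff P i = (if i \<le> N then to_fract [:p i:] else 0) - (if i = 0 then z else 0)" for i
    by (auto simp: P_def P0_def coeff_sum coeff_pCons split: nat.splits)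
  have "\<forall>i. coeff P i \<in> A"
    using z I_sub_A to_fract_in_A subring_closed[OF subring_A] by (auto simp: cP)
  moreover have "poly P h = 0" by (simp add: P_def z_def)
  moreover have "coeff P j - const_fract (poly (p j) 0) \<in> origin_max f"
  proof -
    have "const_term ([:p j:] - const2 (poly (p j) 0)) = 0"
      by (simp add: const_term_simps) (simp add: const_term_def coeff2_def poly_0_coeff_0)
    moreover have "(if j = 0 then - z else 0) \<in> I" using z I_closed by auto
    ultimately have "to_fract ([:p j:] - const2 (poly (p j) 0)) + (if j = 0 then - z else 0) \<in> origin_max f"
      unfolding chart_max_def by blast
    then show ?thesis using p(1) by (simp add: cP const_fract_def algebra_simps split: if_splits)
  qed
  ultimately show ?thesis using p(2) by blast
qed

lemma local_valuation_unique:
  assumes uni: "\<exists>!M. M \<in> normalization_fibre f" and x: "\<not> f dvd var_x"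
    and V: "local_valuation V" and W: "local_valuation W"
  shows "V = W"
proof -
  have sub: "V \<subseteq> W" if V: "local_valuation V" and W: "local_valuation W" for V W
  proof
    note VD = local_valuationD[OF V]
    note ncl = nonunits_rules[OF VD(1) VD(1)]
    fix h assume h: "h \<in> V"
    then obtain P j c where P: "\<And>i. coeff P i \<in> A" "poly P h = 0" "c \<noteq> 0"
      "coeff P j - const_fract c \<in> origin_max f"
      using algebraic_relation[OF x, of h] VD(5) by blast
    have "coeff P j \<notin> nonunits V"
    proof
      assume "coeff P j \<in> nonunits V"
      moreover have "coeff P j - const_fract c \<in> nonunits V" using P(4) VD(3) by blast
      ultimately have "coeff P j - (coeff P j - const_fract c) \<in> nonunits V" by (rule ncl(7))
      then show False using VD(8)[OF P(3)] by simp
    qed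
    then show "h \<in> W"
      using valuation_ring_determined_by_centre[OF subring_A VD(1,2) local_valuationD(1,2)[OF W]
          same_centre[OF uni V W] h P(1) _ P(2)] by blast
  qed
  show ?thesis using sub[OF V W] sub[OF W V] by blast
qed

definition dominating :: "poly2 fract set \<Rightarrow> bool" where
  "dominating W \<longleftrightarrow> local_valuation W \<and> (\<forall>S J. subring_of_field S \<longrightarrow> A \<subseteq> S \<longrightarrow> ideal_in S J \<longrightarrow>
     origin_max f \<subseteq> J \<longrightarrow> 1 \<notin> J \<longrightarrow> S \<subseteq> W \<and> J \<subseteq> nonunits W)"

text \<open>
  Every ring above the local ring of the origin that has a proper ideal containing the origin's
  is dominated by some local valuation ring; by uniqueness it is always the same one.
\<close>
lemma dominating_exists:
  assumes uni: "\<exists>!M. M \<in> normalization_fibre f" and x: "\<not> f dvd var_x"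
  shows "\<exists>W. dominating W"
proof -
  obtain W where W: "valuation_ring W" "A \<subseteq> W" "origin_max f \<subseteq> nonunits W"
    using chevalley_extension[OF subring_A ideal_origin_max one_notin_origin_max] .
  then have lW: "local_valuation W" by (simp add: local_valuation_def)
  have "S \<subseteq> W \<and> J \<subseteq> nonunits W" if S: "subring_of_field S" "A \<subseteq> S" and J: "ideal_in S J"
    "origin_max f \<subseteq> J" "1 \<notin> J" for S J
  proof -
    obtain V where V: "valuation_ring V" "S \<subseteq> V" "J \<subseteq> nonunits V"
      using chevalley_extension[OF S(1) J(1,3)] .
    then have "local_valuation V" using S J by (auto simp: local_valuation_def)
    then have "V = W" using local_valuation_unique[OF uni x] lW by blast
    then show ?thesis using V by blast
  qed
  then show ?thesis using lW unfolding dominating_def by blast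
qed

end


section \<open>Coordinates and blow-ups\<close>

lemma coeff2_simps:
  "coeff2 0 i j = 0" "coeff2 (p + q) i j = coeff2 p i j + coeff2 q i j" "coeff2 (p - q) i j = coeff2 p i j - coeff2 q i j"
  by (simp_all add: coeff2_def)

lemma coeff2_eqI: "(\<And>i j. coeff2 p i j = coeff2 q i j) \<Longrightarrow> p = q"
  by (simp add: coeff2_def poly_eq_iff)

lemma coeff2_var_x_power: "coeff2 (var_x ^ n * p) i j = (if n \<le> i then coeff2 p (i - n) j else 0)"
proof (induction n arbitrary: i)
  case (Suc n)
  have "coeff2 (var_x * q) i j = (if i = 0 then 0 else coeff2 q (i - 1) j)" for q i
    by (simp add: var_x_smult coeff2_def coeff_pCons split: nat.splits)
  then have "coeff2 (var_x ^ Suc n * p) i j = (if i = 0 then 0 else coeff2 (var_x ^ n * p) (i - 1) j)"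
    by (simp add: mult.assoc)
  then show ?case using Suc by auto
qed simp

lemma coeff2_var_y_power: "coeff2 (var_y ^ n * p) i j = (if n \<le> j then coeff2 p i (j - n) else 0)"
proof (induction n arbitrary: j)
  case (Suc n)
  have "coeff2 (var_y * q) i j = (if j = 0 then 0 else coeff2 q i (j - 1))" for q j
    by (simp add: var_y_def coeff2_def coeff_pCons split: nat.splits)
  then have "coeff2 (var_y ^ Suc n * p) i j = (if j = 0 then 0 else coeff2 (var_y ^ n * p) i (j - 1))"
    by (simp add: mult.assoc)
  then show ?case using Suc by auto
qed simp

lemma poly2_decompose:
  obtains q r where "p = const2 (const_term p) + var_x * q + var_y * r"
proof -
  obtain a r where p: "p = pCons a r" by (metis pCons_cases)
  obtain c s where a: "a = pCons c s" by (metis pCons_cases)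
  have "p = const2 c + var_x * [:s:] + var_y * r"
    by (simp add: p a const2_def var_x_def var_y_def)
  moreover have "const_term p = c" by (simp add: p a const_term_def coeff2_def)
  ultimately have "p = const2 (const_term p) + var_x * [:s:] + var_y * r" by simp
  then show ?thesis by (rule that)
qed

text \<open>
  The exchange of the coordinates reduces the blow-up chart \<open>None\<close> to the chart \<open>Some 0\<close>.
\<close>
definition swap_xy :: "poly2 \<Rightarrow> poly2" where
  "swap_xy = eval2 const2 var_y var_x"

lemma unital_hom_eval2: "unital_hom k \<Longrightarrow> unital_hom (eval2 k a b)"
  by (intro unital_hom_extend)

lemma unital_hom_swap: "unital_hom swap_xy"
  unfolding swap_xy_def by (rule unital_hom_eval2[OF unital_hom_const2])

lemma swap_simps [simp]: "swap_xy (const2 c) = const2 c" "swap_xy var_x = var_y" "swap_xy var_y = var_x"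
  by (simp_all add: swap_xy_def unital_hom_const2)

lemma poly2_hom_eqI:
  assumes "unital_hom h" "unital_hom k" "\<And>c. h (const2 c) = k (const2 c)"
    "h var_x = k var_x" "h var_y = k var_y"
  shows "h p = k p"
  using unital_hom_eqI2[OF assms(1,2)] assms(3-) unfolding const2_def var_x_def var_y_def by blast

lemma unital_hom_id: "unital_hom (\<lambda>x. x)"
  by (simp add: unital_hom_def)

lemma swap_swap [simp]: "swap_xy (swap_xy p) = p"
  by (rule poly2_hom_eqI[where h = "\<lambda>p. swap_xy (swap_xy p)" and k = "\<lambda>p. p"])
    (auto intro: unital_hom_comp unital_hom_swap unital_hom_id)

lemma coeff2_swap: "coeff2 (swap_xy p) i j = coeff2 p j i"
proof (induction "i + j" arbitrary: p i j)
  case 0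
  have "const_term (swap_xy p) = const_term p"
    by (rule poly2_hom_eqI[where h = "\<lambda>p. const_term (swap_xy p)"])
      (auto intro: unital_hom_comp unital_hom_swap unital_hom_const_term)
  then show ?case using 0 by (simp add: const_term_def)
next
  case (Suc n)
  obtain q r where p: "p = const2 (const_term p) + var_x * q + var_y * r" using poly2_decompose .
  define c where "c = const_term p"
  have p': "p = const2 c + var_x * q + var_y * r" using p by (simp add: c_def)
  have s: "swap_xy p = const2 c + var_y * swap_xy q + var_x * swap_xy r"
    unfolding p' by (simp add: unital_homD[OF unital_hom_swap])
  have c0: "coeff2 (const2 c) i j = 0" "coeff2 (const2 c) j i = 0"
    using Suc(2) by (auto simp: const2_def coeff2_def coeff_pCons split: nat.splits)
  note x1 = coeff2_var_x_power[of 1, simplified] and y1 = coeff2_var_y_power[of 1, simplified]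
  have IH: "coeff2 (swap_xy q) i (j - 1) = coeff2 q (j - 1) i" if "j > 0" for q
    using Suc(1)[of i "j - 1" q] Suc(2) that by auto
  have IH': "coeff2 (swap_xy q) (i - 1) j = coeff2 q j (i - 1)" if "i > 0" for q
    using Suc(1)[of "i - 1" j q] Suc(2) that by auto
  have "coeff2 (swap_xy p) i j = coeff2 (const2 c + var_x * q + var_y * r) j i"
    unfolding s using Suc(2) IH[of q] IH'[of r] by (auto simp: coeff2_simps c0 x1 y1)
  then show ?case using p' by simp
qed

lemma mult_origin_le: "coeff2 f i j \<noteq> 0 \<Longrightarrow> mult_origin f \<le> i + j"
  unfolding mult_origin_def by (rule Least_le) auto

lemma mult_origin_attained:
  assumes "f \<noteq> 0"
  obtains i j where "i + j = mult_origin f" "coeff2 f i j \<noteq> 0"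
proof -
  obtain i j where "coeff2 f i j \<noteq> 0"
    using assms coeff2_eqI[of f 0] by (auto simp: coeff2_simps)
  then have "\<exists>i' j'. i' + j' = i + j \<and> coeff2 f i' j' \<noteq> 0" by blast
  then have "\<exists>i j. i + j = mult_origin f \<and> coeff2 f i j \<noteq> 0"
    unfolding mult_origin_def by (rule LeastI)
  then show ?thesis using that by blast
qed

lemma mult_origin_swap: "mult_origin (swap_xy f) = mult_origin f"
  unfolding mult_origin_def coeff2_swap by (metis add.commute)

lemma mult_origin_pos: "f \<noteq> 0 \<Longrightarrow> const_term f = 0 \<Longrightarrow> mult_origin f > 0"
proof (rule mult_origin_attained[of f])
  fix i j assume "const_term f = 0" "i + j = mult_origin f" "coeff2 f i j \<noteq> 0"
  then show "mult_origin f > 0" by (cases "i + j = 0") (auto simp: const_term_def)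
qed

lemma subst2_var_x: "subst2 f var_x b = pcompose f b"
proof -
  have "extend_hom const2 var_x p = [:p:]" for p
  proof (rule unital_hom_eqI[OF unital_hom_extend[OF unital_hom_const2]])
    show "unital_hom (\<lambda>p::complex poly. [:p:])" by (simp add: unital_hom_def one_pCons)
    show "extend_hom const2 var_x [:c:] = [:[:c:]:]" for c
      by (simp add: unital_hom_const2, simp add: const2_def)
    show "extend_hom const2 var_x [:0, 1:] = [:[:0, 1:]:]"
      by (simp add: unital_hom_const2, simp add: var_x_def)
  qed
  then have "extend_hom const2 var_x = (\<lambda>p. [:p:])" by auto
  then show ?thesis by (simp add: subst2_eq extend_hom_def[of "\<lambda>p. [:p:]"] pcompose_altdef)
qed

lemma unital_hom_subst2: "unital_hom (\<lambda>p. subst2 p a b)"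
  unfolding subst2_eq by (rule unital_hom_eval2[OF unital_hom_const2])

lemma subst2_simps [simp]: "subst2 (const2 c) a b = const2 c" "subst2 var_x a b = a" "subst2 var_y a b = b"
  by (simp_all add: subst2_eq unital_hom_const2)

lemma var_x_nz [simp]: "var_x \<noteq> 0" and var_y_nz [simp]: "var_y \<noteq> 0"
  by (simp_all add: var_x_def var_y_def)

lemma var_x_power_factor:
  assumes "\<And>i j. i < m \<Longrightarrow> coeff2 p i j = 0"
  shows "\<exists>h. p = var_x ^ m * h"
proof
  have "coeff2 p i j = coeff2 (var_x ^ m * map_poly (poly_shift m) p) i j" for i j
    using assms by (simp add: coeff2_var_x_power) (simp add: coeff2_def coeff_map_poly coeff_poly_shift)
  then show "p = var_x ^ m * map_poly (poly_shift m) p" by (rule coeff2_eqI)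
qed

lemma coeff2_blowup:
  "coeff2 (pcompose g [:0, [:0, 1:]:]) i j = (if j \<le> i then coeff2 g (i - j) j else 0)"
proof -
  have "[:0, 1:] ^ j = monom (1::complex) j" by (simp add: monom_altdef)
  then show ?thesis by (simp add: coeff2_def coeff_pcompose_linear coeff_monom_mult)
qed

text \<open>
  The substitution \<open>y = x (y' + t)\<close> is \<open>y = x y'\<close> followed by a translation of \<open>y'\<close>. The first
  step moves the monomial \<open>x^i y^j\<close> to \<open>x^(i + j) y^j\<close>, so it produces the factor \<open>x\<close> to the
  multiplicity of \<open>g\<close>.
\<close>
lemma proper_transform_Some_aux:
  obtains h where "pcompose g [:0, [:0, 1:]:] = var_x ^ mult_origin g * h"
    "\<And>t. subst2 g var_x (var_x * (var_y + const2 t)) = var_x ^ mult_origin g * pcompose h [:[:t:], 1:]"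
    "\<And>t. proper_transform g (Some t) = pcompose h [:[:t:], 1:]"
proof -
  have "coeff2 (pcompose g [:0, [:0, 1:]:]) i j = 0" if "i < mult_origin g" for i j
  proof (rule ccontr)
    assume "coeff2 (pcompose g [:0, [:0, 1:]:]) i j \<noteq> 0"
    then have "j \<le> i" "coeff2 g (i - j) j \<noteq> 0" by (auto simp: coeff2_blowup split: if_splits)
    then show False using mult_origin_le[of g "i - j" j] that by auto
  qed
  then obtain h where h: "pcompose g [:0, [:0, 1:]:] = var_x ^ mult_origin g * h"
    using var_x_power_factor by blast
  have s: "subst2 g var_x (var_x * (var_y + const2 t)) = var_x ^ mult_origin g * pcompose h [:[:t:], 1:]" for t
  proof -
    have "var_x * (var_y + const2 t) = pcompose [:0, [:0, 1:]:] [:[:t:], 1:]"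
      by (simp add: var_x_def var_y_def const2_def pcompose_pCons)
    then have "subst2 g var_x (var_x * (var_y + const2 t)) = pcompose (pcompose g [:0, [:0, 1:]:]) [:[:t:], 1:]"
      by (simp add: subst2_var_x pcompose_assoc)
    also have "\<dots> = pcompose (var_x ^ mult_origin g) [:[:t:], 1:] * pcompose h [:[:t:], 1:]"
      by (simp add: h pcompose_mult)
    also have "pcompose (var_x ^ n) q = var_x ^ n" for n q
      by (induction n) (simp_all add: pcompose_1 pcompose_mult, simp add: var_x_def)
    finally show ?thesis .
  qed
  show ?thesis
    by (rule that[OF h s]) (simp add: proper_transform_def s)
qed

lemma coeff2_proper_transform_0:
  "coeff2 (proper_transform g (Some 0)) i j =
    (if j \<le> i + mult_origin g then coeff2 g (i + mult_origin g - j) j else 0)"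
proof -
  obtain h where h: "pcompose g [:0, [:0, 1:]:] = var_x ^ mult_origin g * h"
    "\<And>t. proper_transform g (Some t) = pcompose h [:[:t:], 1:]"
    by (rule proper_transform_Some_aux[of g]) blast
  have "proper_transform g (Some 0) = h" by (simp add: h(2))
  then have "coeff2 (proper_transform g (Some 0)) i j =
      coeff2 (var_x ^ mult_origin g * h) (i + mult_origin g) j"
    by (simp add: coeff2_var_x_power)
  then show ?thesis by (simp add: coeff2_blowup flip: h(1))
qed

lemma proper_transform_translate:
  "proper_transform g (Some t) = pcompose (proper_transform g (Some 0)) [:[:t:], 1:]"
proof -
  obtain h where h: "\<And>t. proper_transform g (Some t) = pcompose h [:[:t:], 1:]"
    by (rule proper_transform_Some_aux[of g]) blast
  have "proper_transform g (Some 0) = h" by (simp add: h)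
  then show ?thesis using h by simp
qed

lemma proper_transform_Some:
  "subst2 g var_x (var_x * (var_y + const2 t)) = var_x ^ mult_origin g * proper_transform g (Some t)"
proof -
  obtain h where h: "\<And>t. subst2 g var_x (var_x * (var_y + const2 t)) = var_x ^ mult_origin g * pcompose h [:[:t:], 1:]"
    "\<And>t. proper_transform g (Some t) = pcompose h [:[:t:], 1:]"
    by (rule proper_transform_Some_aux[of g]) blast
  show ?thesis unfolding h(2) by (rule h(1))
qed

lemma proper_transform_None: "proper_transform g None = swap_xy (proper_transform (swap_xy g) (Some 0))"
proof -
  have "subst2 g (var_x * var_y) var_y = swap_xy (subst2 (swap_xy g) var_x (var_x * var_y))"
  proof (rule poly2_hom_eqI[where h = "\<lambda>p. subst2 p (var_x * var_y) var_y"
        and k = "\<lambda>p. swap_xy (subst2 (swap_xy p) var_x (var_x * var_y))"])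
    show "unital_hom (\<lambda>p. swap_xy (subst2 (swap_xy p) var_x (var_x * var_y)))"
      by (rule unital_hom_comp[OF unital_hom_swap unital_hom_comp[OF unital_hom_subst2 unital_hom_swap]])
  qed (simp_all add: unital_hom_subst2 unital_homD[OF unital_hom_swap] mult.commute)
  also have "subst2 (swap_xy g) var_x (var_x * var_y) = var_x ^ mult_origin g * proper_transform (swap_xy g) (Some 0)"
    using proper_transform_Some[of "swap_xy g" 0] by (simp add: mult_origin_swap unital_homD[OF unital_hom_const2])
  finally show ?thesis
    by (simp add: proper_transform_def[of g] unital_homD[OF unital_hom_swap])
qed

definition restrict_x0 :: "poly2 \<Rightarrow> complex poly" where
  "restrict_x0 = extend_hom (\<lambda>p. [:coeff p 0:]) [:0, 1:]"

lemma unital_hom_coeff_0: "unital_hom (\<lambda>p::complex poly. [:coeff p 0:])"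
  by (simp add: unital_hom_def coeff_mult one_pCons)

lemma unital_hom_restrict_x0: "unital_hom restrict_x0"
  unfolding restrict_x0_def by (rule unital_hom_extend[OF unital_hom_coeff_0])

lemma coeff_restrict_x0: "coeff (restrict_x0 p) j = coeff2 p 0 j"
proof (induction p arbitrary: j)
  case (pCons a p)
  have "restrict_x0 (pCons a p) = pCons (coeff a 0) (restrict_x0 p)"
    unfolding restrict_x0_def by (simp add: extend_hom_pCons[OF unital_hom_coeff_0])
  then show ?case using pCons by (auto simp: coeff2_def coeff_pCons split: nat.splits)
qed (simp add: restrict_x0_def coeff2_def)

lemma restrict_x0_translate: "restrict_x0 (pcompose p [:[:t:], 1:]) = pcompose (restrict_x0 p) [:t, 1:]"
proof (rule unital_hom_eqI2[where h = "\<lambda>p. restrict_x0 (pcompose p [:[:t:], 1:])" and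
      k = "\<lambda>p. pcompose (restrict_x0 p) [:t, 1:]"])
  have pc: "unital_hom (\<lambda>p. pcompose p q)" for q :: "'a::comm_ring_1 poly"
    by (simp add: unital_hom_def pcompose_1 pcompose_add pcompose_mult)
  show "unital_hom (\<lambda>p. restrict_x0 (pcompose p [:[:t:], 1:]))"
    "unital_hom (\<lambda>p. pcompose (restrict_x0 p) [:t, 1:])"
    by (rule unital_hom_comp[OF unital_hom_restrict_x0 pc] unital_hom_comp[OF pc unital_hom_restrict_x0])+
qed (simp_all add: restrict_x0_def extend_hom_pCons[OF unital_hom_coeff_0] pcompose_pCons)

lemma var_x_dvd_iff: "var_x dvd p \<longleftrightarrow> restrict_x0 p = 0"
proof
  assume "var_x dvd p"
  then obtain q where "p = var_x ^ 1 * q" by auto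
  then show "restrict_x0 p = 0" by (intro poly_eqI) (simp only: coeff_restrict_x0 coeff2_var_x_power, simp)
next
  assume "restrict_x0 p = 0"
  then have "coeff2 p 0 j = 0" for j using coeff_restrict_x0[of p j] by simp
  then have "\<exists>h. p = var_x ^ 1 * h" by (intro var_x_power_factor) auto
  then show "var_x dvd p" by auto
qed

lemma prime_elem_var_x: "prime_elem var_x"
proof (rule prime_elemI)
  show "\<not> var_x dvd 1" by (simp add: var_x_dvd_iff unital_homD[OF unital_hom_restrict_x0])
qed (auto simp: var_x_dvd_iff unital_homD[OF unital_hom_restrict_x0])

text \<open>
  The polynomial \<open>g_m(1, T)\<close>, where \<open>g_m\<close> is the initial form of \<open>g\<close>. Its roots are the slopes
  of the tangent lines other than \<open>x = 0\<close>, and it has degree less than \<open>m\<close> exactly if \<open>x = 0\<close> is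
  tangent too.
\<close>
definition tangent_poly :: "poly2 \<Rightarrow> complex poly" where
  "tangent_poly g = restrict_x0 (proper_transform g (Some 0))"

lemma coeff_tangent_poly:
  "coeff (tangent_poly g) j = (if j \<le> mult_origin g then coeff2 g (mult_origin g - j) j else 0)"
  by (simp add: tangent_poly_def coeff_restrict_x0 coeff2_proper_transform_0)

lemma tangent_poly_nz: "g \<noteq> 0 \<Longrightarrow> tangent_poly g \<noteq> 0"
proof (rule mult_origin_attained[of g])
  fix i j assume "i + j = mult_origin g" "coeff2 g i j \<noteq> 0"
  then have "coeff (tangent_poly g) j \<noteq> 0" by (auto simp: coeff_tangent_poly simp flip: \<open>i + j = _\<close>)
  then show "tangent_poly g \<noteq> 0" by auto
qed

lemma degree_tangent_poly: "degree (tangent_poly g) \<le> mult_origin g"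
  by (rule degree_le) (simp add: coeff_tangent_poly)

lemma restrict_proper_transform: "restrict_x0 (proper_transform g (Some t)) = pcompose (tangent_poly g) [:t, 1:]"
  by (subst proper_transform_translate) (simp add: restrict_x0_translate tangent_poly_def)

lemma const_term_Some: "const_term (proper_transform g (Some t)) = poly (tangent_poly g) t"
proof -
  have "const_term (proper_transform g (Some t)) = coeff (pcompose (tangent_poly g) [:t, 1:]) 0"
    by (simp add: const_term_def coeff_restrict_x0 flip: restrict_proper_transform)
  then show ?thesis by (simp add: pcompose_coeff_0)
qed

lemma coeff2_proper_transform_None:
  "coeff2 (proper_transform g None) i j =
    (if i \<le> j + mult_origin g then coeff2 g i (j + mult_origin g - i) else 0)"
  by (simp add: proper_transform_None coeff2_swap coeff2_proper_transform_0 mult_origin_swap)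

lemma const_term_None: "const_term (proper_transform g None) = coeff2 g 0 (mult_origin g)"
  by (simp add: const_term_def coeff2_proper_transform_None)

lemma translate_nz: "p \<noteq> 0 \<Longrightarrow> pcompose p [:t, 1:] \<noteq> (0 :: complex poly)"
  by (simp add: pcompose_eq_0_iff)

lemma not_var_x_dvd_proper_transform: "g \<noteq> 0 \<Longrightarrow> \<not> var_x dvd proper_transform g (Some t)"
  unfolding var_x_dvd_iff restrict_proper_transform by (intro translate_nz tangent_poly_nz)

lemma dvd_cancel_var_x_power:
  assumes "\<not> var_x dvd g" "g dvd var_x ^ n * p"
  shows "g dvd p"
  using assms(2)
proof (induction n)
  case (Suc n)
  then obtain r where r: "var_x * (var_x ^ n * p) = g * r" by (auto simp: mult.assoc)
  then have "var_x dvd g * r" by (metis dvd_triv_left)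
  then have "var_x dvd r" using assms(1) prime_elem_var_x by (simp add: prime_elem_dvd_mult_iff)
  then obtain s where "r = var_x * s" by auto
  then have "var_x * (var_x ^ n * p) = var_x * (g * s)" using r by (simp add: mult.left_commute)
  then have "var_x ^ n * p = g * s" by simp
  then show ?case using Suc.IH by simp
qed simp

text \<open>
  On the level of the original coordinates: every polynomial in \<open>x\<close> and \<open>y / x\<close> becomes a
  polynomial in \<open>x\<close> and \<open>y\<close> after multiplication by a power of \<open>x\<close>.
\<close>
lemma blowup_clear_denominators:
  "\<exists>N Q. subst2 Q var_x (var_x * (var_y + const2 t)) = var_x ^ N * P"
proof (induction P)
  case 0
  show ?case by (intro exI[of _ 0]) (simp add: subst2_def)
next
  case (pCons p P)
  obtain N Q where Q: "subst2 Q var_x (var_x * (var_y + const2 t)) = var_x ^ N * P" using pCons by auto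
  have c: "subst2 [:p:] var_x (var_x * (var_y + const2 t)) = [:p:]" by (simp add: subst2_var_x)
  define c where "c = [:p:]"
  have c': "subst2 c var_x (var_x * (var_y + const2 t)) = c" using c by (simp add: c_def)
  \<comment> \<open>\<open>y - t x\<close> becomes \<open>x y'\<close>, which compensates for the power of \<open>x\<close>\<close>
  define Q' where "Q' = var_x ^ Suc N * c + (var_y - const2 t * var_x) * Q"
  have "subst2 Q' var_x (var_x * (var_y + const2 t)) = var_x ^ Suc N * c + var_x * var_y * (var_x ^ N * P)"
    unfolding Q'_def unital_homD[OF unital_hom_subst2] Q c' subst2_simps by (simp add: algebra_simps)
  also have "\<dots> = var_x ^ Suc N * (c + var_y * P)" by (simp add: algebra_simps)
  also have "c + var_y * P = pCons p P" by (simp add: var_y_def c_def)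
  finally show ?case by blast
qed

lemma swap_dvd_iff: "swap_xy g dvd p \<longleftrightarrow> g dvd swap_xy p"
  by (metis dvd_def swap_swap unital_homD(4)[OF unital_hom_swap])


section \<open>Infinitely near points of a unibranch germ\<close>

locale unibranch_germ = affine_curve +
  fixes W :: "poly2 fract set"
  assumes W: "dominating W"
begin

lemma lW: "local_valuation W"
  using W by (simp add: dominating_def)

lemmas WD = local_valuationD[OF lW]
lemmas W_closed = subring_closed[OF valuation_ringD(1)[OF WD(1)]]
lemmas nonunits_closed = nonunits_rules[OF WD(1) WD(1)]

abbreviation ev :: "poly2 fract \<Rightarrow> poly2 fract \<Rightarrow> poly2 \<Rightarrow> poly2 fract" where
  "ev \<equiv> eval2 const_fract"

lemma ev_hom: "unital_hom (ev X Y)"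
  by (rule unital_hom_eval2[OF unital_hom_const_fract])

lemmas ev_simps = unital_homD[OF ev_hom] eval2_simps[OF unital_hom_const_fract]

lemma ev_in_subring:
  assumes S: "subring_of_field S" "\<And>c. const_fract c \<in> S" and XY: "X \<in> S" "Y \<in> S"
  shows "ev X Y P \<in> S"
proof -
  have "extend_hom const_fract X p \<in> S" for p
    unfolding extend_hom_def
    by (rule subring_poly[OF S(1) _ XY(1)])
      (simp add: coeff_map_poly unital_homD(1)[OF unital_hom_const_fract] S(2))
  then show ?thesis unfolding extend_hom_def[of "extend_hom const_fract X"]
    by (intro subring_poly[OF S(1) _ XY(2)])
      (simp add: coeff_map_poly unital_homD(1)[OF unital_hom_extend[OF unital_hom_const_fract]])
qed

lemma const_fract_in_G: "const_fract c \<in> G"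
  unfolding const_fract_def by (rule to_fract_in_generic_fractions[OF prime])

lemma ev_in_G: "X \<in> G \<Longrightarrow> Y \<in> G \<Longrightarrow> ev X Y P \<in> G"
  by (rule ev_in_subring[OF subring_generic[OF prime] const_fract_in_G])

lemma ev_minus_const:
  assumes "X \<in> nonunits W" "Y \<in> nonunits W"
  shows "ev X Y P - const_fract (const_term P) \<in> nonunits W"
proof -
  obtain q r where P: "P = const2 (const_term P) + var_x * q + var_y * r" using poly2_decompose .
  have "ev X Y P = const_fract (const_term P) + X * ev X Y q + Y * ev X Y r"
    by (subst P) (simp add: ev_simps)
  moreover have "ev X Y p \<in> W" for p
    using assms WD(7) nonunits_closed(1) by (intro ev_in_subring valuation_ringD(1)[OF WD(1)]) auto
  then have "X * ev X Y q + Y * ev X Y r \<in> nonunits W"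
    using assms nonunits_closed(3,5) by blast
  ultimately show ?thesis by simp
qed

text \<open>
  Local coordinates \<open>X, Y\<close> at a point infinitely near to the origin, viewed as rational
  functions on the original plane. The point is the centre of \<open>W\<close>; the polynomial \<open>g\<close> generates
  the relations between \<open>X\<close> and \<open>Y\<close> on the curve, so it is the equation of the transform; and
  functions on the original plane are polynomials in \<open>X, Y\<close> with the same value at the point.
\<close>
definition chart :: "poly2 fract \<Rightarrow> poly2 fract \<Rightarrow> poly2 \<Rightarrow> bool" where
  "chart X Y g \<longleftrightarrow> X \<in> nonunits W \<and> Y \<in> nonunits W \<and> (\<forall>P. ev X Y P \<in> I \<longleftrightarrow> g dvd P) \<and>
     (\<forall>P. \<exists>Q. to_fract P = ev X Y Q \<and> const_term Q = const_term P)"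

lemma chartD:
  assumes "chart X Y g"
  shows "X \<in> nonunits W" "Y \<in> nonunits W" "ev X Y P \<in> I \<longleftrightarrow> g dvd P" "X \<in> G" "Y \<in> G"
  using assms nonunits_closed(1) WD(5) unfolding chart_def by blast+

lemma chart_base: "chart (to_fract var_x) (to_fract var_y) f"
proof -
  have ev: "ev (to_fract var_x) (to_fract var_y) P = to_fract P" for P
    by (rule poly2_hom_eqI[OF ev_hom unital_hom_to_fract]) (simp_all add: ev_simps const_fract_def)
  have "to_fract v \<in> nonunits W" if "const_term v = 0" for v
  proof -
    have "to_fract v + 0 \<in> origin_max f" unfolding chart_max_def using that I_closed(2) by blast
    then show ?thesis using WD(3) by auto
  qed
  then show ?thesis
    unfolding chart_def ev using to_fract_in_generic_ideal_iff[OF prime] by auto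
qed

lemma chart_const_term:
  assumes "chart X Y g"
  shows "const_term g = 0"
proof (rule ccontr)
  assume c: "const_term g \<noteq> 0"
  note C = chartD[OF assms]
  have "ev X Y g \<in> nonunits W" using C(3)[of g] WD(4) by auto
  then have "ev X Y g - (ev X Y g - const_fract (const_term g)) \<in> nonunits W"
    by (rule nonunits_closed(7)[OF _ ev_minus_const[OF C(1,2)]])
  then show False using WD(8)[OF c] by simp
qed

lemma chart_prime:
  assumes "chart X Y g"
  shows "prime_elem g"
proof (rule prime_elemI)
  note C = chartD[OF assms]
  show "g \<noteq> 0"
  proof
    assume "g = 0"
    obtain Q where "to_fract f = ev X Y Q" using assms unfolding chart_def by blast
    moreover have "to_fract f \<in> I" using to_fract_in_generic_ideal_iff[OF prime] by simp
    ultimately have "Q = 0" using C(3)[of Q] \<open>g = 0\<close> by simp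
    then show False using \<open>to_fract f = ev X Y Q\<close> prime by (simp add: ev_simps)
  qed
  show "\<not> g dvd 1" using C(3)[of 1] one_notin_I by (simp add: ev_simps)
  fix a b assume "g dvd a * b"
  then have "ev X Y a * ev X Y b \<in> I" using C(3)[of "a * b"] by (simp add: ev_simps)
  then have "ev X Y a \<in> I \<or> ev X Y b \<in> I"
    by (intro generic_ideal_prime[OF prime] ev_in_G C)
  then show "g dvd a \<or> g dvd b" using C(3) by blast
qed

lemma ev_swap: "ev X Y (swap_xy P) = ev Y X P"
  by (rule poly2_hom_eqI[OF unital_hom_comp[OF ev_hom unital_hom_swap] ev_hom]) (simp_all add: ev_simps)

lemma const_term_swap [simp]: "const_term (swap_xy P) = const_term P"
  by (simp add: const_term_def coeff2_swap)

lemma chart_swap: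
  assumes "chart X Y g"
  shows "chart Y X (swap_xy g)"
proof -
  have "\<exists>Q. to_fract P = ev Y X Q \<and> const_term Q = const_term P" for P
  proof -
    obtain Q where "to_fract P = ev X Y Q \<and> const_term Q = const_term P"
      using assms unfolding chart_def by blast
    then show ?thesis using ev_swap[of Y X Q] by (intro exI[of _ "swap_xy Q"]) auto
  qed
  moreover have "ev Y X P \<in> I \<longleftrightarrow> swap_xy g dvd P" for P
    using chartD(3)[OF assms, of "swap_xy P"] by (simp add: ev_swap swap_dvd_iff)
  ultimately show ?thesis
    using assms unfolding chart_def by blast
qed

text \<open>
  It suffices that \<open>X, Y\<close> have the right relations: as \<open>g\<close> vanishes at the origin, \<open>X\<close> and \<open>Y\<close>
  generate a proper ideal, and the valuation ring that dominates it can only be \<open>W\<close>.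
\<close>
lemma chartI:
  assumes G: "X \<in> G" "Y \<in> G" and ker: "\<And>P. ev X Y P \<in> I \<longleftrightarrow> g dvd P" and g: "const_term g = 0"
    and sur: "\<And>P. \<exists>Q. to_fract P = ev X Y Q \<and> const_term Q = const_term P"
  shows "chart X Y g"
proof -
  let ?S = "chart_ring f (ev X Y)" and ?J = "chart_max f (ev X Y)"
  have "A \<subseteq> ?S"
  proof
    fix a assume "a \<in> A"
    then obtain p i where "a = to_fract p + i" "i \<in> I" unfolding chart_ring_def by blast
    moreover obtain Q where "to_fract p = ev X Y Q" using sur by blast
    ultimately have "a = ev X Y Q + i" by simp
    then show "a \<in> ?S" using \<open>i \<in> I\<close> unfolding chart_ring_def by blast
  qed
  moreover have "origin_max f \<subseteq> ?J"
  proof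
    fix a assume "a \<in> origin_max f"
    then obtain p i where "a = to_fract p + i" "i \<in> I" "const_term p = 0" unfolding chart_max_def by blast
    then show "a \<in> ?J" using sur[of p] unfolding chart_max_def by fastforce
  qed
  ultimately have J: "?J \<subseteq> nonunits W"
    using W subring_chart(1)[OF ev_hom ev_in_G[OF G]] ideal_chart_max[OF ev_hom ev_in_G[OF G]]
      one_notin_chart_max[OF ev_hom ker[THEN iffD1] g]
    unfolding dominating_def by blast
  have "ev X Y v + 0 \<in> ?J" if "const_term v = 0" for v
    unfolding chart_max_def using that I_closed(2) by blast
  then have "ev X Y var_x \<in> nonunits W" "ev X Y var_y \<in> nonunits W" using J by auto
  then show ?thesis
    unfolding chart_def using ker sur by (simp add: ev_simps)
qed

text \<open>
  The relations between the new coordinates \<open>X\<close> and \<open>Y / X - t\<close> are obtained from those between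
  \<open>X\<close> and \<open>Y\<close> by clearing denominators. No power of \<open>X\<close> is lost because the exceptional curve is
  not a component of the proper transform.
\<close>
lemma chart_Some:
  assumes ch: "chart X Y g" and t: "const_term (proper_transform g (Some t)) = 0"
  shows "chart X (Y / X - const_fract t) (proper_transform g (Some t))" "X \<noteq> 0"
proof -
  note C = chartD[OF ch]
  have g0: "g \<noteq> 0" using chart_prime[OF ch] by auto
  \<comment> \<open>otherwise \<open>g\<close> is the equation \<open>x = 0\<close>, which has the direction \<open>None\<close> only\<close>
  have XI: "X \<notin> I"
  proof
    assume "X \<in> I"
    then have "g dvd var_x" using C(3)[of var_x] by (simp add: ev_simps)
    then obtain r where "var_x = g * r" by auto
    moreover from this have "g \<noteq> 0" "r \<noteq> 0" by auto
    ultimately have "degree var_x = degree g + degree r" by (metis degree_mult_eq)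
    then have "degree g = 0" by (simp add: var_x_def)
    then have "coeff2 g i j = 0" if "j > 0" for i j using that by (simp add: coeff2_def coeff_eq_0)
    then have "\<forall>i>0. coeff (tangent_poly g) i = 0" by (simp add: coeff_tangent_poly)
    then have "degree (tangent_poly g) \<le> 0" by (rule degree_le)
    then have "degree (tangent_poly g) = 0" by simp
    then obtain c where "tangent_poly g = [:c:]" using degree_eq_zeroE by blast
    then show False using t tangent_poly_nz[OF g0] by (simp add: const_term_Some)
  qed
  then show X0: "X \<noteq> 0" using I_closed(2) by auto
  let ?Y = "Y / X - const_fract t" and ?\<sigma> = "\<lambda>P. subst2 P var_x (var_x * (var_y + const2 t))"
  have YG: "?Y \<in> G"
    using inverse_in_generic_fractions[OF prime C(4) XI] C(5) const_fract_in_G G_closed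
    by (simp add: divide_inverse)
  have ev_sub: "ev X ?Y (?\<sigma> P) = ev X Y P" for P
    by (rule poly2_hom_eqI[OF unital_hom_comp[OF ev_hom unital_hom_subst2] ev_hom])
      (use X0 in \<open>simp_all add: ev_simps\<close>)
  have Xn: "z \<in> I" if "X ^ n * z \<in> I" "z \<in> G" for n z
    using that(1)
  proof (induction n)
    case (Suc n)
    have "X ^ n * z \<in> G" by (rule G_closed(6)[OF G_closed(7)[OF C(4)] that(2)])
    moreover have "X * (X ^ n * z) \<in> I" using Suc.prems by (simp add: mult.assoc)
    ultimately have "X ^ n * z \<in> I" using generic_ideal_prime[OF prime C(4)] XI by blast
    then show ?case by (rule Suc.IH)
  qed simp
  have ker: "ev X ?Y P \<in> I \<longleftrightarrow> proper_transform g (Some t) dvd P" for P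
  proof
    assume P: "ev X ?Y P \<in> I"
    obtain N Q where Q: "?\<sigma> Q = var_x ^ N * P" using blowup_clear_denominators by blast
    have "ev X Y Q = X ^ N * ev X ?Y P" unfolding ev_sub[symmetric] Q by (simp add: ev_simps)
    then have "ev X Y Q \<in> I" using P G_closed(7)[OF C(4)] I_closed(4) by simp
    then have "g dvd Q" using C(3) by blast
    then obtain r where "Q = g * r" by auto
    then have "?\<sigma> Q = ?\<sigma> g * ?\<sigma> r"
      by (simp add: unital_homD[OF unital_hom_subst2])
    also have "?\<sigma> g = var_x ^ mult_origin g * proper_transform g (Some t)"
      by (rule proper_transform_Some)
    finally have "proper_transform g (Some t) dvd var_x ^ N * P"
      unfolding Q by simp
    then show "proper_transform g (Some t) dvd P"
      by (rule dvd_cancel_var_x_power[OF not_var_x_dvd_proper_transform[OF g0]])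
  next
    assume "proper_transform g (Some t) dvd P"
    then obtain r where r: "P = proper_transform g (Some t) * r" by auto
    have "ev X ?Y (?\<sigma> g) \<in> I" unfolding ev_sub using C(3)[of g] by simp
    then have "X ^ mult_origin g * ev X ?Y (proper_transform g (Some t)) \<in> I"
      unfolding proper_transform_Some by (simp add: ev_simps)
    then have "ev X ?Y (proper_transform g (Some t)) \<in> I" using Xn ev_in_G[OF C(4) YG] by blast
    then show "ev X ?Y P \<in> I" unfolding r ev_simps using ev_in_G[OF C(4) YG] I_closed(5) by blast
  qed
  show "chart X ?Y (proper_transform g (Some t))"
  proof (rule chartI[OF C(4) YG ker t])
    fix P
    obtain Q where Q: "to_fract P = ev X Y Q" "const_term Q = const_term P"
      using ch unfolding chart_def by blast
    have "const_term (?\<sigma> Q) = const_term Q"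
      by (rule poly2_hom_eqI[OF unital_hom_comp[OF unital_hom_const_term unital_hom_subst2] unital_hom_const_term])
        (simp_all add: const_term_simps)
    then show "\<exists>Q. to_fract P = ev X ?Y Q \<and> const_term Q = const_term P"
      using Q ev_sub by metis
  qed
qed

lemma chart_None:
  assumes ch: "chart X Y g" and t: "const_term (proper_transform g None) = 0"
  shows "chart (X / Y) Y (proper_transform g None)" "Y \<noteq> 0"
proof -
  have t': "const_term (proper_transform (swap_xy g) (Some 0)) = 0"
    using t by (simp add: proper_transform_None)
  show "Y \<noteq> 0" by (rule chart_Some(2)[OF chart_swap[OF ch] t'])
  show "chart (X / Y) Y (proper_transform g None)"
    using chart_swap[OF chart_Some(1)[OF chart_swap[OF ch] t']]
    by (simp add: proper_transform_None unital_homD[OF unital_hom_const_fract])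
qed

lemma chart_next:
  assumes "chart X Y g" "const_term (proper_transform g s) = 0"
  shows "\<exists>X' Y'. chart X' Y' (proper_transform g s)"
  using assms chart_Some chart_None by (cases s) blast+

text \<open>
  There is a direction because \<open>\<complex>\<close> is algebraically closed. Two directions would give \<open>Y / X\<close>
  two different residues in \<open>W\<close>.
\<close>
lemma chart_unique_direction:
  assumes ch: "chart X Y g"
  shows "\<exists>!s. const_term (proper_transform g s) = 0"
proof (rule ex_ex1I)
  note C = chartD[OF ch]
  have g0: "g \<noteq> 0" using chart_prime[OF ch] by auto
  show "\<exists>s. const_term (proper_transform g s) = 0"
  proof (cases "coeff2 g 0 (mult_origin g) = 0")
    case True
    then show ?thesis by (intro exI[of _ None]) (simp add: const_term_None)
  next
    case False
    then have "coeff (tangent_poly g) (mult_origin g) \<noteq> 0" by (simp add: coeff_tangent_poly)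
    then have "degree (tangent_poly g) \<ge> mult_origin g" by (rule le_degree)
    then have "degree (tangent_poly g) > 0"
      using mult_origin_pos[OF g0 chart_const_term[OF ch]] by linarith
    then have "\<not> constant (poly (tangent_poly g))" by (simp add: constant_degree)
    then obtain t where "poly (tangent_poly g) t = 0" using fundamental_theorem_of_algebra by blast
    then show ?thesis by (intro exI[of _ "Some t"]) (simp add: const_term_Some)
  qed
  have Some_None: False if s: "const_term (proper_transform g (Some t)) = 0"
    and n: "const_term (proper_transform g None) = 0" for t
  proof -
    note S = chart_Some[OF ch s] and N = chart_None[OF ch n]
    have "Y / X - const_fract t \<in> W" "X / Y \<in> nonunits W"
      using chartD(1,2)[OF S(1)] chartD(1)[OF N(1)] nonunits_closed(1) by auto
    then have "(Y / X - const_fract t) + const_fract t \<in> W" using W_closed(4) WD(7) by blast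
    then have "Y / X \<in> W" by simp
    then have "Y / X * (X / Y) \<in> nonunits W"
      using \<open>X / Y \<in> nonunits W\<close> by (rule nonunits_closed(4))
    then show False using S(2) N(2) one_notin_nonunits[OF WD(1)] by simp
  qed
  fix s s' assume s: "const_term (proper_transform g s) = 0" "const_term (proper_transform g s') = 0"
  show "s = s'"
  proof (cases s; cases s')
    fix t t' assume tt: "s = Some t" "s' = Some t'"
    have "Y / X - const_fract t \<in> nonunits W" "Y / X - const_fract t' \<in> nonunits W"
      using chartD(2)[OF chart_Some(1)[OF ch]] s tt by auto
    then have "(Y / X - const_fract t') - (Y / X - const_fract t) \<in> nonunits W"
      by (rule nonunits_closed(7)[rotated])
    moreover have "(Y / X - const_fract t') - (Y / X - const_fract t) = const_fract (t - t')"
      by (simp add: unital_homD[OF unital_hom_const_fract])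
    ultimately have "const_fract (t - t') \<in> nonunits W" by metis
    then have "t - t' = 0" using WD(8) by blast
    then show ?thesis using tt by simp
  qed (use s Some_None in auto)
qed

end


section \<open>Finiteness of the set of multiple points\<close>

text \<open>
  Take a nonzero \<open>r\<close> of least degree in \<open>y\<close> in the ideal generated by \<open>h\<close> and its derivative.
  Pseudo-division gives \<open>a h = r q\<close> with \<open>a \<in> \<complex>[x]\<close>. As \<open>h\<close> is prime and has larger degree than
  \<open>r\<close>, it divides \<open>q\<close>, so \<open>r\<close> divides \<open>a\<close>.
\<close>
lemma prime_pderiv_bezout:
  fixes h :: poly2
  assumes h: "prime_elem h" "degree h > 0"
  shows "\<exists>A B D. D \<noteq> 0 \<and> A * h + B * pderiv h = [:D:]"
proof -
  define J where "J = {A * h + B * pderiv h | A B. True}"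
  have JI: "A * h + B * pderiv h \<in> J" for A B by (auto simp: J_def)
  have d: "pderiv h \<noteq> 0" "degree (pderiv h) < degree h"
    using h(2) by (auto simp: pderiv_eq_0_iff degree_pderiv)
  have "pderiv h \<in> J" using JI[of 0 1] by simp
  then have "\<exists>r. r \<in> J \<and> r \<noteq> 0" using d by blast
  then obtain r where r: "r \<in> J" "r \<noteq> 0" and min: "\<And>s. s \<in> J \<Longrightarrow> s \<noteq> 0 \<Longrightarrow> degree r \<le> degree s"
    using ex_has_least_nat[of "\<lambda>r. r \<in> J \<and> r \<noteq> 0" _ degree] by blast
  obtain A B where AB: "r = A * h + B * pderiv h" using r(1) by (auto simp: J_def)
  obtain a q where aq: "a \<noteq> 0" "smult a h = r * q + pseudo_mod h r" using pseudo_mod(1)[OF r(2)] by blast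
  have "pseudo_mod h r = smult a h - r * q" using aq(2) by simp
  also have "\<dots> = ([:a:] - q * A) * h + (- q * B) * pderiv h" by (simp add: AB algebra_simps)
  finally have "pseudo_mod h r \<in> J" by (simp only: JI)
  then have "pseudo_mod h r = 0" using min pseudo_mod(2)[OF r(2), of h] by fastforce
  then have eq: "[:a:] * h = r * q" using aq(2) by simp
  have "degree r = 0"
  proof -
    have "h dvd r * q" unfolding eq[symmetric] by (rule dvd_triv_right)
    then have "h dvd r \<or> h dvd q" using h(1) by (simp add: prime_elem_dvd_mult_iff)
    then show ?thesis
    proof
      assume "h dvd r"
      then have "degree h \<le> degree r" using r(2) by (rule dvd_imp_degree_le)
      also have "\<dots> \<le> degree (pderiv h)" using min[OF \<open>pderiv h \<in> J\<close> d(1)] .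
      finally show ?thesis using d(2) by simp
    next
      assume "h dvd q"
      then obtain s where "q = h * s" by auto
      then have "[:a:] * h = (r * s) * h" using eq by (simp only: mult_ac)
      then have "[:a:] = r * s" using h(1) by (metis mult_cancel_right prime_elem_not_zeroI prime_elem_def)
      moreover from this have "s \<noteq> 0" using aq(1) by auto
      ultimately have "degree [:a:] = degree r + degree s" using r(2) by (simp add: degree_mult_eq)
      then show ?thesis by simp
    qed
  qed
  then obtain D where "r = [:D:]" using degree_eq_zeroE by blast
  then show ?thesis using r(2) AB by auto
qed

text \<open>
  The hypothesis says that modulo ever higher powers of \<open>x\<close> the polynomial \<open>h\<close> has an \<open>m\<close>-fold
  root in \<open>\<complex>[x]\<close>. Its derivative then has the same root with multiplicity \<open>m - 1 \<ge> 1\<close>, and every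
  power of \<open>x\<close> divides the polynomial \<open>D\<close> of the preceding lemma.
\<close>
lemma no_infinite_tangency:
  fixes h :: poly2
  assumes h: "prime_elem h" "degree h > 0" and m: "m \<ge> 2"
    and tang: "\<And>k. \<exists>\<sigma> h'. pcompose h [:\<sigma>, [:0, 1:] ^ k:] = smult ([:0, 1:] ^ (m * k)) h'"
  shows False
proof -
  obtain A B D where D: "D \<noteq> 0" "A * h + B * pderiv h = [:D:]"
    using prime_pderiv_bezout[OF h] by blast
  define k where "k = Suc (degree D)"
  define x where "x = [:0, 1::complex:]"
  have x0: "x ^ j \<noteq> 0" for j by (simp add: x_def)
  obtain \<sigma> h' where h': "pcompose h [:\<sigma>, x ^ k:] = smult (x ^ (m * k)) h'"
    using tang[of k] unfolding x_def by blast
  define q where "q = [:\<sigma>, x ^ k:]"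
  have "smult (x ^ k) (pcompose (pderiv h) q) = pderiv (pcompose h q)"
    by (simp add: pderiv_pcompose q_def pderiv_pCons mult.commute)
  also have "\<dots> = smult (x ^ k) (smult (x ^ ((m - 1) * k)) (pderiv h'))"
  proof -
    have "m * k = k + (m - 1) * k" using m by (cases m) auto
    then show ?thesis by (simp add: q_def h' pderiv_smult flip: power_add)
  qed
  finally have "smult (x ^ k) (pcompose (pderiv h) q - smult (x ^ ((m - 1) * k)) (pderiv h')) = 0"
    by (simp add: smult_diff_right)
  then have d: "pcompose (pderiv h) q = smult (x ^ ((m - 1) * k)) (pderiv h')"
    using x0[of k] by (metis smult_eq_0_iff eq_iff_diff_eq_0)
  obtain e e' where e: "m * k = k + e" "(m - 1) * k = k + e'"
    using m by (metis le_add1 le_Suc_ex mult_le_mono1 nat_mult_1 le_diff_conv2 one_le_numeral order_trans Suc_1 plus_1_eq_Suc)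
  have "[:D:] = pcompose (A * h + B * pderiv h) q" by (simp add: D(2))
  also have "\<dots> = pcompose A q * smult (x ^ (k + e)) h' + pcompose B q * smult (x ^ (k + e')) (pderiv h')"
    using d[unfolded e(2)] h'[unfolded e(1)] by (simp add: pcompose_add pcompose_mult q_def)
  also have "\<dots> = smult (x ^ k) (pcompose A q * smult (x ^ e) h' + pcompose B q * smult (x ^ e') (pderiv h'))"
    by (simp add: power_add smult_add_right)
  finally have "coeff [:D:] 0 = x ^ k * coeff (pcompose A q * smult (x ^ e) h' + pcompose B q * smult (x ^ e') (pderiv h')) 0"
    by (metis coeff_smult)
  then have "x ^ k dvd D" by simp
  then have "degree (x ^ k) \<le> degree D" using D(1) by (rule dvd_imp_degree_le)
  then show False by (simp add: k_def x_def degree_power_eq)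
qed

lemma only_root_0_imp_monom:
  fixes p :: "complex poly"
  assumes "p \<noteq> 0" "\<And>z. poly p z = 0 \<Longrightarrow> z = 0"
  shows "p = monom (lead_coeff p) (degree p)"
  using assms
proof (induction "degree p" arbitrary: p)
  case 0
  then obtain c where "p = [:c:]" using degree_eq_zeroE by metis
  then show ?case by (simp add: monom_0)
next
  case (Suc n)
  then have "\<not> constant (poly p)" by (simp add: constant_degree)
  then have "poly p 0 = 0" using fundamental_theorem_of_algebra Suc.prems by blast
  then obtain q where q: "p = [:0, 1:] * q" using poly_eq_0_iff_dvd[of p 0] by auto
  have q0: "q \<noteq> 0" using q Suc.prems by auto
  have dq: "degree p = Suc (degree q)" unfolding q using q0 by (subst degree_mult_eq) auto
  have "q = monom (lead_coeff q) (degree q)"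
  proof (rule Suc.hyps(1)[OF _ q0])
    show "n = degree q" using Suc.hyps(2) dq by simp
    show "z = 0" if "poly q z = 0" for z
      by (rule Suc.prems(2)) (simp add: q that)
  qed
  then have "p = pCons 0 (monom (lead_coeff q) (degree q))" using q by simp
  then have "p = monom (lead_coeff q) (Suc (degree q))" by (simp add: monom_Suc)
  moreover have "lead_coeff p = lead_coeff q" unfolding q by (subst lead_coeff_mult) simp
  ultimately show ?case using dq by simp
qed

definition delta_term :: "poly2 \<Rightarrow> complex option list \<Rightarrow> real" where
  "delta_term g p = real (infinitely_near_mult g p) * (real (infinitely_near_mult g p) - 1) / 2"

definition multiple_points :: "poly2 \<Rightarrow> complex option list set" where
  "multiple_points g = {p \<in> infinitely_near_points g. infinitely_near_mult g p \<noteq> 1}"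

lemma delta_origin_eq: "delta_origin g = infsum (delta_term g) (infinitely_near_points g)"
  by (simp add: delta_origin_def delta_term_def[abs_def])

lemma delta_term_nonneg: "delta_term g p \<ge> 0"
  unfolding delta_term_def by (cases "infinitely_near_mult g p") auto

lemma delta_origin_nonneg: "delta_origin g \<ge> 0"
  unfolding delta_origin_eq by (rule infsum_nonneg) (rule delta_term_nonneg)

lemma delta_origin_eq_0: "multiple_points g = {} \<Longrightarrow> delta_origin g = 0"
  unfolding delta_origin_eq by (rule infsum_0) (auto simp: multiple_points_def delta_term_def)

lemma summable_delta: "finite (multiple_points g) \<Longrightarrow> delta_term g summable_on infinitely_near_points g"
  by (rule finite_nonzero_values_imp_summable_on)
    (rule finite_subset[of _ "multiple_points g"], auto simp: multiple_points_def delta_term_def)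

lemma infinitely_near_mult_simps:
  "infinitely_near_mult g [] = mult_origin g"
  "infinitely_near_mult g (s # p) = infinitely_near_mult (proper_transform g s) p"
  by (simp_all add: infinitely_near_mult_def)

lemma on_transforms_const_term: "on_transforms g p \<Longrightarrow> const_term g = 0"
  by (cases p) (auto simp: const_term_def)

lemma infinitely_near_points_step:
  assumes "const_term g = 0" "const_term (proper_transform g s) = 0"
    "\<And>s'. const_term (proper_transform g s') = 0 \<Longrightarrow> s' = s"
  shows "infinitely_near_points g = insert [] ((#) s ` infinitely_near_points (proper_transform g s))"
proof -
  have "p \<in> infinitely_near_points g \<longleftrightarrow> p \<in> insert [] ((#) s ` infinitely_near_points (proper_transform g s))" for p
  proof (cases p)
    case Nil
    then show ?thesis using assms(1) by (simp add: infinitely_near_points_def const_term_def)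
  next
    case (Cons s' p')
    have "p \<in> infinitely_near_points g \<longleftrightarrow> on_transforms (proper_transform g s') p'"
      using assms(1) by (simp add: infinitely_near_points_def const_term_def Cons)
    also have "\<dots> \<longleftrightarrow> s' = s \<and> on_transforms (proper_transform g s) p'"
      using assms(3)[OF on_transforms_const_term, of s' p'] by blast
    finally show ?thesis by (auto simp: infinitely_near_points_def Cons)
  qed
  then show ?thesis by (simp only: set_eq_iff) simp
qed

context
  fixes g s
  assumes step: "infinitely_near_points g = insert [] ((#) s ` infinitely_near_points (proper_transform g s))"
begin

lemma multiple_points_step: "multiple_points g \<subseteq> insert [] ((#) s ` multiple_points (proper_transform g s))"
  by (auto simp: multiple_points_def step infinitely_near_mult_simps)

lemma delta_origin_step:
  assumes "finite (multiple_points (proper_transform g s))"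
  shows "delta_origin g = real (mult_origin g) * (real (mult_origin g) - 1) / 2 + delta_origin (proper_transform g s)"
proof -
  let ?g' = "proper_transform g s"
  have eq: "delta_term g \<circ> (#) s = delta_term ?g'"
    by (auto simp: delta_term_def infinitely_near_mult_simps)
  have sum: "delta_term g summable_on (#) s ` infinitely_near_points ?g'"
    by (subst summable_on_reindex) (simp_all add: eq summable_delta assms)
  have "delta_origin g = delta_term g [] + infsum (delta_term g) ((#) s ` infinitely_near_points ?g')"
    unfolding delta_origin_eq step by (rule infsum_insert[OF sum]) auto
  also have "infsum (delta_term g) ((#) s ` infinitely_near_points ?g') = delta_origin ?g'"
    unfolding delta_origin_eq by (subst infsum_reindex) (simp_all add: eq)
  finally show ?thesis by (simp add: delta_term_def infinitely_near_mult_simps)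
qed

end

text \<open>
  The proper transform meets the exceptional curve with multiplicity at most \<open>mult_origin g\<close> at
  any of its points.
\<close>
lemma mult_proper_transform_le:
  assumes "g \<noteq> 0"
  shows "mult_origin (proper_transform g s) \<le> mult_origin g"
proof (cases s)
  case None
  obtain i j where "i + j = mult_origin g" "coeff2 g i j \<noteq> 0" using mult_origin_attained[OF assms] .
  then have "coeff2 (proper_transform g s) i 0 \<noteq> 0"
    by (auto simp: None coeff2_proper_transform_None simp flip: \<open>i + j = _\<close>)
  then show ?thesis using mult_origin_le[of _ i 0] \<open>i + j = _\<close> by fastforce
next
  case (Some t)
  define p where "p = restrict_x0 (proper_transform g s)"
  have "p \<noteq> 0" "degree p \<le> mult_origin g"
    unfolding p_def Some restrict_proper_transform using translate_nz[OF tangent_poly_nz[OF assms]]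
      degree_tangent_poly[of g] by (simp_all add: degree_pcompose)
  then have "coeff2 (proper_transform g s) 0 (degree p) \<noteq> 0"
    by (metis coeff_restrict_x0 leading_coeff_0_iff p_def)
  then show ?thesis using mult_origin_le[of _ 0 "degree p"] \<open>degree p \<le> _\<close> by fastforce
qed

lemma blowup_iterate:
  assumes "pcompose h [:\<sigma>, [:0, 1:] ^ k:] = smult ([:0, 1:] ^ (m * k)) h'" "mult_origin h' = m"
  shows "\<exists>\<sigma>. pcompose h [:\<sigma>, [:0, 1:] ^ Suc k:] = smult ([:0, 1:] ^ (m * Suc k)) (proper_transform h' (Some t))"
proof
  let ?q = "[:\<sigma>, [:0, 1:] ^ k:]" and ?r = "[:[:0, t:], [:0, 1:]:]"
  have r: "?r = var_x * (var_y + const2 t)" by (simp add: var_x_def var_y_def const2_def)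
  have "pcompose h [:\<sigma> + [:0, 1:] ^ k * [:0, t:], [:0, 1:] ^ Suc k:] = pcompose (pcompose h ?q) ?r"
    unfolding pcompose_assoc[symmetric] by (simp add: pcompose_pCons mult.commute)
  also have "\<dots> = smult ([:0, 1:] ^ (m * k)) (pcompose h' ?r)" by (simp add: assms(1) pcompose_smult)
  also have "pcompose h' ?r = var_x ^ m * proper_transform h' (Some t)"
    using proper_transform_Some[of h' t] by (simp only: subst2_var_x r assms(2))
  also have "\<dots> = smult ([:0, 1:] ^ m) (proper_transform h' (Some t))"
    by (simp add: var_x_def poly_const_pow)
  finally show "pcompose h [:\<sigma> + [:0, 1:] ^ k * [:0, t:], [:0, 1:] ^ Suc k:] =
      smult ([:0, 1:] ^ (m * Suc k)) (proper_transform h' (Some t))"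
    by (simp add: power_add mult.commute)
qed

context unibranch_germ
begin

lemma chart_nz: "chart X Y g \<Longrightarrow> g \<noteq> 0"
  by (metis chart_prime not_prime_elem_zero)

lemma chart_mult_pos: "chart X Y g \<Longrightarrow> mult_origin g > 0"
  using chart_nz chart_const_term mult_origin_pos by blast

text \<open>
  Hence the infinitely near points on a unibranch germ form a chain.
\<close>
lemma chart_points_step:
  assumes "chart X Y g" "const_term (proper_transform g s) = 0"
  shows "infinitely_near_points g = insert [] ((#) s ` infinitely_near_points (proper_transform g s))"
  using assms chart_unique_direction[OF assms(1)]
  by (intro infinitely_near_points_step chart_const_term[OF assms(1)]) auto

lemma smooth_imp_no_multiple_points:
  assumes "chart X Y g" "mult_origin g = 1"
  shows "multiple_points g = {}"
proof -
  have "infinitely_near_mult g p = 1" if "on_transforms g p" for p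
    using that assms
  proof (induction p arbitrary: X Y g)
    case Nil
    then show ?case by (simp add: infinitely_near_mult_simps)
  next
    case (Cons s p)
    have on: "on_transforms (proper_transform g s) p" using Cons.prems(1) by simp
    obtain X' Y' where ch: "chart X' Y' (proper_transform g s)"
      using chart_next[OF Cons.prems(2) on_transforms_const_term[OF on]] by blast
    have "mult_origin (proper_transform g s) = 1"
      using mult_proper_transform_le[OF chart_nz[OF Cons.prems(2)], of s] chart_mult_pos[OF ch] Cons.prems(3)
      by simp
    then show ?case using Cons.IH[OF on ch] by (simp add: infinitely_near_mult_simps)
  qed
  then show ?thesis by (auto simp: multiple_points_def infinitely_near_points_def)
qed

text \<open>
  The exceptional curve is \<open>x = 0\<close> in the new coordinates, and the transform meets it where
  \<open>tangent_poly g\<close> vanishes. As there is one direction only, this polynomial has a single root,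
  whose multiplicity is its full degree \<open>mult_origin g\<close>.
\<close>
lemma proper_transform_Some_order:
  assumes ch: "chart X Y g" and t: "const_term (proper_transform g (Some t)) = 0"
  shows "coeff2 (proper_transform g (Some t)) 0 (mult_origin g) \<noteq> 0"
    "j < mult_origin g \<Longrightarrow> coeff2 (proper_transform g (Some t)) 0 j = 0"
proof -
  define p where "p = restrict_x0 (proper_transform g (Some t))"
  have p: "p = pcompose (tangent_poly g) [:t, 1:]" by (simp add: p_def restrict_proper_transform)
  have "const_term (proper_transform g None) \<noteq> 0" using t chart_unique_direction[OF ch] by blast
  then have "coeff (tangent_poly g) (mult_origin g) \<noteq> 0" by (simp add: const_term_None coeff_tangent_poly)
  then have "degree (tangent_poly g) = mult_origin g"
    using le_degree degree_tangent_poly le_antisym by blast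
  then have deg: "degree p = mult_origin g" by (simp add: p degree_pcompose)
  have p0: "p \<noteq> 0" unfolding p by (intro translate_nz tangent_poly_nz chart_nz[OF ch])
  have "z = 0" if "poly p z = 0" for z
  proof -
    have "const_term (proper_transform g (Some (t + z))) = 0"
      using that by (simp add: const_term_Some p poly_pcompose add.commute)
    then have "Some (t + z) = Some t" using t chart_unique_direction[OF ch] by blast
    then show ?thesis by simp
  qed
  then have mon: "p = monom (lead_coeff p) (mult_origin g)" using only_root_0_imp_monom[OF p0] deg by simp
  have c: "coeff2 (proper_transform g (Some t)) 0 j = coeff p j" for j by (simp add: p_def coeff_restrict_x0)
  show "coeff2 (proper_transform g (Some t)) 0 (mult_origin g) \<noteq> 0"
    unfolding c using p0 deg by (metis leading_coeff_0_iff)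
  show "coeff2 (proper_transform g (Some t)) 0 j = 0" if "j < mult_origin g"
    unfolding c using that by (subst mon) simp
qed

lemma proper_transform_None_order:
  assumes ch: "chart X Y g" and n: "const_term (proper_transform g None) = 0"
  shows "coeff2 (proper_transform g None) (mult_origin g) 0 \<noteq> 0"
    "i < mult_origin g \<Longrightarrow> coeff2 (proper_transform g None) i 0 = 0"
proof -
  let ?p = "tangent_poly g"
  have "poly ?p t \<noteq> 0" for t
    using n chart_unique_direction[OF ch] const_term_Some[of g t] by (metis option.distinct(1))
  then have "constant (poly ?p)" using fundamental_theorem_of_algebra by blast
  then have "degree ?p = 0" by (simp add: constant_degree)
  then obtain c where c: "?p = [:c:]" using degree_eq_zeroE by blast
  then have "c \<noteq> 0" using tangent_poly_nz[OF chart_nz[OF ch]] by auto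
  have eq: "coeff2 (proper_transform g None) i 0 = coeff ?p (mult_origin g - i)" if "i \<le> mult_origin g" for i
    using that by (simp add: coeff2_proper_transform_None coeff_tangent_poly)
  show "coeff2 (proper_transform g None) (mult_origin g) 0 \<noteq> 0" using eq[of "mult_origin g"] c \<open>c \<noteq> 0\<close> by simp
  show "coeff2 (proper_transform g None) i 0 = 0" if "i < mult_origin g"
    using eq[of i] that by (simp add: c coeff_pCons split: nat.splits)
qed

lemma degree_pos_if_coeff: "coeff2 h 0 m \<noteq> 0 \<Longrightarrow> m > 0 \<Longrightarrow> degree h > 0"
  by (metis coeff2_def coeff_0 degree_0 gr0I le_degree not_less_zero order_less_le_trans le_zero_eq)

text \<open>
  Multiplicities do not increase, so an infinite set of multiple points yields, by induction, an
  infinite chain with constant multiplicity \<open>m \<ge> 2\<close>. Then the exceptional curve is transversal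
  to the transform from the second point on. If some direction in the chain is \<open>Some t\<close>, all
  later ones are of this form, since \<open>None\<close> is then the direction of the exceptional curve;
  composing the blow-ups gives the substitutions \<open>y = \<sigma>(x) + x^k y'\<close> excluded by
  \<open>no_infinite_tangency\<close>. If all directions are \<open>None\<close>, the same holds with the coordinates
  exchanged.
\<close>
theorem finite_multiple_points:
  assumes "chart X Y g"
  shows "finite (multiple_points g)"
  using assms
proof (induction "mult_origin g" arbitrary: X Y g rule: less_induct)
  case less
  show ?case
  proof (rule ccontr)
    define m where "m = mult_origin g"
    define bad where "bad h \<longleftrightarrow> (\<exists>X Y. chart X Y h) \<and> infinite (multiple_points h) \<and> mult_origin h = m" for h
    assume "infinite (multiple_points g)"
    then have bad_g: "bad g" using less.prems by (auto simp: bad_def m_def)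
    have next_bad: "bad (proper_transform h s)" if hb: "bad h" and hs: "const_term (proper_transform h s) = 0" for h s
    proof -
      obtain X Y where ch: "chart X Y h" using hb by (auto simp: bad_def)
      obtain X' Y' where ch': "chart X' Y' (proper_transform h s)" using chart_next[OF ch hs] by blast
      have inf: "infinite (multiple_points (proper_transform h s))"
        using hb multiple_points_step[OF chart_points_step[OF ch hs]]
        by (metis bad_def finite.insertI finite_imageI finite_subset)
      moreover have "mult_origin (proper_transform h s) \<le> m"
        using mult_proper_transform_le[OF chart_nz[OF ch], of s] hb by (auto simp: bad_def)
      then have "mult_origin (proper_transform h s) = m"
        using less.hyps[OF _ ch'] inf unfolding m_def by (metis le_neq_implies_less)
      ultimately show ?thesis using ch' by (auto simp: bad_def)
    qed
    have "m \<noteq> 1" using bad_g smooth_imp_no_multiple_points by (auto simp: bad_def)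
    then have m2: "m \<ge> 2" using chart_mult_pos[OF less.prems] unfolding m_def by linarith
    show False
    proof (cases "\<exists>h t. bad h \<and> const_term (proper_transform h (Some t)) = 0")
      case True
      then obtain h0 t0 where h0: "bad h0" "const_term (proper_transform h0 (Some t0)) = 0" by blast
      define h where "h = proper_transform h0 (Some t0)"
      have h: "bad h" "coeff2 h 0 m \<noteq> 0"
        using next_bad[OF h0] proper_transform_Some_order(1)[OF _ h0(2)] h0(1) by (auto simp: h_def bad_def)
      have "\<exists>\<sigma> h'. pcompose h [:\<sigma>, [:0, 1:] ^ k:] = smult ([:0, 1:] ^ (m * k)) h' \<and> bad h' \<and> coeff2 h' 0 m \<noteq> 0" for k
      proof (induction k)
        case 0
        show ?case using h by (intro exI[of _ 0] exI[of _ h]) simp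
      next
        case (Suc k)
        then obtain \<sigma> h' where h': "pcompose h [:\<sigma>, [:0, 1:] ^ k:] = smult ([:0, 1:] ^ (m * k)) h'"
          "bad h'" "coeff2 h' 0 m \<noteq> 0" by blast
        obtain X' Y' where ch': "chart X' Y' h'" "mult_origin h' = m" using h'(2) by (auto simp: bad_def)
        obtain s where s: "const_term (proper_transform h' s) = 0" using chart_unique_direction[OF ch'(1)] by blast
        have "\<exists>t. s = Some t" using s h'(3) ch'(2) by (cases s) (auto simp: const_term_None)
        then obtain t where t: "s = Some t" by blast
        have "bad (proper_transform h' s)" by (rule next_bad[OF h'(2) s])
        moreover have "coeff2 (proper_transform h' s) 0 m \<noteq> 0"
          using proper_transform_Some_order(1)[OF ch'(1)] s ch'(2) unfolding t by blast
        ultimately show ?case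
          using blowup_iterate[OF h'(1) ch'(2), of t] unfolding t by blast
      qed
      then have "\<And>k. \<exists>\<sigma> h'. pcompose h [:\<sigma>, [:0, 1:] ^ k:] = smult ([:0, 1:] ^ (m * k)) h'" by blast
      moreover have "prime_elem h" using h(1) chart_prime by (auto simp: bad_def)
      moreover have "degree h > 0" using degree_pos_if_coeff[OF h(2)] m2 by simp
      ultimately show False using no_infinite_tangency m2 by blast
    next
      case False
      then have none: "const_term (proper_transform h None) = 0" if "bad h" for h
        using that chart_unique_direction unfolding bad_def by (metis option.exhaust)
      define h where "h = proper_transform g None"
      have h: "bad h" "coeff2 (swap_xy h) 0 m \<noteq> 0"
        using next_bad[OF bad_g none[OF bad_g]] proper_transform_None_order(1)[OF less.prems none[OF bad_g]]
        by (auto simp: h_def m_def coeff2_swap)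
      have "\<exists>\<sigma> h'. pcompose (swap_xy h) [:\<sigma>, [:0, 1:] ^ k:] = smult ([:0, 1:] ^ (m * k)) (swap_xy h') \<and> bad h'" for k
      proof (induction k)
        case 0
        show ?case using h by (intro exI[of _ 0] exI[of _ h]) simp
      next
        case (Suc k)
        then obtain \<sigma> h' where h': "pcompose (swap_xy h) [:\<sigma>, [:0, 1:] ^ k:] = smult ([:0, 1:] ^ (m * k)) (swap_xy h')"
          "bad h'" by blast
        have "mult_origin (swap_xy h') = m" using h'(2) by (simp add: bad_def mult_origin_swap)
        moreover have "proper_transform (swap_xy h') (Some 0) = swap_xy (proper_transform h' None)"
          by (simp add: proper_transform_None)
        ultimately show ?case
          using blowup_iterate[OF h'(1), of 0] next_bad[OF h'(2) none[OF h'(2)]] by metis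
      qed
      then have "\<And>k. \<exists>\<sigma> h'. pcompose (swap_xy h) [:\<sigma>, [:0, 1:] ^ k:] = smult ([:0, 1:] ^ (m * k)) h'" by blast
      moreover have "prime_elem (swap_xy h)" using h(1) chart_prime chart_swap unfolding bad_def by blast
      moreover have "degree (swap_xy h) > 0" using degree_pos_if_coeff[OF h(2)] m2 by simp
      ultimately show False using no_infinite_tangency m2 by blast
    qed
  qed
qed


section \<open>The bound by Euclid's algorithm\<close>

text \<open>
  One step of Euclid's algorithm per blow-up. If the multiplicity \<open>m\<close> were less than both \<open>a\<close>
  and \<open>b\<close>, both axes would be tangent; so it is the smaller one of \<open>a\<close> and \<open>b\<close>.
\<close>
theorem delta_lower_bound:
  assumes "chart X Y g"
    and "coeff2 g 0 a \<noteq> 0" "\<And>j. j < a \<Longrightarrow> coeff2 g 0 j = 0"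
    and "coeff2 g b 0 \<noteq> 0" "\<And>i. i < b \<Longrightarrow> coeff2 g i 0 = 0"
  shows "2 * delta_origin g \<ge> real a * real b - real a - real b + real (gcd a b) \<and>
    (gcd a b = 1 \<longrightarrow> 2 * delta_origin g = real a * real b - real a - real b + real (gcd a b))"
  using assms
proof (induction "a + b" arbitrary: a b X Y g rule: less_induct)
  case less
  note ch = less.prems(1)
  define m where "m = mult_origin g"
  have m0: "m > 0" unfolding m_def by (rule chart_mult_pos[OF ch])
  have m_le: "m \<le> a" "m \<le> b"
    using mult_origin_le[OF less.prems(2)] mult_origin_le[OF less.prems(4)] by (simp_all add: m_def)
  have None_on: "const_term (proper_transform g None) = 0" if "m < a"
    using less.prems(3)[OF that] by (simp add: const_term_None m_def)
  have Some_on: "const_term (proper_transform g (Some 0)) = 0" if "m < b"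
    using less.prems(5)[OF that] by (simp add: const_term_Some poly_0_coeff_0 coeff_tangent_poly m_def)
  \<comment> \<open>an axis that the germ meets with multiplicity larger than \<open>m\<close> is tangent to it\<close>
  have min: "\<not> (m < a \<and> m < b)"
    using None_on Some_on chart_unique_direction[OF ch] by blast
  have step: "delta_origin g = real m * (real m - 1) / 2 + delta_origin (proper_transform g s)"
    if s: "const_term (proper_transform g s) = 0" for s
  proof -
    obtain X' Y' where "chart X' Y' (proper_transform g s)" using chart_next[OF ch s] by blast
    then show ?thesis
      unfolding m_def by (intro delta_origin_step[OF chart_points_step[OF ch s]] finite_multiple_points)
  qed
  consider "a = b" | "a < b" | "b < a" by linarith
  then show ?case
  proof cases
    case 1
    then have ma: "a = m" "b = m" using m_le min by auto
    obtain s where s: "const_term (proper_transform g s) = 0" using chart_unique_direction[OF ch] by blast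
    have "delta_origin g \<ge> real m * (real m - 1) / 2"
      using step[OF s] delta_origin_nonneg[of "proper_transform g s"] by simp
    moreover have "delta_origin g = 0" if "m = 1"
      using that smooth_imp_no_multiple_points[OF ch] delta_origin_eq_0 unfolding m_def by blast
    ultimately show ?thesis unfolding ma by (auto simp: algebra_simps)
  next
    case 2
    then have ma: "a = m" "m < b" using m_le min by auto
    let ?g = "proper_transform g (Some 0)"
    have s: "const_term ?g = 0" using Some_on ma by blast
    have c: "coeff2 ?g i 0 = coeff2 g (i + a) 0" for i
      by (simp add: coeff2_proper_transform_0 ma(1) m_def)
    obtain X' Y' where ch': "chart X' Y' ?g" using chart_next[OF ch s] by blast
    have IH: "2 * delta_origin ?g \<ge> real a * real (b - a) - real a - real (b - a) + real (gcd a (b - a)) \<and>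
      (gcd a (b - a) = 1 \<longrightarrow> 2 * delta_origin ?g = real a * real (b - a) - real a - real (b - a) + real (gcd a (b - a)))"
      by (rule less.hyps[OF _ ch'])
        (use 2 ma m0 less.prems(4,5) proper_transform_Some_order[OF ch s] in \<open>auto simp: c m_def\<close>)
    moreover have "gcd a (b - a) = gcd a b" using 2 by (metis gcd.commute gcd_diff1_nat less_imp_le)
    moreover have "real (b - a) = real b - real a" using 2 by simp
    ultimately show ?thesis using step[OF s] ma(1) by (simp add: algebra_simps)
  next
    case 3
    then have mb: "b = m" "m < a" using m_le min by auto
    let ?g = "proper_transform g None"
    have s: "const_term ?g = 0" using None_on mb by blast
    have c: "coeff2 ?g 0 j = coeff2 g 0 (j + b)" for j
      by (simp add: coeff2_proper_transform_None mb(1) m_def)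
    obtain X' Y' where ch': "chart X' Y' ?g" using chart_next[OF ch s] by blast
    have IH: "2 * delta_origin ?g \<ge> real (a - b) * real b - real (a - b) - real b + real (gcd (a - b) b) \<and>
      (gcd (a - b) b = 1 \<longrightarrow> 2 * delta_origin ?g = real (a - b) * real b - real (a - b) - real b + real (gcd (a - b) b))"
      by (rule less.hyps[OF _ ch'])
        (use 3 mb m0 less.prems(2,3) proper_transform_None_order[OF ch s] in \<open>auto simp: c m_def\<close>)
    moreover have "gcd (a - b) b = gcd a b" using 3 by (simp add: gcd_diff1_nat)
    moreover have "real (a - b) = real a - real b" using 3 by simp
    ultimately show ?thesis using step[OF s] mb(1) by (simp add: algebra_simps)
  qed
qed

text \<open>
  After the first blow-up, in the direction \<open>s\<close> of the tangent line, one axis is the exceptional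
  curve and the other one the transform of the tangent line, which has multiplicity \<open>k = n - m\<close>
  with the transform of the curve.
\<close>
lemma delta_after_tangent_blowup:
  assumes ch: "chart X Y g" and s: "const_term (proper_transform g s) = 0"
    and m: "m = mult_origin g" and k: "k > 0"
    and ax: "s = None \<Longrightarrow> coeff2 (proper_transform g s) 0 k \<noteq> 0 \<and> (\<forall>j<k. coeff2 (proper_transform g s) 0 j = 0)"
      "s \<noteq> None \<Longrightarrow> coeff2 (proper_transform g s) k 0 \<noteq> 0 \<and> (\<forall>i<k. coeff2 (proper_transform g s) i 0 = 0)"
  defines "n \<equiv> m + k"
  shows "2 * delta_origin g \<ge> real n * real m - real n - real m + real (gcd n m) \<and>
    (gcd n m = 1 \<longrightarrow> 2 * delta_origin g = real n * real m - real n - real m + real (gcd n m))"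
proof -
  let ?g = "proper_transform g s"
  obtain X' Y' where ch': "chart X' Y' ?g" using chart_next[OF ch s] by blast
  have step: "delta_origin g = real m * (real m - 1) / 2 + delta_origin ?g"
    unfolding m using ch' by (intro delta_origin_step[OF chart_points_step[OF ch s]] finite_multiple_points)
  have "2 * delta_origin ?g \<ge> real m * real k - real m - real k + real (gcd m k) \<and>
    (gcd m k = 1 \<longrightarrow> 2 * delta_origin ?g = real m * real k - real m - real k + real (gcd m k))"
  proof (cases s)
    case None
    then show ?thesis
      using delta_lower_bound[OF ch', of k m] ax(1) proper_transform_None_order[OF ch] s
      by (simp add: m gcd.commute mult.commute)
  next
    case (Some t)
    then show ?thesis
      using delta_lower_bound[OF ch', of m k] ax(2) proper_transform_Some_order[OF ch] s
      by (simp add: m)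
  qed
  moreover have "gcd n m = gcd m k" unfolding n_def by (simp add: gcd.commute)
  ultimately show ?thesis using step by (simp add: n_def algebra_simps)
qed

end


section \<open>The local equation of an integral curve\<close>

lemma poly2_induct:
  fixes Q :: "poly2 \<Rightarrow> bool"
  assumes c: "\<And>c. Q (const2 c)" and x: "Q var_x" and y: "Q var_y"
    and add: "\<And>p q. Q p \<Longrightarrow> Q q \<Longrightarrow> Q (p + q)" and mult: "\<And>p q. Q p \<Longrightarrow> Q q \<Longrightarrow> Q (p * q)"
  shows "Q p"
proof (induction p)
  case 0
  show ?case using c[of 0] by (simp add: const2_def)
next
  case (pCons a p)
  have "Q [:a:]"
  proof (induction a)
    case 0
    show ?case using c[of 0] by (simp add: const2_def)
  next
    case (pCons b a)
    have "[:pCons b a:] = const2 b + var_x * [:a:]" by (simp add: const2_def var_x_def)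
    then show ?case using c x add mult pCons by metis
  qed
  moreover have "pCons a p = [:a:] + var_y * p" by (simp add: var_y_def)
  ultimately show ?case using y add mult pCons by metis
qed

lemma extend_hom_monom:
  "unital_hom h \<Longrightarrow> extend_hom h a (monom c i) = h c * a ^ i"
  by (simp add: extend_hom_def map_poly_monom unital_homD poly_monom)

lemma extend_hom_altdef:
  assumes "unital_hom h"
  shows "extend_hom h a p = (\<Sum>i\<le>degree p. h (coeff p i) * a ^ i)"
proof -
  have "extend_hom h a p = extend_hom h a (\<Sum>i\<le>degree p. monom (coeff p i) i)"
    by (simp add: poly_as_sum_of_monoms)
  then show ?thesis
    by (simp add: unital_hom_sum[OF unital_hom_extend[OF assms]] extend_hom_monom[OF assms])
qed

abbreviation eval3 :: "(complex \<Rightarrow> 'b::comm_ring_1) \<Rightarrow> 'b \<Rightarrow> 'b \<Rightarrow> 'b \<Rightarrow> poly3 \<Rightarrow> 'b" where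
  "eval3 k a b c \<equiv> extend_hom (eval2 k a b) c"

definition const3 :: "complex \<Rightarrow> poly3" where "const3 c = [:[:[:c:]:]:]"
definition var3_x :: poly3 where "var3_x = [:[:[:0, 1:]:]:]"
definition var3_y :: poly3 where "var3_y = [:[:0, 1:]:]"
definition var3_z :: poly3 where "var3_z = [:0, 1:]"

lemma unital_hom_eval3: "unital_hom k \<Longrightarrow> unital_hom (eval3 k a b c)"
  by (intro unital_hom_extend)

lemma unital_hom_const3: "unital_hom const3"
  by (simp add: unital_hom_def const3_def one_pCons)

lemma eval3_simps [simp]:
  assumes "unital_hom k"
  shows "eval3 k a b c (const3 r) = k r" "eval3 k a b c var3_x = a" "eval3 k a b c var3_y = b"
    "eval3 k a b c var3_z = c"
  using assms by (simp_all add: const3_def var3_x_def var3_y_def var3_z_def unital_hom_extend)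

lemma poly3_hom_eqI:
  assumes "unital_hom h" "unital_hom k" "\<And>c. h (const3 c) = k (const3 c)"
    "h var3_x = k var3_x" "h var3_y = k var3_y" "h var3_z = k var3_z"
  shows "h p = k p"
proof (rule unital_hom_eqI[OF assms(1,2)])
  show "h [:p:] = k [:p:]" for p
    by (rule unital_hom_eqI2[OF unital_hom_const[OF assms(1)] unital_hom_const[OF assms(2)]])
      (use assms(3-5) in \<open>simp_all add: const3_def var3_x_def var3_y_def\<close>)
qed (use assms(6) in \<open>simp add: var3_z_def\<close>)

lemma eval3_expand:
  assumes "unital_hom k"
  shows "eval3 k a b c F = (\<Sum>l\<le>degree F. \<Sum>j\<le>degree (coeff F l). \<Sum>i\<le>degree (coeff (coeff F l) j).
    k (coeff3 F i j l) * a ^ i * b ^ j * c ^ l)"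
  by (simp add: extend_hom_altdef unital_hom_extend assms sum_distrib_right coeff3_def)

lemma eval3_homogeneous:
  assumes k: "unital_hom k" and F: "homogeneous d F"
  shows "eval3 k (s * a) (s * b) (s * c) F = s ^ d * eval3 k a b c F"
proof -
  have "k (coeff3 F i j l) * (s * a) ^ i * (s * b) ^ j * (s * c) ^ l =
      s ^ d * (k (coeff3 F i j l) * a ^ i * b ^ j * c ^ l)" for i j l
  proof (cases "coeff3 F i j l = 0")
    case False
    then have "d = i + j + l" using F by (simp add: homogeneous_def)
    then show ?thesis by (simp add: power_mult_distrib power_add mult_ac)
  qed (simp add: unital_homD[OF k])
  then show ?thesis by (simp add: eval3_expand[OF k] sum_distrib_left)
qed

definition linear_form :: "complex \<Rightarrow> complex \<Rightarrow> complex \<Rightarrow> poly3" where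
  "linear_form a b c = const3 a * var3_x + const3 b * var3_y + const3 c * var3_z"

lemma homogeneous_1_linear_form:
  assumes "homogeneous 1 L"
  obtains a b c where "L = linear_form a b c"
proof -
  define a b c where "a = coeff3 L 1 0 0" and "b = coeff3 L 0 1 0" and "c = coeff3 L 0 0 1"
  have R: "linear_form a b c = [:[:[:0, a:], [:b:]:], [:[:c:]:]:]"
    by (simp add: linear_form_def const3_def var3_x_def var3_y_def var3_z_def)
  have "coeff3 L i j k = coeff3 (linear_form a b c) i j k" for i j k
  proof (cases "i + j + k = 1")
    case True
    then consider "i = 1 \<and> j = 0 \<and> k = 0" | "i = 0 \<and> j = 1 \<and> k = 0" | "i = 0 \<and> j = 0 \<and> k = 1" by linarith
    then show ?thesis by cases (auto simp: R, auto simp: coeff3_def a_def b_def c_def)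
  next
    case False
    then have "coeff3 L i j k = 0" using assms by (auto simp: homogeneous_def)
    moreover have "coeff3 (linear_form a b c) i j k = 0"
      using False unfolding R coeff3_def by (auto simp: coeff_pCons split: nat.splits)
    ultimately show ?thesis by simp
  qed
  then have "L = linear_form a b c" by (intro poly_eqI) (simp add: coeff3_def)
  then show ?thesis by (rule that)
qed

lemma eval3_linear_form:
  "unital_hom k \<Longrightarrow> eval3 k a b c (linear_form r s t) = k r * a + k s * b + k t * c"
  by (simp add: linear_form_def unital_homD[OF unital_hom_eval3])

lemma unital_hom_pconst: "unital_hom (\<lambda>c::complex. [:c:])"
  by (simp add: unital_hom_def one_pCons)

text \<open>
  On a line through the origin of \<open>\<complex>^3\<close>, parametrized by \<open>t\<close>, every multiple of \<open>F\<close> is divisible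
  by \<open>t^d\<close>, whereas a linear form is a constant times \<open>t\<close>.
\<close>
lemma not_dvd_linear_form:
  assumes F: "homogeneous d F" "d \<ge> 2" and nz: "r \<noteq> 0 \<or> s \<noteq> 0 \<or> t \<noteq> 0"
  shows "\<not> F dvd linear_form r s t"
proof
  assume "F dvd linear_form r s t"
  then obtain Q where Q: "linear_form r s t = F * Q" by auto
  obtain a b c where abc: "r * a + s * b + t * c \<noteq> 0"
  proof -
    have "r * 1 + s * 0 + t * 0 \<noteq> 0 \<or> r * 0 + s * 1 + t * 0 \<noteq> 0 \<or> r * 0 + s * 0 + t * 1 \<noteq> 0"
      using nz by simp
    then show ?thesis using that by blast
  qed
  let ?x = "[:0, 1::complex:]"
  let ?e = "eval3 (\<lambda>c. [:c:]) (?x * [:a:]) (?x * [:b:]) (?x * [:c:])"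
  have "?x * [:r * a + s * b + t * c:] = ?e (linear_form r s t)"
    by (simp add: eval3_linear_form[OF unital_hom_pconst])
  also have "\<dots> = ?e F * ?e Q" unfolding Q by (rule unital_homD[OF unital_hom_eval3[OF unital_hom_pconst]])
  also have "?e F = ?x ^ d * eval3 (\<lambda>c. [:c:]) [:a:] [:b:] [:c:] F"
    by (rule eval3_homogeneous[OF unital_hom_pconst F(1)])
  finally have eq: "?x * [:r * a + s * b + t * c:] =
    ?x ^ d * eval3 (\<lambda>c. [:c:]) [:a:] [:b:] [:c:] F * ?e Q" .
  have "?x ^ d dvd ?x * [:r * a + s * b + t * c:]"
    unfolding eq mult.assoc by (rule dvd_triv_left)
  then have "degree (?x ^ d) \<le> degree (?x * [:r * a + s * b + t * c:])"
    using abc by (intro dvd_imp_degree_le) auto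
  then show False using F(2) abc by (simp add: degree_power_eq)
qed

text \<open>
  Homogenization \<open>E\<close>, that is, the substitution \<open>x = U/T, y = V/T\<close>, turns divisibility by \<open>\<delta> F\<close>
  into divisibility by \<open>F\<close> up to powers of \<open>T\<close>, which are harmless because \<open>F\<close> is prime and does
  not divide \<open>T\<close>. The linear forms \<open>T, U, V\<close> are the homogeneous coordinates adapted to the
  affine chart and to the point.
\<close>
lemma dehomogenization_prime:
  assumes F: "homogeneous d F" "irreducible F"
    and T: "T \<noteq> 0" "\<not> F dvd T" and lin: "\<And>r s. r \<noteq> 0 \<or> s \<noteq> 0 \<Longrightarrow> \<not> F dvd const3 r * U + const3 s * V"
    and \<delta>: "\<delta> = eval3 const2 a b c" "\<delta> T = 1" "\<delta> U = var_x" "\<delta> V = var_y"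
    and E: "E = eval2 (\<lambda>c. to_fract (const3 c)) (to_fract U / to_fract T) (to_fract V / to_fract T)"
    and abc: "to_fract var3_x = to_fract T * E a" "to_fract var3_y = to_fract T * E b" "to_fract var3_z = to_fract T * E c"
    and const: "const_term (\<delta> F) = 0"
  shows "prime_elem (\<delta> F)" "r \<noteq> 0 \<or> s \<noteq> 0 \<Longrightarrow> \<not> \<delta> F dvd const2 r * var_x + const2 s * var_y"
proof -
  have k: "unital_hom (\<lambda>c. to_fract (const3 c) :: poly3 fract)"
    by (simp add: unital_hom_def unital_homD[OF unital_hom_const3])
  have \<delta>h: "unital_hom \<delta>" unfolding \<delta>(1) by (rule unital_hom_eval3[OF unital_hom_const2])
  have \<delta>c: "\<delta> (const3 r) = const2 r" for r by (simp add: \<delta>(1) unital_hom_const2)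
  have Eh: "unital_hom E" unfolding E by (rule unital_hom_eval2[OF k])
  note \<delta>s = unital_homD[OF \<delta>h] and Es = unital_homD[OF Eh]
  have Ec: "E (const2 r) = to_fract (const3 r)" for r by (simp add: E k)
  have Exy: "to_fract T * E var_x = to_fract U" "to_fract T * E var_y = to_fract V"
    using T(1) by (simp_all add: E k)
  have Eabc: "E (\<delta> P) = eval3 (\<lambda>c. to_fract (const3 c)) (E a) (E b) (E c) P" for P
    by (rule poly3_hom_eqI[OF unital_hom_comp[OF Eh \<delta>h] unital_hom_eval3[OF k]])
      (simp_all add: \<delta>c Ec k, simp_all add: \<delta>(1) unital_hom_const2)
  have "to_fract F = eval3 (\<lambda>c. to_fract (const3 c)) (to_fract T * E a) (to_fract T * E b) (to_fract T * E c) F"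
    by (rule poly3_hom_eqI[OF _ unital_hom_eval3[OF k]])
      (simp_all add: k abc unital_hom_def)
  also have "\<dots> = to_fract T ^ d * E (\<delta> F)"
    unfolding Eabc by (rule eval3_homogeneous[OF k F(1)])
  finally have F': "to_fract F = to_fract T ^ d * E (\<delta> F)" .
  have pow: "to_fract (p ^ n) = to_fract p ^ n" for p :: poly3 and n by (induction n) auto
  have hom: "\<exists>n H. to_fract H = to_fract T ^ n * E g \<and> \<delta> H = g" for g
  proof (induction g rule: poly2_induct)
    case (1 c)
    show ?case by (intro exI[of _ 0] exI[of _ "const3 c"]) (simp add: Ec \<delta>c)
  next
    case 2
    show ?case by (intro exI[of _ 1] exI[of _ U]) (simp add: Exy \<delta>(2-4))
  next
    case 3
    show ?case by (intro exI[of _ 1] exI[of _ V]) (simp add: Exy \<delta>(2-4))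
  next
    case (4 p q)
    then obtain n H n' H' where H: "to_fract H = to_fract T ^ n * E p" "\<delta> H = p"
      "to_fract H' = to_fract T ^ n' * E q" "\<delta> H' = q" by blast
    show ?case
      by (intro exI[of _ "n + n'"] exI[of _ "T ^ n' * H + T ^ n * H'"])
        (simp add: H pow \<delta>s Es \<delta>(2) power_add algebra_simps)
  next
    case (5 p q)
    then obtain n H n' H' where H: "to_fract H = to_fract T ^ n * E p" "\<delta> H = p"
      "to_fract H' = to_fract T ^ n' * E q" "\<delta> H' = q" by blast
    show ?case
      by (intro exI[of _ "n + n'"] exI[of _ "H * H'"]) (simp add: H \<delta>s Es power_add)
  qed
  have pF: "prime_elem F" using F(2) by (simp add: prime_elem_iff_irreducible)
  have nT: "\<not> F dvd T ^ n" for n using T(2) pF prime_elem_dvd_power by blast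
  have lift: "F dvd H" if "\<delta> F dvd g" and H: "to_fract H = to_fract T ^ n * E g" for g n H
  proof -
    obtain r where r: "g = \<delta> F * r" using \<open>\<delta> F dvd g\<close> by auto
    obtain n' R where R: "to_fract R = to_fract T ^ n' * E r" using hom by blast
    have "to_fract (T ^ (d + n') * H) = to_fract (T ^ n * (F * R))"
      by (simp add: pow H r Es F' R power_add)
    then have "T ^ (d + n') * H = T ^ n * (F * R)" by (rule to_fract_eq_iff[THEN iffD1])
    then have "F dvd T ^ (d + n') * H" by simp
    then show ?thesis using pF nT by (simp add: prime_elem_dvd_mult_iff)
  qed
  show "prime_elem (\<delta> F)"
  proof (rule prime_elemI)
    show "\<delta> F \<noteq> 0" using F' pF by (auto simp: Es)
    show "\<not> \<delta> F dvd 1"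
    proof
      assume "\<delta> F dvd 1"
      then obtain r where "1 = \<delta> F * r" by auto
      then have "const_term 1 = const_term (\<delta> F) * const_term r" by (metis const_term_simps(4))
      then show False using const by (simp add: const_term_simps)
    qed
    fix g h assume gh: "\<delta> F dvd g * h"
    obtain n H n' H' where H: "to_fract H = to_fract T ^ n * E g" "\<delta> H = g"
      "to_fract H' = to_fract T ^ n' * E h" "\<delta> H' = h" using hom by metis
    have "F dvd H * H'"
      by (rule lift[OF gh, of _ "n + n'"]) (simp add: H Es power_add)
    then have "F dvd H \<or> F dvd H'" using pF by (simp add: prime_elem_dvd_mult_iff)
    then show "\<delta> F dvd g \<or> \<delta> F dvd h"
      using H by (auto simp: dvd_def \<delta>s)
  qed
  assume rs: "r \<noteq> 0 \<or> s \<noteq> 0"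
  show "\<not> \<delta> F dvd const2 r * var_x + const2 s * var_y"
  proof
    assume *: "\<delta> F dvd const2 r * var_x + const2 s * var_y"
    have "F dvd const3 r * U + const3 s * V"
      by (rule lift[OF *, of _ 1]) (simp add: Es Ec Exy algebra_simps flip: Exy)
    then show False using lin[OF rs] by blast
  qed
qed

lemma on_curve_iff: "on_curve (a, b, c) F \<longleftrightarrow> (a, b, c) \<noteq> (0, 0, 0) \<and> eval3 (\<lambda>x. x) a b c F = 0"
proof -
  have "poly (poly (poly F [:[:c:]:]) [:b:]) a = eval3 (\<lambda>x. x) a b c F"
    by (rule poly3_hom_eqI[where h = "\<lambda>F. poly (poly (poly F [:[:c:]:]) [:b:]) a"])
      (auto simp: unital_hom_eval3 unital_hom_id, auto simp: unital_hom_def const3_def var3_x_def var3_y_def var3_z_def)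
  then show ?thesis by (simp add: on_curve_def)
qed

lemma const_term_eval3: "const_term (eval3 const2 a b c F) = eval3 (\<lambda>x. x) (const_term a) (const_term b) (const_term c) F"
  by (rule poly3_hom_eqI[OF unital_hom_comp[OF unital_hom_const_term unital_hom_eval3[OF unital_hom_const2]]
        unital_hom_eval3[OF unital_hom_id]])
    (simp_all add: unital_hom_const2 unital_hom_id)

text \<open>
  The form common to the three standard charts: \<open>T\<close> is the coordinate that becomes 1, and
  \<open>a, b, c\<close> are the values of the three homogeneous coordinates in the chart.
\<close>
lemma chart_properties:
  fixes a b c :: poly2 and T U V :: poly3 and p0 :: complex
  defines "E \<equiv> eval2 (\<lambda>c. to_fract (const3 c)) (to_fract U / to_fract T) (to_fract V / to_fract T)"
    and "\<delta> \<equiv> eval3 const2 a b c"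
  assumes T: "T \<noteq> 0" "\<exists>r s t. (r \<noteq> 0 \<or> s \<noteq> 0 \<or> t \<noteq> 0) \<and> T = linear_form r s t"
    and basis: "\<And>p1 p2 p3. \<exists>t r s. linear_form p1 p2 p3 = const3 t * T + const3 r * U + const3 s * V"
    and lin: "\<And>r s. r \<noteq> 0 \<or> s \<noteq> 0 \<Longrightarrow>
      \<exists>p1 p2 p3. (p1 \<noteq> 0 \<or> p2 \<noteq> 0 \<or> p3 \<noteq> 0) \<and> const3 r * U + const3 s * V = linear_form p1 p2 p3"
    and \<delta>: "\<delta> T = 1" "\<delta> U = var_x" "\<delta> V = var_y"
    and abc: "to_fract var3_x = to_fract T * E a" "to_fract var3_y = to_fract T * E b" "to_fract var3_z = to_fract T * E c"
    and q: "p0 \<noteq> 0" "q = (p0 * const_term a, p0 * const_term b, p0 * const_term c)"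
  shows "homogeneous d F \<Longrightarrow> on_curve q F \<Longrightarrow> const_term (\<delta> F) = 0"
    and "homogeneous d F \<Longrightarrow> d \<ge> 2 \<Longrightarrow> irreducible F \<Longrightarrow> on_curve q F \<Longrightarrow> prime_elem (\<delta> F)"
    and "homogeneous d F \<Longrightarrow> d \<ge> 2 \<Longrightarrow> irreducible F \<Longrightarrow> on_curve q F \<Longrightarrow> r \<noteq> 0 \<or> s \<noteq> 0 \<Longrightarrow>
      \<not> \<delta> F dvd const2 r * var_x + const2 s * var_y"
    and "line L \<Longrightarrow> on_curve q L \<Longrightarrow> \<exists>r s. (r \<noteq> 0 \<or> s \<noteq> 0) \<and> \<delta> L = const2 r * var_x + const2 s * var_y"
proof -
  show ct: "const_term (\<delta> F) = 0" if "homogeneous d F" "on_curve q F" for d F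
  proof -
    have "p0 ^ d * const_term (\<delta> F) = 0"
      using that(2) eval3_homogeneous[OF unital_hom_id that(1), of p0 "const_term a" "const_term b" "const_term c"]
      by (simp add: q(2) on_curve_iff \<delta>_def const_term_eval3)
    then show ?thesis using q(1) by simp
  qed
  show "prime_elem (\<delta> F)" "r \<noteq> 0 \<or> s \<noteq> 0 \<Longrightarrow> \<not> \<delta> F dvd const2 r * var_x + const2 s * var_y"
    if F: "homogeneous d F" "d \<ge> 2" "irreducible F" "on_curve q F" for d F r s
  proof -
    have nT: "\<not> F dvd T" using T(2) not_dvd_linear_form[OF F(1,2)] by blast
    have nl: "\<not> F dvd const3 r * U + const3 s * V" if "r \<noteq> 0 \<or> s \<noteq> 0" for r s
      using lin[OF that] not_dvd_linear_form[OF F(1,2)] by metis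
    note * = dehomogenization_prime[OF F(1,3) T(1) nT nl \<delta>_def[THEN meta_eq_to_obj_eq] \<delta>
        E_def[THEN meta_eq_to_obj_eq] abc ct[OF F(1,4)]]
    show "prime_elem (\<delta> F)" by (rule *(1))
    show "\<not> \<delta> F dvd const2 r * var_x + const2 s * var_y" if "r \<noteq> 0 \<or> s \<noteq> 0" by (rule *(2)[OF _ that])
  qed
  assume L: "line L" "on_curve q L"
  then have L1: "homogeneous 1 L" by (simp add: line_def)
  obtain p1 p2 p3 where "L = linear_form p1 p2 p3" using homogeneous_1_linear_form[OF L1] .
  then obtain t r s where trs: "L = const3 t * T + const3 r * U + const3 s * V" using basis by metis
  have \<delta>L: "\<delta> L = const2 t + const2 r * var_x + const2 s * var_y"
    unfolding trs using \<delta> by (simp add: \<delta>_def unital_homD[OF unital_hom_eval3[OF unital_hom_const2]] unital_hom_const2)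
  then have "t = 0" using ct[OF L1 L(2)] by (simp add: const_term_simps)
  then have "\<delta> L = const2 r * var_x + const2 s * var_y" "r \<noteq> 0 \<or> s \<noteq> 0"
    using \<delta>L trs L(1) by (auto simp: line_def unital_homD[OF unital_hom_const2] unital_homD[OF unital_hom_const3])
  then show "\<exists>r s. (r \<noteq> 0 \<or> s \<noteq> 0) \<and> \<delta> L = const2 r * var_x + const2 s * var_y" by blast
qed

text \<open>
  In the coordinates \<open>T, X, Y\<close>, with \<open>T\<close> the one that is nonzero at \<open>q\<close>, the linear forms
  \<open>X - u T\<close> and \<open>Y - v T\<close> vanish at \<open>q\<close> and become the affine coordinates \<open>x\<close> and \<open>y\<close>.
\<close>
lemma local_eq_properties:
  assumes q: "q \<noteq> (0, 0, 0)"
  obtains \<delta> where "\<And>F. local_eq F q = \<delta> F"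
    "\<And>d F. homogeneous d F \<Longrightarrow> on_curve q F \<Longrightarrow> const_term (\<delta> F) = 0"
    "\<And>d F. homogeneous d F \<Longrightarrow> d \<ge> 2 \<Longrightarrow> irreducible F \<Longrightarrow> on_curve q F \<Longrightarrow> prime_elem (\<delta> F)"
    "\<And>d F r s. homogeneous d F \<Longrightarrow> d \<ge> 2 \<Longrightarrow> irreducible F \<Longrightarrow> on_curve q F \<Longrightarrow> r \<noteq> 0 \<or> s \<noteq> 0 \<Longrightarrow>
      \<not> \<delta> F dvd const2 r * var_x + const2 s * var_y"
    "\<And>L. line L \<Longrightarrow> on_curve q L \<Longrightarrow> \<exists>r s. (r \<noteq> 0 \<or> s \<noteq> 0) \<and> \<delta> L = const2 r * var_x + const2 s * var_y"
proof -
  note result = that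
  have main: thesis
    if loc: "\<And>F. local_eq F q = eval3 const2 A B C F" and p0: "p0 \<noteq> 0"
      and q': "q = (p0 * const_term A, p0 * const_term B, p0 * const_term C)"
      and perm: "(T, X, Y, A, B, C) \<in> {(var3_x, var3_y, var3_z, 1, const2 u + var_x, const2 v + var_y),
        (var3_y, var3_x, var3_z, const2 u + var_x, 1, const2 v + var_y),
        (var3_z, var3_x, var3_y, const2 u + var_x, const2 v + var_y, 1)}" for T X Y A B C p0 u v
  proof -
    define U V where "U = X - const3 u * T" and "V = Y - const3 v * T"
    note c3 = unital_homD[OF unital_hom_const3]
    have form: "\<exists>t r s. linear_form p1 p2 p3 = const3 t * T + const3 r * X + const3 s * Y" for p1 p2 p3
    proof -
      have "linear_form p1 p2 p3 \<in> {const3 p1 * T + const3 p2 * X + const3 p3 * Y,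
          const3 p2 * T + const3 p1 * X + const3 p3 * Y, const3 p3 * T + const3 p1 * X + const3 p2 * Y}"
        using perm by (auto simp: linear_form_def ac_simps)
      then show ?thesis by blast
    qed
    have basis: "\<exists>t r s. linear_form p1 p2 p3 = const3 t * T + const3 r * U + const3 s * V" for p1 p2 p3
    proof -
      obtain t r s where "linear_form p1 p2 p3 = const3 t * T + const3 r * X + const3 s * Y" using form by blast
      also have "\<dots> = const3 (t + r * u + s * v) * T + const3 r * U + const3 s * V"
        by (simp add: U_def V_def c3 algebra_simps)
      finally show ?thesis by blast
    qed
    have form': "\<exists>p1 p2 p3. (p1 \<noteq> 0 \<or> p2 \<noteq> 0 \<or> p3 \<noteq> 0) \<and>
        const3 t * T + const3 r * X + const3 s * Y = linear_form p1 p2 p3"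
      if "t \<noteq> 0 \<or> r \<noteq> 0 \<or> s \<noteq> 0" for t r s
    proof -
      have "const3 t * T + const3 r * X + const3 s * Y \<in> {linear_form t r s, linear_form r t s, linear_form r s t}"
        using perm by (auto simp: linear_form_def ac_simps)
      then show ?thesis using that by blast
    qed
    have lin: "\<exists>p1 p2 p3. (p1 \<noteq> 0 \<or> p2 \<noteq> 0 \<or> p3 \<noteq> 0) \<and> const3 r * U + const3 s * V = linear_form p1 p2 p3"
      if "r \<noteq> 0 \<or> s \<noteq> 0" for r s
    proof -
      have "const3 r * U + const3 s * V = const3 (- r * u - s * v) * T + const3 r * X + const3 s * Y"
        by (simp add: U_def V_def c3 algebra_simps)
      then show ?thesis using form'[of "- r * u - s * v" r s] that by auto
    qed
    have T: "T \<noteq> 0" using perm by (auto simp: var3_x_def var3_y_def var3_z_def)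
    have T': "\<exists>r s t. (r \<noteq> 0 \<or> s \<noteq> 0 \<or> t \<noteq> 0) \<and> T = linear_form r s t"
      using form'[of 1 0 0] by (simp add: c3)
    have \<delta>: "eval3 const2 A B C T = 1" "eval3 const2 A B C U = var_x" "eval3 const2 A B C V = var_y"
      unfolding U_def V_def using perm
      by (auto simp: unital_homD[OF unital_hom_eval3[OF unital_hom_const2]] unital_hom_const2)
    let ?E = "eval2 (\<lambda>c. to_fract (const3 c)) (to_fract U / to_fract T) (to_fract V / to_fract T)"
    have k: "unital_hom (\<lambda>c. to_fract (const3 c) :: poly3 fract)" by (simp add: unital_hom_def c3)
    have E: "to_fract var3_x = to_fract T * ?E A" "to_fract var3_y = to_fract T * ?E B"
      "to_fract var3_z = to_fract T * ?E C"
      using perm T by (auto simp: U_def V_def k unital_homD[OF unital_hom_eval2[OF k]] distrib_left)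
    show ?thesis by (rule result[OF loc chart_properties[OF T T' basis lin \<delta> E p0 q']])
  qed
  obtain a b c where abc: "q = (a, b, c)" by (metis prod_cases3)
  consider "a \<noteq> 0" | "a = 0" "b \<noteq> 0" | "a = 0" "b = 0" "c \<noteq> 0" using q abc by auto
  then show ?thesis
  proof cases
    case 1
    show ?thesis
      by (rule main[of 1 "const2 (b / a) + var_x" "const2 (c / a) + var_y" a var3_x var3_y var3_z "b / a" "c / a"])
        (use 1 in \<open>simp_all add: abc local_eq_def subst3_eq const_term_simps\<close>)
  next
    case 2
    show ?thesis
      by (rule main[of "const2 (a / b) + var_x" 1 "const2 (c / b) + var_y" b var3_y var3_x var3_z "a / b" "c / b"])
        (use 2 in \<open>simp_all add: abc local_eq_def subst3_eq const_term_simps\<close>)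
  next
    case 3
    show ?thesis
      by (rule main[of "const2 (a / c) + var_x" "const2 (b / c) + var_y" 1 c var3_z var3_x var3_y "a / c" "b / c"])
        (use 3 in \<open>simp_all add: abc local_eq_def subst3_eq const_term_simps\<close>)
  qed
qed


section \<open>Intersection with a line\<close>

lemma local_ring_eq: "local_ring = {Fract a b | a b. const_term b \<noteq> 0}"
  by (simp add: local_ring_def const_term_def)

lemma local_ringI: "const_term b \<noteq> 0 \<Longrightarrow> Fract a b \<in> local_ring"
  by (auto simp: local_ring_eq)

lemma subring_local_ring: "subring_of_field local_ring"
  unfolding subring_of_field_def
proof (intro conjI ballI)
  show "1 \<in> local_ring" using local_ringI[of 1 1] by (simp add: const_term_simps One_fract_def)
  fix g h assume "g \<in> local_ring" "h \<in> local_ring"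
  then obtain a b c d where *: "g = Fract a b" "const_term b \<noteq> 0" "h = Fract c d" "const_term d \<noteq> 0"
    by (auto simp: local_ring_eq)
  then have "b \<noteq> 0" "d \<noteq> 0" "const_term (b * d) \<noteq> 0" by (auto simp: const_term_simps)
  then show "g - h \<in> local_ring" "g * h \<in> local_ring" using * by (auto intro!: local_ringI)
qed

text \<open>
  The first \<open>n\<close> coefficients of the power series \<open>p / q\<close>.
\<close>
lemma division_by_unit_series:
  fixes p q :: "complex poly"
  assumes "coeff q 0 \<noteq> 0"
  shows "\<exists>c r. p = (\<Sum>i<n. monom (c i) i) * q + [:0, 1:] ^ n * r"
proof (induction n)
  case 0
  show ?case by (intro exI[of _ "\<lambda>_. 0"] exI[of _ p]) simp
next
  case (Suc n)
  then obtain c r where cr: "p = (\<Sum>i<n. monom (c i) i) * q + [:0, 1:] ^ n * r" by blast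
  define e where "e = coeff r 0 / coeff q 0"
  have "poly (r - smult e q) 0 = 0" using assms by (simp add: e_def poly_0_coeff_0)
  then have "[:0, 1:] dvd r - smult e q" using poly_eq_0_iff_dvd[of "r - smult e q" 0] by simp
  then obtain r' where r': "r - smult e q = [:0, 1:] * r'" by (rule dvdE)
  have "r = smult e q + [:0, 1:] * r'" using r' by (simp add: algebra_simps)
  moreover have "monom e n = [:0, 1:] ^ n * [:e:]" by (simp add: monom_altdef)
  ultimately have "[:0, 1:] ^ n * r = monom e n * q + [:0, 1:] ^ Suc n * r'" by (simp add: algebra_simps)
  moreover have "(\<Sum>i<n. monom (c i) i) = (\<Sum>i<n. monom ((c(n := e)) i) i)" by (intro sum.cong) auto
  ultimately have "p = (\<Sum>i<Suc n. monom ((c(n := e)) i) i) * q + [:0, 1:] ^ Suc n * r'"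
    using cr by (simp add: algebra_simps)
  then show ?case by blast
qed

text \<open>
  On the line \<open>l = 0\<close> with parameter \<open>s\<close> the coordinates are \<open>x = u s\<close> and \<open>y = v s\<close>.
\<close>
lemma line_reduction:
  assumes x: "l dvd var_x - const2 u * s" and y: "l dvd var_y - const2 v * s"
  shows "l dvd p - extend_hom const2 s (eval2 (\<lambda>c. [:c:]) [:0, u:] [:0, v:] p)"
proof -
  define \<rho> where "\<rho> = eval2 (\<lambda>c. [:c:]) [:0, u:] [:0, v:]"
  define \<iota> where "\<iota> = extend_hom const2 s"
  have \<rho>: "unital_hom \<rho>" unfolding \<rho>_def by (rule unital_hom_eval2[OF unital_hom_pconst])
  have \<iota>: "unital_hom \<iota>" unfolding \<iota>_def by (rule unital_hom_extend[OF unital_hom_const2])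
  note \<rho>s = unital_homD[OF \<rho>] and \<iota>s = unital_homD[OF \<iota>]
  have v: "\<rho> (const2 c) = [:c:]" "\<rho> var_x = [:0, u:]" "\<rho> var_y = [:0, v:]"
    "\<iota> [:c:] = const2 c" "\<iota> [:0, c:] = const2 c * s" for c
    by (simp_all add: \<rho>_def \<iota>_def unital_hom_pconst unital_hom_const2 extend_hom_pCons
        unital_homD[OF unital_hom_const2] mult.commute)
  have "l dvd p - \<iota> (\<rho> p)"
  proof (induction p rule: poly2_induct)
    case (4 p q)
    have "p + q - \<iota> (\<rho> (p + q)) = (p - \<iota> (\<rho> p)) + (q - \<iota> (\<rho> q))" by (simp add: \<rho>s \<iota>s)
    then show ?case using 4 by (metis dvd_add)
  next
    case (5 p q)
    have "p * q - \<iota> (\<rho> (p * q)) = (p - \<iota> (\<rho> p)) * q + \<iota> (\<rho> p) * (q - \<iota> (\<rho> q))"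
      by (simp add: \<rho>s \<iota>s algebra_simps)
    then show ?case using 5 by (metis dvd_add dvd_mult dvd_mult2)
  qed (use x y in \<open>simp_all add: v\<close>)
  then show ?thesis by (simp add: \<rho>_def \<iota>_def)
qed

text \<open>
  Restriction to the line identifies the local ring modulo \<open>l\<close> and \<open>f\<close> with \<open>\<complex>[x] / (x^n)\<close>,
  where \<open>n\<close> is the order of the restriction of \<open>f\<close>. The powers of the parameter below the \<open>n\<close>-th
  span. Fewer than \<open>n\<close> elements cannot span, for otherwise a nonzero combination of these powers
  would be zero in the quotient, whereas its restriction is not divisible by \<open>x^n\<close>.
\<close>
lemma intersection_with_line:
  fixes f l s :: poly2 and u v :: complex
  defines "\<rho> \<equiv> eval2 (\<lambda>c. [:c:]) [:0, u:] [:0, v:]"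
  assumes x: "l dvd var_x - const2 u * s" and y: "l dvd var_y - const2 v * s"
    and l: "\<rho> l = 0" and s: "\<rho> s = [:0, 1:]" and f: "\<rho> f \<noteq> 0"
  shows "intersection_origin f l = Polynomial.order 0 (\<rho> f)"
proof -
  define n where "n = Polynomial.order 0 (\<rho> f)"
  have \<rho>: "unital_hom \<rho>" unfolding \<rho>_def by (rule unital_hom_eval2[OF unital_hom_pconst])
  note \<rho>s = unital_homD[OF \<rho>]
  have \<rho>v: "\<rho> (const2 c) = [:c:]" "\<rho> var_x = [:0, u:]" "\<rho> var_y = [:0, v:]" for c
    by (simp_all add: \<rho>_def unital_hom_pconst)
  define \<iota> where "\<iota> = extend_hom const2 s"
  have \<iota>: "unital_hom \<iota>" unfolding \<iota>_def by (rule unital_hom_extend[OF unital_hom_const2])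
  note \<iota>s = unital_homD[OF \<iota>]
  have \<iota>v: "\<iota> [:c:] = const2 c" "\<iota> [:0, 1:] = s" for c
    by (simp_all add: \<iota>_def unital_hom_const2)
  have \<iota>v': "\<iota> [:0, c:] = const2 c * s" for c
    using \<iota>s(4)[of "[:c:]" "[:0, 1:]"] by (simp add: \<iota>v)
  have \<iota>m: "\<iota> (monom c i) = const2 c * s ^ i" for c i
    by (simp add: \<iota>_def extend_hom_monom unital_hom_const2)
  have ct: "coeff (\<rho> p) 0 = const_term p" for p
  proof (rule poly2_hom_eqI[OF _ unital_hom_const_term])
    show "unital_hom (\<lambda>p. coeff (\<rho> p) 0)" by (simp add: unital_hom_def \<rho>s coeff_mult)
  qed (simp_all add: \<rho>v)
  have ct\<iota>: "const_term (\<iota> p) = coeff p 0" for p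
  proof -
    have s0: "const_term s = 0" using ct[of s] s by simp
    show ?thesis
      by (rule unital_hom_eqI[where h = "\<lambda>p. const_term (\<iota> p)" and k = "\<lambda>p. coeff p 0"])
        (simp_all add: unital_hom_def \<iota>s \<iota>v const_term_simps coeff_mult s0)
  qed
  have mod: "l dvd p - \<iota> (\<rho> p)" for p
    unfolding \<iota>_def \<rho>_def by (rule line_reduction[OF x y])
  obtain w where w: "\<rho> f = [:0, 1:] ^ n * w" "coeff w 0 \<noteq> 0"
    using order_decomp[OF f, of 0] poly_eq_0_iff_dvd[of _ 0] by (auto simp: n_def poly_0_coeff_0)
  have upper: "\<exists>c. \<exists>g\<in>local_ring. \<exists>h'\<in>local_ring.
      h = (\<Sum>i<n. Fract (const2 (c i)) 1 * to_fract (s ^ i)) + Fract f 1 * g + Fract l 1 * h'"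
    if h: "h \<in> local_ring" for h
  proof -
    obtain a b where ab: "h = Fract a b" "const_term b \<noteq> 0" using h by (auto simp: local_ring_eq)
    have "coeff (\<rho> b) 0 \<noteq> 0" using ab ct by simp
    then obtain c r where cr: "\<rho> a = (\<Sum>i<n. monom (c i) i) * \<rho> b + [:0, 1:] ^ n * r"
      using division_by_unit_series by blast
    define p where "p = \<iota> (\<Sum>i<n. monom (c i) i)"
    have split: "\<exists>A. p = \<iota> (\<rho> p) + l * A" for p
    proof -
      obtain A where "p - \<iota> (\<rho> p) = l * A" using mod[of p] by (rule dvdE)
      then have "p = \<iota> (\<rho> p) + l * A" by (simp add: algebra_simps)
      then show ?thesis by blast
    qed
    obtain A1 where A1: "a = \<iota> (\<rho> a) + l * A1" using split by blast
    obtain A2 where A2: "f = \<iota> (\<rho> f) + l * A2" using split by blast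
    obtain A3 where A3: "b = \<iota> (\<rho> b) + l * A3" using split by blast
    have f': "f = s ^ n * \<iota> w + l * A2" using A2 w by (simp add: \<iota>s \<iota>v)
    have a': "a = p * (b - l * A3) + s ^ n * \<iota> r + l * A1"
    proof -
      have "\<iota> (\<rho> a) = p * \<iota> (\<rho> b) + s ^ n * \<iota> r" unfolding cr by (simp add: \<iota>s \<iota>v p_def)
      moreover have "\<iota> (\<rho> b) = b - l * A3" using A3 by (simp add: algebra_simps)
      ultimately show ?thesis using A1 by simp
    qed
    define D where "D = \<iota> w * b"
    have D: "const_term D \<noteq> 0" using ab w by (simp add: D_def const_term_simps ct\<iota>)
    then have D0: "D \<noteq> 0" "b \<noteq> 0" "\<iota> w \<noteq> 0" by (auto simp: D_def const_term_simps)
    define B where "B = A1 * \<iota> w - \<iota> r * A2 - p * A3 * \<iota> w"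
    \<comment> \<open>\<open>a / b\<close> is congruent to \<open>p\<close> modulo \<open>f\<close> and \<open>l\<close>, because \<open>w\<close> is a unit\<close>
    have "\<iota> w * a = p * D + f * \<iota> r + l * B"
      unfolding B_def D_def by (subst a', subst f') (simp add: algebra_simps)
    then have eq: "to_fract (\<iota> w) * to_fract a = to_fract p * to_fract D + to_fract f * to_fract (\<iota> r) + to_fract l * to_fract B"
      by (metis to_fract_add to_fract_mult)
    have "h = to_fract a / to_fract b" unfolding ab by (simp add: Fract_conv_to_fract)
    also have "\<dots> = to_fract (\<iota> w) * to_fract a / to_fract D" using D0 by (simp add: D_def)
    also have "\<dots> = to_fract p + to_fract f * (to_fract (\<iota> r) / to_fract D) + to_fract l * (to_fract B / to_fract D)"
      unfolding eq using D0 by (simp add: add_divide_distrib)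
    also have "to_fract p = (\<Sum>i<n. Fract (const2 (c i)) 1 * to_fract (s ^ i))"
      unfolding p_def unital_hom_sum[OF \<iota>] unital_hom_sum[OF unital_hom_to_fract] \<iota>m
      by (simp add: to_fract_def)
    finally have "h = (\<Sum>i<n. Fract (const2 (c i)) 1 * to_fract (s ^ i)) + Fract f 1 * Fract (\<iota> r) D + Fract l 1 * Fract B D"
      by (simp add: Fract_conv_to_fract)
    then show ?thesis using local_ringI[OF D] by blast
  qed
  have sn: "to_fract (s ^ i) \<in> local_ring" for i
    unfolding to_fract_def by (rule local_ringI) (simp add: const_term_simps)
  have lower: "n \<le> k" if e: "\<forall>i<k. e i \<in> local_ring"
    and span: "\<forall>h\<in>local_ring. \<exists>c. \<exists>g\<in>local_ring. \<exists>h'\<in>local_ring.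
      h = (\<Sum>i<k. Fract (const2 (c i)) 1 * e i) + Fract f 1 * g + Fract l 1 * h'" for k e
  proof (rule ccontr)
    assume "\<not> n \<le> k"
    define R where "R j c g h' \<longleftrightarrow> g \<in> local_ring \<and> h' \<in> local_ring \<and>
      to_fract (s ^ j) = (\<Sum>i<k. Fract (const2 (c i)) 1 * e i) + Fract f 1 * g + Fract l 1 * h'" for j c g h'
    have "\<exists>c g h'. R j c g h'" for j
      using bspec[OF span sn[of j]] unfolding R_def by blast
    then obtain c g h' where "R j (c j) (g j) (h' j)" for j by metis
    then obtain c g h' where cgh: "\<And>j. g j \<in> local_ring" "\<And>j. h' j \<in> local_ring"
      "\<And>j. to_fract (s ^ j) = (\<Sum>i<k. Fract (const2 (c j i)) 1 * e i) + Fract f 1 * g j + Fract l 1 * h' j"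
      unfolding R_def by blast
    obtain z where z: "\<exists>j<n. z j \<noteq> 0" "\<And>i. i < k \<Longrightarrow> (\<Sum>j<n. z j * c j i) = 0"
      using dependent_rows[of "{..<n}" k c] \<open>\<not> n \<le> k\<close> by auto
    define C where "C r = to_fract (const2 r)" for r
    have C: "unital_hom C" unfolding C_def by (rule unital_hom_comp[OF unital_hom_to_fract unital_hom_const2])
    note Cs = unital_homD[OF C]
    have CL: "C r \<in> local_ring" for r
      unfolding C_def to_fract_def by (rule local_ringI) (simp add: const_term_simps)
    define P where "P = (\<Sum>j<n. monom (z j) j)"
    define g0 where "g0 = (\<Sum>j<n. C (z j) * g j)"
    define h0 where "h0 = (\<Sum>j<n. C (z j) * h' j)"
    have "to_fract (\<iota> P) = (\<Sum>j<n. C (z j) * to_fract (s ^ j))"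
      unfolding P_def unital_hom_sum[OF \<iota>] unital_hom_sum[OF unital_hom_to_fract] \<iota>m by (simp add: C_def)
    also have "\<dots> = (\<Sum>j<n. \<Sum>i<k. C (z j * c j i) * e i) + to_fract f * g0 + to_fract l * h0"
      unfolding cgh(3) by (simp add: C_def[symmetric] to_fract_def[symmetric] g0_def h0_def Cs distrib_left
          sum.distrib sum_distrib_left mult_ac)
    also have "(\<Sum>j<n. \<Sum>i<k. C (z j * c j i) * e i) = (\<Sum>i<k. C (\<Sum>j<n. z j * c j i) * e i)"
      unfolding unital_hom_sum[OF C] sum_distrib_right by (rule sum.swap)
    also have "\<dots> = 0" by (intro sum.neutral) (auto simp: z(2) Cs)
    finally have eq: "to_fract (\<iota> P) = to_fract f * g0 + to_fract l * h0" by simp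
    have "g0 \<in> local_ring" "h0 \<in> local_ring"
      unfolding g0_def h0_def using CL cgh(1,2) subring_closed(6)[OF subring_local_ring]
      by (auto intro!: subring_sum[OF subring_local_ring])
    then obtain a b a' b' where ab: "g0 = Fract a b" "const_term b \<noteq> 0" "h0 = Fract a' b'" "const_term b' \<noteq> 0"
      by (auto simp: local_ring_eq)
    have b0: "b \<noteq> 0" "b' \<noteq> 0" using ab by (auto simp: const_term_simps)
    have "to_fract (\<iota> P * (b * b')) = to_fract (f * (a * b') + l * (a' * b))"
      using eq b0 by (simp add: ab Fract_conv_to_fract field_simps)
    then have "\<iota> P * (b * b') = f * (a * b') + l * (a' * b)" by (rule to_fract_eq_iff[THEN iffD1])
    then have "\<rho> (\<iota> P * (b * b')) = \<rho> (f * (a * b') + l * (a' * b))" by (rule arg_cong)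
    then have "\<rho> (\<iota> P) * \<rho> (b * b') = [:0, 1:] ^ n * (w * \<rho> (a * b'))"
      by (simp add: \<rho>s w l)
    moreover have "\<rho> (\<iota> P) = P"
      by (rule unital_hom_eqI[OF unital_hom_comp[OF \<rho> \<iota>] unital_hom_id]) (simp_all add: \<iota>v \<rho>v s)
    ultimately have dv: "[:- 0, 1:] ^ n dvd P * \<rho> (b * b')" by simp
    have P0: "P \<noteq> 0"
    proof -
      obtain j where "j < n" "z j \<noteq> 0" using z(1) by blast
      then have "coeff P j \<noteq> 0" by (simp add: P_def coeff_sum)
      then show ?thesis by auto
    qed
    have nz: "poly (\<rho> (b * b')) 0 \<noteq> 0" using ab by (simp add: poly_0_coeff_0 ct const_term_simps)
    then have Q0: "\<rho> (b * b') \<noteq> 0" by auto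
    have "n \<le> Polynomial.order 0 (P * \<rho> (b * b'))" using dv P0 Q0 by (subst (asm) order_divides) auto
    also have "\<dots> = Polynomial.order 0 P" using P0 Q0 nz by (simp add: order_mult order_root)
    also have "\<dots> \<le> degree P" by (rule order_degree[OF P0])
    finally have "n \<le> degree P" .
    moreover have "degree P < n"
    proof -
      have "n > 0" using \<open>\<not> n \<le> k\<close> by simp
      moreover have "coeff P i = 0" if "i \<ge> n" for i using that by (simp add: P_def coeff_sum)
      ultimately show ?thesis using P0 by (metis leading_coeff_0_iff not_less)
    qed
    ultimately show False by simp
  qed
  show ?thesis
    unfolding intersection_origin_def n_def[symmetric]
  proof (rule Least_equality)
    show "\<exists>e. (\<forall>i<n. e i \<in> local_ring) \<and> (\<forall>h\<in>local_ring. \<exists>c. \<exists>u\<in>local_ring. \<exists>v\<in>local_ring.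
      h = (\<Sum>i<n. Fract (const2 (c i)) 1 * e i) + Fract f 1 * u + Fract l 1 * v)"
      by (rule exI[of _ "\<lambda>i. to_fract (s ^ i)"]) (use upper sn in auto)
  next
    fix k :: nat
    assume "\<exists>e. (\<forall>i<k. e i \<in> local_ring) \<and> (\<forall>h\<in>local_ring. \<exists>c. \<exists>u\<in>local_ring. \<exists>v\<in>local_ring.
      h = (\<Sum>i<k. Fract (const2 (c i)) 1 * e i) + Fract f 1 * u + Fract l 1 * v)"
    then obtain e where "\<forall>i<k. e i \<in> local_ring" "\<forall>h\<in>local_ring. \<exists>c. \<exists>u\<in>local_ring. \<exists>v\<in>local_ring.
      h = (\<Sum>i<k. Fract (const2 (c i)) 1 * e i) + Fract f 1 * u + Fract l 1 * v" by (elim exE conjE)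
    then show "n \<le> k" by (rule lower)
  qed
qed


section \<open>The delta-invariant of a unibranch point\<close>

lemma poly_at_0_coeffs:
  fixes p :: "complex poly"
  assumes "p \<noteq> 0"
  shows "coeff p (Polynomial.order 0 p) \<noteq> 0" "j < Polynomial.order 0 p \<Longrightarrow> coeff p j = 0"
proof -
  obtain w where w: "p = [:0, 1:] ^ Polynomial.order 0 p * w" "\<not> [:0, 1:] dvd w"
    using order_decomp[OF assms, of 0] by auto
  have "coeff w 0 \<noteq> 0" using w(2) poly_eq_0_iff_dvd[of w 0] by (simp add: poly_0_coeff_0)
  moreover have c: "coeff p j = (if j < Polynomial.order 0 p then 0 else coeff w (j - Polynomial.order 0 p))" for j
    by (subst w(1)) (simp add: coeff_monom_mult flip: monom_altdef[of 1, simplified])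
  ultimately show "coeff p (Polynomial.order 0 p) \<noteq> 0" "j < Polynomial.order 0 p \<Longrightarrow> coeff p j = 0"
    by simp_all
qed

lemma eval2_monom: "unital_hom k \<Longrightarrow> eval2 k a b (monom (monom c i) j) = k c * a ^ i * b ^ j"
  by (simp add: extend_hom_monom unital_hom_extend)

lemma eval2_initial_form:
  "unital_hom k \<Longrightarrow> eval2 k a b (initial_form f) =
    (\<Sum>i\<le>mult_origin f. k (coeff2 f i (mult_origin f - i)) * a ^ i * b ^ (mult_origin f - i))"
  unfolding initial_form_def by (simp add: unital_hom_sum[OF unital_hom_eval2] eval2_monom)

text \<open>
  A line in the tangent cone gives a point of the proper transform: the value of the initial
  form at \<open>(1, t)\<close> is the value of the proper transform at the point of the exceptional curve
  with slope \<open>t\<close>.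
\<close>
lemma eval2_initial_form_Some: "eval2 (\<lambda>x. x) 1 t (initial_form f) = const_term (proper_transform f (Some t))"
proof -
  have "eval2 (\<lambda>x. x) 1 t (initial_form f) = (\<Sum>i\<le>mult_origin f. coeff2 f i (mult_origin f - i) * t ^ (mult_origin f - i))"
    by (simp add: eval2_initial_form unital_hom_id)
  also have "\<dots> = (\<Sum>j\<le>mult_origin f. coeff (tangent_poly f) j * t ^ j)"
    by (rule sum.reindex_bij_witness[of _ "\<lambda>i. mult_origin f - i" "\<lambda>i. mult_origin f - i"])
      (auto simp: coeff_tangent_poly)
  also have "\<dots> = poly (tangent_poly f) t"
    unfolding poly_altdef using degree_tangent_poly[of f]
    by (intro sum.mono_neutral_right) (auto simp: coeff_eq_0)
  finally show ?thesis by (simp add: const_term_Some)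
qed

lemma eval2_initial_form_None: "eval2 (\<lambda>x. x) 0 1 (initial_form f) = const_term (proper_transform f None)"
proof -
  have "eval2 (\<lambda>x. x) 0 1 (initial_form f) =
      (\<Sum>i\<le>mult_origin f. coeff2 f i (mult_origin f - i) * 0 ^ i * 1 ^ (mult_origin f - i))"
    by (rule eval2_initial_form[OF unital_hom_id])
  also have "\<dots> = (\<Sum>i\<le>mult_origin f. if i = 0 then coeff2 f 0 (mult_origin f) else 0)"
    by (intro sum.cong) auto
  finally have "eval2 (\<lambda>x. x) 0 1 (initial_form f) = coeff2 f 0 (mult_origin f)" by simp
  then show ?thesis by (simp add: const_term_None)
qed

lemma coeff_eval2_y0: "coeff (eval2 (\<lambda>c. [:c:]) [:0, 1:] 0 p) i = coeff2 p i 0"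
proof -
  have id: "extend_hom (\<lambda>c. [:c:]) [:0, 1:] q = q" for q :: "complex poly"
    by (rule unital_hom_eqI[OF unital_hom_extend[OF unital_hom_pconst] unital_hom_id])
      (simp_all add: unital_hom_pconst)
  show ?thesis
    by (cases p) (simp add: extend_hom_pCons unital_hom_extend unital_hom_pconst id coeff2_def)
qed

text \<open>
  The axis \<open>y = 0\<close> of the blow-up in direction \<open>t\<close> is the proper transform of the line
  \<open>y = t x\<close>.
\<close>
lemma proper_transform_Some_axis:
  "coeff2 (proper_transform f (Some t)) i 0 = coeff (eval2 (\<lambda>c. [:c:]) [:0, 1:] [:0, t:] f) (i + mult_origin f)"
  "j < mult_origin f \<Longrightarrow> coeff (eval2 (\<lambda>c. [:c:]) [:0, 1:] [:0, t:] f) j = 0"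
proof -
  let ?r = "eval2 (\<lambda>c. [:c:]) [:0, 1:] 0" and ?g = "proper_transform f (Some t)"
  note r = unital_hom_eval2[OF unital_hom_pconst]
  have "eval2 (\<lambda>c. [:c:]) [:0, 1:] [:0, t:] f = ?r (subst2 f var_x (var_x * (var_y + const2 t)))"
    by (rule poly2_hom_eqI[OF r unital_hom_comp[OF r unital_hom_subst2]])
      (simp_all add: unital_hom_pconst unital_homD[OF r])
  also have "\<dots> = ?r (var_x ^ mult_origin f * ?g)" by (simp only: proper_transform_Some)
  also have "coeff (?r (var_x ^ mult_origin f * ?g)) j = (if mult_origin f \<le> j then coeff2 ?g (j - mult_origin f) 0 else 0)" for j
    by (simp only: coeff_eval2_y0 coeff2_var_x_power)
  finally have *: "coeff (eval2 (\<lambda>c. [:c:]) [:0, 1:] [:0, t:] f) j = (if mult_origin f \<le> j then coeff2 ?g (j - mult_origin f) 0 else 0)" for j .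
  show "coeff2 ?g i 0 = coeff (eval2 (\<lambda>c. [:c:]) [:0, 1:] [:0, t:] f) (i + mult_origin f)" by (simp add: *)
  show "j < mult_origin f \<Longrightarrow> coeff (eval2 (\<lambda>c. [:c:]) [:0, 1:] [:0, t:] f) j = 0" by (simp add: *)
qed

lemma eval2_x0: "eval2 (\<lambda>c. [:c:]) 0 [:0, 1:] p = restrict_x0 p"
  by (rule poly2_hom_eqI[OF unital_hom_eval2[OF unital_hom_pconst] unital_hom_restrict_x0])
    (simp_all add: unital_hom_pconst, simp_all add: restrict_x0_def const2_def var_x_def var_y_def unital_hom_coeff_0)

theorem proposition5p1p1:
  fixes F :: poly3 and q :: point and d m n c :: nat
  assumes "integral_curve d F" and "d \<ge> 2"
    and "mn_point F q m n"
    and "c = gcd n m"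
  shows "delta_invariant F q \<ge> (real n * real m - real n - real m + real c) / 2 \<and>
    (c = 1 \<longrightarrow> delta_invariant F q = (real n * real m - real n - real m + real c) / 2)"
proof -
  have F: "homogeneous d F" "irreducible F" using assms(1) by (simp_all add: integral_curve_def)
  obtain L where uni: "unibranch F q" and m: "m = multiplicity_at F q" and tl: "tangent_line F q L"
    and n: "n = intersection_multiplicity F L q"
    using assms(3) unfolding mn_point_def by blast
  have on: "on_curve q F" and fib: "\<exists>!M. M \<in> normalization_fibre (local_eq F q)"
    using uni by (simp_all add: unibranch_def)
  have q0: "q \<noteq> (0, 0, 0)" using on by (simp add: on_curve_def)
  obtain \<delta> where loc: "\<And>F. local_eq F q = \<delta> F"
    and ct: "\<And>d F. homogeneous d F \<Longrightarrow> on_curve q F \<Longrightarrow> const_term (\<delta> F) = 0"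
    and pr: "\<And>d F. homogeneous d F \<Longrightarrow> d \<ge> 2 \<Longrightarrow> irreducible F \<Longrightarrow> on_curve q F \<Longrightarrow> prime_elem (\<delta> F)"
    and nd: "\<And>d F r s. homogeneous d F \<Longrightarrow> d \<ge> 2 \<Longrightarrow> irreducible F \<Longrightarrow> on_curve q F \<Longrightarrow> r \<noteq> 0 \<or> s \<noteq> 0 \<Longrightarrow>
      \<not> \<delta> F dvd const2 r * var_x + const2 s * var_y"
    and li: "\<And>L. line L \<Longrightarrow> on_curve q L \<Longrightarrow> \<exists>r s. (r \<noteq> 0 \<or> s \<noteq> 0) \<and> \<delta> L = const2 r * var_x + const2 s * var_y"
    using local_eq_properties[OF q0] by blast
  define f where "f = local_eq F q"
  note c2 = unital_homD[OF unital_hom_const2]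
  have nd': "\<not> f dvd const2 r * var_x + const2 s * var_y" if "r \<noteq> 0 \<or> s \<noteq> 0" for r s
    unfolding f_def loc by (rule nd[OF F(1) assms(2) F(2) on that])
  interpret affine_curve f
    by standard (use pr[OF F(1) assms(2) F(2) on] ct[OF F(1) on] in \<open>simp_all add: f_def loc\<close>)
  have "\<not> f dvd var_x" using nd'[of 1 0] by (simp add: c2)
  then obtain W where "dominating W" using dominating_exists fib unfolding f_def by blast
  then interpret unibranch_germ f W by unfold_locales
  have L: "line L" "on_curve q L" "local_eq L q dvd initial_form f"
    using tl by (simp_all add: tangent_line_def f_def)
  obtain r s where rs: "r \<noteq> 0 \<or> s \<noteq> 0" "local_eq L q = const2 r * var_x + const2 s * var_y"
    using li[OF L(1,2)] loc by metis
  define l where "l = const2 r * var_x + const2 s * var_y"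
  have n': "n = intersection_origin f l" by (simp add: n intersection_multiplicity_def f_def l_def rs)
  have m': "m = mult_origin f" by (simp add: m multiplicity_at_def f_def)
  have l_init: "l dvd initial_form f" using L(3) rs by (simp add: l_def)
  \<comment> \<open>the tangent line is not a component of the curve, so \<open>n\<close> is the order of a nonzero
    polynomial\<close>
  have nl: "\<not> l dvd f"
  proof
    assume "l dvd f"
    then obtain g where g: "f = l * g" by auto
    then have "f dvd l \<or> f dvd g" using prime by (metis dvd_refl prime_elem_dvd_mult_iff)
    then have "f dvd g" using nd'[OF rs(1)] by (auto simp: l_def)
    then obtain h where h: "g = f * h" by auto
    have "f * 1 = l * g" using g by simp
    also have "\<dots> = f * (l * h)" unfolding h by (simp only: mult_ac)
    finally have "f * 1 = f * (l * h)" .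
    then have "f = 0 \<or> 1 = l * h" by (simp only: mult_cancel_left)
    then have "1 = l * h" using prime not_prime_elem_zero by metis
    then have "const_term 1 = const_term (l * h)" by simp
    then show False by (simp add: const_term_simps l_def)
  qed
  have main: ?thesis if s: "const_term (proper_transform f z) = 0" and "n > m"
    and ax: "z = None \<Longrightarrow> coeff2 (proper_transform f z) 0 (n - m) \<noteq> 0 \<and> (\<forall>j<n - m. coeff2 (proper_transform f z) 0 j = 0)"
      "z \<noteq> None \<Longrightarrow> coeff2 (proper_transform f z) (n - m) 0 \<noteq> 0 \<and> (\<forall>i<n - m. coeff2 (proper_transform f z) i 0 = 0)" for z
  proof -
    have "n = m + (n - m)" "n - m > 0" using \<open>n > m\<close> by simp_all
    then have "2 * delta_origin f \<ge> real n * real m - real n - real m + real (gcd n m) \<and>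
      (gcd n m = 1 \<longrightarrow> 2 * delta_origin f = real n * real m - real n - real m + real (gcd n m))"
      using delta_after_tangent_blowup[OF chart_base s m' _ ax] by metis
    then show ?thesis by (auto simp: delta_invariant_def f_def assms(4))
  qed
  show ?thesis
  proof (cases "s = 0")
    case False
    define t where "t = - r / s"
    let ?\<rho> = "eval2 (\<lambda>c. [:c:]) [:0, 1:] [:0, t:]"
    have rst: "r + s * t = 0" using False by (simp add: t_def)
    have y: "l * const2 (inverse s) = var_y - const2 t * var_x"
    proof -
      have "l * const2 (inverse s) = const2 (r * inverse s) * var_x + const2 (s * inverse s) * var_y"
        by (simp add: l_def c2 algebra_simps)
      also have "r * inverse s = - t" using False by (simp add: t_def field_simps)
      finally show ?thesis using False by (simp add: c2)
    qed
    have dv: "l dvd var_x - const2 1 * var_x" "l dvd var_y - const2 t * var_x"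
      by (simp add: c2) (metis dvd_triv_left y)
    have \<rho>0: "?\<rho> f \<noteq> 0"
    proof
      assume "?\<rho> f = 0"
      then show False using line_reduction[OF dv, of f] nl by simp
    qed
    have n_ord: "n = Polynomial.order 0 (?\<rho> f)"
      unfolding n' by (rule intersection_with_line[OF dv _ _ \<rho>0])
        (use rst in \<open>simp_all add: l_def unital_homD[OF unital_hom_eval2[OF unital_hom_pconst]] unital_hom_pconst mult.commute\<close>)
    note co = poly_at_0_coeffs[OF \<rho>0, folded n_ord] and ax = proper_transform_Some_axis[where f = f and t = t, folded m']
    have on_t: "const_term (proper_transform f (Some t)) = 0"
    proof -
      obtain h where "initial_form f = l * h" using l_init by auto
      then have "eval2 (\<lambda>x. x) 1 t (initial_form f) = 0"
        using rst by (simp add: l_def unital_homD[OF unital_hom_eval2[OF unital_hom_id]] unital_hom_id)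
      then show ?thesis by (simp add: eval2_initial_form_Some)
    qed
    have "coeff (?\<rho> f) m = 0" using on_t ax(1)[of 0] by (simp add: const_term_def)
    then have nm: "n > m" using co(1) ax(2)[of n] by (metis linorder_neqE_nat)
    show ?thesis
      by (rule main[OF on_t nm]) (use nm co in \<open>auto simp: ax(1)\<close>)
  next
    case True
    then have r: "r \<noteq> 0" using rs(1) by simp
    have lx: "l = const2 r * var_x" using True by (simp add: l_def c2)
    let ?\<rho> = "eval2 (\<lambda>c. [:c:]) [:0, 0:] [:0, 1:]"
    have "l * const2 (inverse r) = var_x"
    proof -
      have "l * const2 (inverse r) = const2 (r * inverse r) * var_x" by (simp add: lx c2)
      then show ?thesis using r by (simp add: c2)
    qed
    then have dv: "l dvd var_x - const2 0 * var_y" "l dvd var_y - const2 1 * var_y"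
      by (simp_all add: c2) (metis dvd_triv_left)
    have \<rho>0: "?\<rho> f \<noteq> 0"
    proof
      assume "?\<rho> f = 0"
      then show False using line_reduction[OF dv, of f] nl by simp
    qed
    have n_ord: "n = Polynomial.order 0 (?\<rho> f)"
      unfolding n' by (rule intersection_with_line[OF dv _ _ \<rho>0])
        (simp_all add: lx unital_homD[OF unital_hom_eval2[OF unital_hom_pconst]] unital_hom_pconst)
    have \<rho>c: "coeff (?\<rho> f) j = coeff2 f 0 j" for j by (simp add: eval2_x0 coeff_restrict_x0)
    note co = poly_at_0_coeffs[OF \<rho>0, folded n_ord, unfolded \<rho>c]
    have ax: "coeff2 (proper_transform f None) 0 j = coeff2 f 0 (j + m)" for j
      by (simp add: coeff2_proper_transform_None m')
    have on_n: "const_term (proper_transform f None) = 0"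
    proof -
      obtain h where "initial_form f = l * h" using l_init by auto
      then have "eval2 (\<lambda>x. x) 0 1 (initial_form f) = 0"
        by (simp add: lx unital_homD[OF unital_hom_eval2[OF unital_hom_id]] unital_hom_id)
      then show ?thesis by (simp add: eval2_initial_form_None)
    qed
    have "coeff2 f 0 m = 0" using on_n by (simp add: const_term_None m')
    moreover have "n \<ge> m" using mult_origin_le[OF co(1)] by (simp add: m')
    ultimately have nm: "n > m" using co(1) le_neq_implies_less by blast
    show ?thesis
      by (rule main[OF on_n nm]) (use nm co in \<open>auto simp: ax\<close>)
  qed
qed

end
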